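(* Let $k\subseteq l$ be distinct algebraic number fields such that $k$ is neither $\mathbb{Q}$ nor an imaginary quadratic field, and $r(l)>r(k)$. Let $\beta_1,\dots,\beta_{r(k)}$ be multiplicatively independent elements of $F_k$ satisfying \[ \prod_{i=1}^{r(k)}\bigl([k:\mathbb{Q}]\,h(\beta_i)\bigr)\le r(k)!\,\mathrm{Reg}(k), \] and let $\psi_1,\dots,\psi_{r(l/k)}$ be multiplicatively independent elements of $E_{l/k}$ satisfying \[ \prod_{j=1}^{r(l/k)}\bigl([l:\mathbb{Q}]\,h(\psi_j)\bigr)\le r(l/k)!\,\mathrm{Reg}(E_{l/k}). \] Then the elements of $\{\beta_1,\dots,\beta_{r(k)}\}\cup\{\psi_1,\dots,\psi_{r(l/k)}\}$ are multiplicatively independent units in $F_l$, and \[ \prod_{i=1}^{r(k)}\bigl([k:\mathbb{Q}]\,h(\beta_i)\bigr)\prod_{j=1}^{r(l/k)}\bigl([l:\mathbb{Q}]\,h(\psi_j)\bigr)\le r(l)!\,\mathrm{Reg}(l). \]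
   Context: For a number field $K$, $r(K)$ is the rank of $O_K^{\times}$, $\mathrm{Reg}(K)$ its regulator, and $F_K=O_K^{\times}/\mathrm{Tor}(O_K^{\times})$; $F_k$ is regarded as a subgroup of $F_l$ via $\alpha\,\mathrm{Tor}(O_k^{\times})\mapsto\alpha\,\mathrm{Tor}(O_l^{\times})$. The norm induces $\mathrm{norm}_{l/k}:F_l\to F_k$, and $E_{l/k}=\{\alpha\in F_l:\mathrm{norm}_{l/k}(\alpha)=1\}$ is the group of relative units, of rank $r(l/k)=r(l)-r(k)$. Absolute values: for each place $w$ of a number field $L$, $\|\cdot\|_w$ extends the usual archimedean (if $w\mid\infty$) or $p$-adic (if $w\mid p$) absolute value of $\mathbb{Q}$, and $|\cdot|_w=\|\cdot\|_w^{[L_w:\mathbb{Q}_w]/[L:\mathbb{Q}]}$. The absolute logarithmic Weil height is $h(\alpha)=\sum_w\log^+|\alpha|_w$, independent of $L\ni\alpha$ and zero on roots of unity, hence defined on $F_L$. Relative regulator: for each archimedean place $v$ of $k$ choose a place $\widehat w_v$ of $l$ above $v$; let $S(l/k)$ be the set of archimedean places of $l$ other than the $\widehat w_v$ (so $|S(l/k)|=r(l/k)$). For a basis $\eta_1,\dots,\eta_{r(l/k)}$ of $E_{l/k}$, $\mathrm{Reg}(E_{l/k})=\bigl|\det\bigl([l_w:\mathbb{Q}_w]\log\|\eta_j\|_w\bigr)_{w\in S(l/k),\,1\le j\le r(l/k)}\bigr|$, independent of the choices. *)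

theory Defs
  imports
    "HOL-Algebra.Algebra"
    "HOL-Algebra.Algebraic_Closure_Type"
    "HOL-Analysis.Infinite_Sum"
    "Jordan_Normal_Form.Determinant"
begin

section \<open>Number fields\<close>

text \<open>
  A number field is a subfield of an arbitrary ambient field of characteristic 0, given as a set,
  whose dimension over the prime field \<open>\<rat>\<close> is finite.
\<close>

abbreviation ambient :: "'a::field_char_0 ring" where
  "ambient \<equiv> ring_of_type_algebra"

definition number_field :: "'a::field_char_0 set \<Rightarrow> bool" where
  "number_field K \<longleftrightarrow> subfield K ambient \<and> ring.finite_dimension ambient \<rat> K"

definition field_degree :: "'a::field_char_0 set \<Rightarrow> nat" where
  "field_degree K = ring.dim ambient \<rat> K"

definition imaginary_quadratic :: "'a::field_char_0 set \<Rightarrow> bool" where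
  "imaginary_quadratic K \<longleftrightarrow>
     (\<exists>d s. d < (0::rat) \<and> s\<^sup>2 = of_rat d \<and> K = {of_rat a + of_rat b * s | a b. True})"

text \<open>
  The norm of \<open>x\<close> is the determinant of multiplication by \<open>x\<close> on the \<open>k\<close>-vector space \<open>l\<close>;
  it does not depend on the chosen basis.
\<close>

definition field_norm :: "'a::field_char_0 set \<Rightarrow> 'a set \<Rightarrow> 'a \<Rightarrow> 'a" where
  "field_norm l k x = (SOME d. \<exists>bs A.
     ring.independent ambient k bs \<and> ring.Span ambient k bs = l \<and>
     A \<in> carrier_mat (length bs) (length bs) \<and>
     (\<forall>i<length bs. \<forall>j<length bs. A $$ (i, j) \<in> k) \<and>
     (\<forall>j<length bs. x * bs ! j = (\<Sum>i<length bs. A $$ (i, j) * bs ! i)) \<and>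
     d = Determinant.det A)"


section \<open>Abelian groups\<close>

definition torsion :: "('g, 'b) monoid_scheme \<Rightarrow> 'g set" where
  "torsion G = {x \<in> carrier G. \<exists>n>0. x [^]\<^bsub>G\<^esub> (n::nat) = \<one>\<^bsub>G\<^esub>}"

definition mult_independent :: "('g, 'b) monoid_scheme \<Rightarrow> 'i set \<Rightarrow> ('i \<Rightarrow> 'g) \<Rightarrow> bool" where
  "mult_independent G I x \<longleftrightarrow> finite I \<and> x \<in> I \<rightarrow> carrier G \<and>
     (\<forall>e::'i \<Rightarrow> int. finprod G (\<lambda>i. x i [^]\<^bsub>G\<^esub> e i) I = \<one>\<^bsub>G\<^esub> \<longrightarrow> (\<forall>i\<in>I. e i = 0))"

definition group_rank :: "('g, 'b) monoid_scheme \<Rightarrow> nat" where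
  "group_rank G = (GREATEST n. \<exists>x. mult_independent G {..<n} x)"

definition group_basis :: "('g, 'b) monoid_scheme \<Rightarrow> 'g list \<Rightarrow> bool" where
  "group_basis G us \<longleftrightarrow>
     mult_independent G {..<length us} (\<lambda>i. us ! i) \<and> generate G (set us) = carrier G"


section \<open>Units and relative units\<close>

definition integers_ring :: "'a::field_char_0 set \<Rightarrow> 'a ring" where
  "integers_ring K = ambient\<lparr>carrier := {x \<in> K. algebraic_int x}\<rparr>"

definition unit_group :: "'a::field_char_0 set \<Rightarrow> 'a monoid" where
  "unit_group K = units_of (integers_ring K)"

definition unit_rank :: "'a::field_char_0 set \<Rightarrow> nat" where
  "unit_rank K = group_rank (unit_group K)"

definition rel_unit_rank :: "'a::field_char_0 set \<Rightarrow> 'a set \<Rightarrow> nat" where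
  "rel_unit_rank l k = unit_rank l - unit_rank k"

definition units_mod_tor :: "'a::field_char_0 set \<Rightarrow> 'a set monoid" where
  "units_mod_tor K = unit_group K Mod torsion (unit_group K)"

text \<open>
  Elements of \<open>units_mod_tor K\<close> are cosets. The product of a coset (or of its image under
  the norm) with the torsion subgroup of the target is the coset of the image of any representative.
\<close>

definition F_embed :: "'a::field_char_0 set \<Rightarrow> 'a set \<Rightarrow> 'a set" where
  "F_embed l A = torsion (unit_group l) <#>\<^bsub>unit_group l\<^esub> A"

definition F_norm :: "'a::field_char_0 set \<Rightarrow> 'a set \<Rightarrow> 'a set \<Rightarrow> 'a set" where
  "F_norm l k A = torsion (unit_group k) <#>\<^bsub>unit_group k\<^esub> (field_norm l k ` A)"

definition rel_units :: "'a::field_char_0 set \<Rightarrow> 'a set \<Rightarrow> 'a set monoid" where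
  "rel_units l k = (units_mod_tor l)
     \<lparr>carrier := {A \<in> carrier (units_mod_tor l). F_norm l k A = \<one>\<^bsub>units_mod_tor k\<^esub>}\<rparr>"


section \<open>Places\<close>

text \<open>
  A place \<open>w\<close> of \<open>L\<close> is represented by its normalized absolute value \<open>\<parallel>\<cdot>\<parallel>\<^sub>w\<close>, the only absolute
  value in its class that restricts to the usual archimedean or \<open>p\<close>-adic absolute value on \<open>\<rat>\<close>.
  It is taken to be \<open>extensional\<close>, so that it is determined by its values on \<open>L\<close>.
\<close>

definition absolute_value :: "'a::field_char_0 set \<Rightarrow> ('a \<Rightarrow> real) \<Rightarrow> bool" where
  "absolute_value L w \<longleftrightarrow> w \<in> extensional L \<and>
     (\<forall>x\<in>L. w x \<ge> 0 \<and> (w x = 0 \<longleftrightarrow> x = 0)) \<and>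
     (\<forall>x\<in>L. \<forall>y\<in>L. w (x * y) = w x * w y \<and> w (x + y) \<le> w x + w y)"

definition padic_abs :: "nat \<Rightarrow> rat \<Rightarrow> real" where
  "padic_abs p q = (if q = 0 then 0 else
     real p powi (int (multiplicity (int p) (snd (quotient_of q)))
                - int (multiplicity (int p) (fst (quotient_of q)))))"

definition arch_places :: "'a::field_char_0 set \<Rightarrow> ('a \<Rightarrow> real) set" where
  "arch_places L = {w. absolute_value L w \<and> (\<forall>q. w (of_rat q) = \<bar>of_rat q\<bar>)}"

definition finite_places :: "'a::field_char_0 set \<Rightarrow> ('a \<Rightarrow> real) set" where
  "finite_places L =
     {w. absolute_value L w \<and>
        (\<exists>p. Factorial_Ring.prime p \<and> (\<forall>q. w (of_rat q) = padic_abs p q))}"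

text \<open>
  The completion \<open>L\<^sub>w\<close> is the ring of Cauchy sequences modulo null sequences; the completion
  \<open>\<rat>\<^sub>w\<close> sits inside it as the classes of the rational Cauchy sequences.
\<close>

definition cauchy_ring :: "'a::field_char_0 set \<Rightarrow> ('a \<Rightarrow> real) \<Rightarrow> (nat \<Rightarrow> 'a) ring" where
  "cauchy_ring L w =
     \<lparr>carrier = {s. (\<forall>n. s n \<in> L) \<and> (\<forall>e>0. \<exists>N. \<forall>m\<ge>N. \<forall>n\<ge>N. w (s m - s n) < e)},
      monoid.mult = (\<lambda>s t n. s n * t n), one = (\<lambda>n. 1),
      ring.zero = (\<lambda>n. 0), add = (\<lambda>s t n. s n + t n)\<rparr>"

definition null_ideal :: "'a::field_char_0 set \<Rightarrow> ('a \<Rightarrow> real) \<Rightarrow> (nat \<Rightarrow> 'a) set" where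
  "null_ideal L w = {s \<in> carrier (cauchy_ring L w). (\<lambda>n. w (s n)) \<longlonglongrightarrow> 0}"

definition completion :: "'a::field_char_0 set \<Rightarrow> ('a \<Rightarrow> real) \<Rightarrow> (nat \<Rightarrow> 'a) set ring" where
  "completion L w = cauchy_ring L w Quot null_ideal L w"

definition rat_completion :: "'a::field_char_0 set \<Rightarrow> ('a \<Rightarrow> real) \<Rightarrow> (nat \<Rightarrow> 'a) set set" where
  "rat_completion L w =
     (\<lambda>s. null_ideal L w +>\<^bsub>cauchy_ring L w\<^esub> s) `
       {s \<in> carrier (cauchy_ring L w). \<forall>n. s n \<in> \<rat>}"

definition local_degree :: "'a::field_char_0 set \<Rightarrow> ('a \<Rightarrow> real) \<Rightarrow> nat" where
  "local_degree L w =
     ring.dim (completion L w) (rat_completion L w) (carrier (completion L w))"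


section \<open>Heights\<close>

text \<open>
  The value does not depend on the number field \<open>L\<close> containing \<open>x\<close>; all but finitely many
  terms of the sum vanish.
\<close>

definition weil_height :: "'a::field_char_0 set \<Rightarrow> 'a \<Rightarrow> real" where
  "weil_height L x = (\<Sum>\<^sub>\<infinity>w \<in> arch_places L \<union> finite_places L.
     ln (max 1 (w x powr (real (local_degree L w) / real (field_degree L)))))"

text \<open>
  Absolute values and heights are constant on cosets of the torsion subgroup.
\<close>

definition F_height :: "'a::field_char_0 set \<Rightarrow> 'a set \<Rightarrow> real" where
  "F_height L A = the_elem (weil_height L ` A)"

definition F_abs :: "('a \<Rightarrow> real) \<Rightarrow> 'a set \<Rightarrow> real" where
  "F_abs w A = the_elem (w ` A)"


section \<open>Regulators\<close>

definition log_det :: "'a::field_char_0 set \<Rightarrow> ('a \<Rightarrow> real) list \<Rightarrow> 'a set list \<Rightarrow> real" where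
  "log_det L ws us = \<bar>Determinant.det (mat (length ws) (length us)
     (\<lambda>(i, j). real (local_degree L (ws ! i)) * ln (F_abs (ws ! i) (us ! j))))\<bar>"

text \<open>
  The list \<open>ws\<close> enumerates the rows, i.e. all archimedean places except the omitted ones. By
  Dirichlet's unit theorem the matrices are square, and their determinants do not depend, up to
  sign, on any of the choices.
\<close>

definition regulator :: "'a::field_char_0 set \<Rightarrow> real" where
  "regulator K = (SOME R. \<exists>w0 ws us.
     w0 \<in> arch_places K \<and> distinct ws \<and> set ws = arch_places K - {w0} \<and>
     group_basis (units_mod_tor K) us \<and> R = log_det K ws us)"

definition rel_regulator :: "'a::field_char_0 set \<Rightarrow> 'a set \<Rightarrow> real" where
  "rel_regulator l k = (SOME R. \<exists>c ws us.
     (\<forall>v\<in>arch_places k. c v \<in> arch_places l \<and> restrict (c v) k = v) \<and>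
     distinct ws \<and> set ws = arch_places l - c ` arch_places k \<and>
     group_basis (rel_units l k) us \<and> R = log_det l ws us)"

end

theory Submission
  imports Defs "HOL-Library.Function_Algebras" "Jordan_Normal_Form.Char_Poly"
begin

text \<open>
  Taking logarithms at the archimedean places turns the units modulo torsion of \<open>k\<close> and \<open>l\<close> into
  lattices of real functions. Summing a function over the places above each place of \<open>k\<close>
  corresponds to the norm, so its kernel on the lattice of \<open>l\<close> is the lattice of relative units.
  A basis of the latter together with lifts of a basis of the image of the norm is a basis of the
  lattice of \<open>l\<close>. In coordinates adapted to it the logarithm matrix is block triangular, whence
  \<open>Reg(l) = [F\<^sub>k : norm F\<^sub>l] Reg(k) Reg(E) \<ge> Reg(k) Reg(E)\<close>, and \<open>r(k)! r(l/k)! \<le> r(l)!\<close> gives the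
  bound. Independence follows since the norm kills relative units and raises units of \<open>k\<close> to the
  power \<open>[l : k]\<close>.

  The lower bound for the rank in Dirichlet's unit theorem plays no role: \<open>det\<close> is 0 on
  non-square matrices, so a deficient rank makes one of the two regulators on the left vanish.
\<close>

section \<open>Determinants of families\<close>

definition fdet :: "nat \<Rightarrow> (nat \<Rightarrow> nat \<Rightarrow> 'b::comm_ring_1) \<Rightarrow> 'b" where
  "fdet n f = Determinant.det (mat n n (\<lambda>(i, j). f i j))"

lemma fdet_cong:
  assumes "\<And>i j. i < n \<Longrightarrow> j < n \<Longrightarrow> f i j = g i j"
  shows "fdet n f = fdet n g"
  unfolding fdet_def by (intro arg_cong[of _ _ Determinant.det] eq_matI) (auto simp: assms)

lemma fdet_leibniz:
  "fdet n f = (\<Sum>p | p permutes {0..<n}. signof p * (\<Prod>i = 0..<n. f i (p i)))"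
  unfolding fdet_def
proof (subst det_def'[of _ n], simp, intro sum.cong refl arg_cong2[of _ _ _ _ times] prod.cong)
  fix p i assume "p \<in> {p. p permutes {0..<n}}" "i \<in> {0..<n}"
  thus "mat n n (\<lambda>(i, j). f i j) $$ (i, p i) = f i (p i)"
    using permutes_in_image[of p "{0..<n}" i] by simp
qed

lemma fdet_mult: "fdet n (\<lambda>i j. \<Sum>m<n. f i m * g m j) = fdet n f * fdet n g"
proof -
  let ?F = "mat n n (\<lambda>(i, j). f i j)" and ?G = "mat n n (\<lambda>(i, j). g i j)"
  have "mat n n (\<lambda>(i, j). \<Sum>m<n. f i m * g m j) = ?F * ?G"
    by (rule eq_matI) (auto simp: scalar_prod_def atLeast0LessThan)
  thus ?thesis unfolding fdet_def by (simp add: det_mult[of _ n])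
qed

lemma fdet_scale_rows: "fdet n (\<lambda>i j. d i * f i j) = (\<Prod>i<n. d i) * fdet n f"
  unfolding fdet_leibniz by (simp add: prod.distrib sum_distrib_left atLeast0LessThan mult_ac)

lemma fdet_transpose: "fdet n (\<lambda>i j. f j i) = fdet n f"
proof -
  have "mat n n (\<lambda>(i, j). f j i) = transpose_mat (mat n n (\<lambda>(i, j). f i j))"
    by (rule eq_matI) auto
  thus ?thesis unfolding fdet_def by (simp add: det_transpose[of _ n])
qed

lemma fdet_of_int: "fdet n (\<lambda>i j. of_int (f i j)) = (of_int (fdet n f) :: 'b::comm_ring_1)"
proof -
  have "mat n n (\<lambda>(i, j). of_int (f i j) :: 'b) = map_mat of_int (mat n n (\<lambda>(i, j). f i j))"
    by (rule eq_matI) auto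
  thus ?thesis unfolding fdet_def by (simp add: of_int_hom.hom_det)
qed

lemma fdet_block_triangular:
  fixes f :: "nat \<Rightarrow> nat \<Rightarrow> 'b::idom"
  assumes "\<And>i j. i < n \<Longrightarrow> j < m \<Longrightarrow> f (m + i) j = 0"
  shows "fdet (m + n) f = fdet m f * fdet n (\<lambda>i j. f (m + i) (m + j))"
proof -
  let ?A = "mat m m (\<lambda>(i, j). f i j)" and ?B = "mat m n (\<lambda>(i, j). f i (m + j))"
    and ?D = "mat n n (\<lambda>(i, j). f (m + i) (m + j))"
  have "mat (m + n) (m + n) (\<lambda>(i, j). f i j) = four_block_mat ?A ?B (0\<^sub>m n m) ?D"
  proof (rule eq_matI)
    fix i j assume "i < dim_row (four_block_mat ?A ?B (0\<^sub>m n m) ?D)"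
      "j < dim_col (four_block_mat ?A ?B (0\<^sub>m n m) ?D)"
    hence "i < m + n" "j < m + n" by auto
    thus "mat (m + n) (m + n) (\<lambda>(i, j). f i j) $$ (i, j)
        = four_block_mat ?A ?B (0\<^sub>m n m) ?D $$ (i, j)"
      using assms[of "i - m" j] by auto
  qed auto
  thus ?thesis unfolding fdet_def
    by (simp add: det_four_block_mat_lower_left_zero[of _ m _ n])
qed

lemma fdet_eq_0_imp_null_vector:
  fixes f :: "nat \<Rightarrow> nat \<Rightarrow> 'b::idom"
  assumes "fdet n f = 0"
  obtains c where "\<exists>j<n. c j \<noteq> 0" "\<And>i. i < n \<Longrightarrow> (\<Sum>j<n. f i j * c j) = 0"
proof -
  let ?F = "mat n n (\<lambda>(i, j). f i j)"
  obtain v where v: "v \<in> carrier_vec n" "v \<noteq> 0\<^sub>v n" "?F *\<^sub>v v = 0\<^sub>v n"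
    using assms det_0_iff_vec_prod_zero[of ?F n] unfolding fdet_def by auto
  have "\<exists>j<n. v $ j \<noteq> 0"
    using v(1,2) by (metis carrier_vecD dim_vec eq_vecI index_zero_vec(1) index_zero_vec(2))
  moreover have "(\<Sum>j<n. f i j * v $ j) = 0" if "i < n" for i
  proof -
    have "(?F *\<^sub>v v) $ i = 0" using v(3) that by simp
    thus ?thesis using that v(1) by (simp add: scalar_prod_def atLeast0LessThan)
  qed
  ultimately show ?thesis by (rule that)
qed

lemma underdetermined_system_has_solution:
  fixes f :: "nat \<Rightarrow> nat \<Rightarrow> 'b::idom"
  assumes "n < m"
  obtains c where "\<exists>j<m. c j \<noteq> 0" "\<And>i. i < n \<Longrightarrow> (\<Sum>j<m. f i j * c j) = 0"
proof -
  define g where "g = (\<lambda>i j. if i < n then f i j else 0)"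
  have "(\<Prod>i = 0..<m. g i (p i)) = 0" for p :: "nat \<Rightarrow> nat"
    using assms by (intro prod_zero bexI[of _ n]) (auto simp: g_def)
  hence "fdet m g = 0"
    unfolding fdet_leibniz by (intro sum.neutral ballI) (simp only: mult_zero_right)
  then obtain c where c: "\<exists>j<m. c j \<noteq> 0" "\<And>i. i < m \<Longrightarrow> (\<Sum>j<m. g i j * c j) = 0"
    using fdet_eq_0_imp_null_vector by blast
  have "(\<Sum>j<m. f i j * c j) = 0" if "i < n" for i
    using c(2)[of i] that assms by (simp add: g_def)
  with c(1) show ?thesis by (rule that)
qed

lemma fdet_nonzero_imp_inverse:
  fixes f :: "nat \<Rightarrow> nat \<Rightarrow> 'b::field"
  assumes "fdet n f \<noteq> 0"
  obtains g where
    "\<And>i j. i < n \<Longrightarrow> j < n \<Longrightarrow> (\<Sum>m<n. f i m * g m j) = (if i = j then 1 else 0)"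
    "\<And>i j. i < n \<Longrightarrow> j < n \<Longrightarrow> (\<Sum>m<n. g i m * f m j) = (if i = j then 1 else 0)"
proof -
  let ?F = "mat n n (\<lambda>(i, j). f i j)"
  have "?F \<in> Units (ring_mat TYPE('b) n ())"
    using assms unfolding fdet_def by (intro det_non_zero_imp_unit) auto
  then obtain G where G: "G \<in> carrier_mat n n" "?F * G = 1\<^sub>m n" "G * ?F = 1\<^sub>m n"
    unfolding Units_def ring_mat_def by auto
  show ?thesis
  proof (rule that[of "\<lambda>i j. G $$ (i, j)"])
    fix i j assume ij: "i < n" "j < n"
    have "(?F * G) $$ (i, j) = (\<Sum>m<n. f i m * G $$ (m, j))"
      using ij G(1) by (simp add: scalar_prod_def atLeast0LessThan)
    thus "(\<Sum>m<n. f i m * G $$ (m, j)) = (if i = j then 1 else 0)" using ij by (simp add: G(2))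
    have "(G * ?F) $$ (i, j) = (\<Sum>m<n. G $$ (i, m) * f m j)"
      using ij G(1) by (simp add: scalar_prod_def atLeast0LessThan)
    thus "(\<Sum>m<n. G $$ (i, m) * f m j) = (if i = j then 1 else 0)" using ij by (simp add: G(3))
  qed
qed


section \<open>Integer combinations in real vector spaces\<close>

instantiation "fun" :: (type, real_vector) real_vector
begin

definition scaleR_fun :: "real \<Rightarrow> ('a \<Rightarrow> 'b) \<Rightarrow> 'a \<Rightarrow> 'b" where
  "scaleR_fun c f = (\<lambda>x. c *\<^sub>R f x)"

instance
  by standard (simp_all add: scaleR_fun_def fun_eq_iff algebra_simps)

end

lemma scaleR_fun_apply [simp]: "(c *\<^sub>R f) x = c *\<^sub>R f x"
  by (simp add: scaleR_fun_def)

lemma sum_fun_apply [simp]: "(\<Sum>i\<in>I. f i) x = (\<Sum>i\<in>I. f i x)"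
  by (induction I rule: infinite_finite_induct) simp_all

global_interpretation int_vec: Modules.module "\<lambda>(m::int) (x::'v::real_vector). of_int m *\<^sub>R x"
  defines int_subspace = int_vec.subspace
    and int_span = int_vec.span
  by standard (simp_all add: algebra_simps)

lemma int_subspaceI:
  assumes "0 \<in> A" and diff: "\<And>x y. x \<in> A \<Longrightarrow> y \<in> A \<Longrightarrow> x - y \<in> A"
  shows "int_subspace A"
proof (rule int_vec.subspaceI)
  have add: "x + y \<in> A" if "x \<in> A" "y \<in> A" for x y
    using diff[OF that(1) diff[OF \<open>0 \<in> A\<close> that(2)]] by simp
  thus "x + y \<in> A" if "x \<in> A" "y \<in> A" for x y using that by blast
  fix m :: int and x assume "x \<in> A"
  show "of_int m *\<^sub>R x \<in> A"
  proof (induction m rule: int_induct[of _ 0])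
    case base
    show ?case using \<open>0 \<in> A\<close> by simp
  next
    case (step1 i)
    thus ?case using add[OF step1(2) \<open>x \<in> A\<close>] by (simp add: algebra_simps)
  next
    case (step2 i)
    thus ?case using diff[OF step2(2) \<open>x \<in> A\<close>] by (simp add: algebra_simps)
  qed
qed fact

lemma int_span_image:
  assumes "finite I"
  shows "int_span (b ` I) = range (\<lambda>e. \<Sum>i\<in>I. of_int (e i) *\<^sub>R b i)" (is "_ = ?R")
proof (rule antisym)
  have "int_subspace ?R"
  proof (rule int_subspaceI)
    show "0 \<in> ?R" by (rule range_eqI[of _ _ "\<lambda>_. 0"]) simp
    fix x y assume "x \<in> ?R" "y \<in> ?R"
    then obtain d e where "x = (\<Sum>i\<in>I. of_int (d i) *\<^sub>R b i)" "y = (\<Sum>i\<in>I. of_int (e i) *\<^sub>R b i)"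
      by blast
    thus "x - y \<in> ?R"
      by (intro range_eqI[of _ _ "\<lambda>i. d i - e i"]) (simp add: algebra_simps sum_subtractf)
  qed
  moreover have "b j \<in> ?R" if "j \<in> I" for j
  proof (rule range_eqI[of _ _ "\<lambda>i. if i = j then 1 else 0"])
    have "(\<Sum>i\<in>I. of_int (if i = j then 1 else 0) *\<^sub>R b i) = (\<Sum>i\<in>I. if i = j then b i else 0)"
      by (intro sum.cong) auto
    thus "b j = (\<Sum>i\<in>I. of_int (if i = j then 1 else 0) *\<^sub>R b i)" using assms that by simp
  qed
  ultimately show "int_span (b ` I) \<subseteq> ?R" by (intro int_vec.span_minimal) auto
  show "?R \<subseteq> int_span (b ` I)"
    by (auto intro!: int_vec.span_sum int_vec.span_scale intro: int_vec.span_base)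
qed

lemma int_coefficients:
  assumes "finite I" and "\<And>j. j \<in> J \<Longrightarrow> x j \<in> int_span (b ` I)"
  obtains P where "\<And>j. j \<in> J \<Longrightarrow> x j = (\<Sum>i\<in>I. of_int (P i j) *\<^sub>R b i)"
proof -
  have "\<forall>j\<in>J. \<exists>e. x j = (\<Sum>i\<in>I. of_int (e i) *\<^sub>R b i)"
    using assms(2) unfolding int_span_image[OF \<open>finite I\<close>] by blast
  then obtain e where "\<forall>j\<in>J. x j = (\<Sum>i\<in>I. of_int (e j i) *\<^sub>R b i)" by metis
  thus ?thesis by (intro that[of "\<lambda>i j. e j i"]) simp
qed

definition int_independent :: "'i set \<Rightarrow> ('i \<Rightarrow> 'v::real_vector) \<Rightarrow> bool" where
  "int_independent I b \<longleftrightarrow>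
     (\<forall>e::'i \<Rightarrow> int. (\<Sum>i\<in>I. of_int (e i) *\<^sub>R b i) = 0 \<longrightarrow> (\<forall>i\<in>I. e i = 0))"

lemma int_independentD:
  "int_independent I b \<Longrightarrow> (\<Sum>i\<in>I. of_int (e i) *\<^sub>R b i) = 0 \<Longrightarrow> i \<in> I \<Longrightarrow> e i = (0::int)"
  by (simp add: int_independent_def)

lemma int_independent_cong:
  "(\<And>i. i \<in> I \<Longrightarrow> b i = c i) \<Longrightarrow> int_independent I b \<longleftrightarrow> int_independent I c"
  by (simp add: int_independent_def)

lemma int_independent_scale:
  assumes "int_independent I b" and "d \<noteq> (0::int)"
  shows "int_independent I (\<lambda>i. of_int d *\<^sub>R b i)"
  unfolding int_independent_def
proof (intro allI impI ballI)
  fix e :: "'a \<Rightarrow> int" and i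
  assume "(\<Sum>i\<in>I. of_int (e i) *\<^sub>R of_int d *\<^sub>R b i) = 0" and "i \<in> I"
  hence "e i * d = 0" using int_independentD[OF assms(1), of "\<lambda>i. e i * d"] by simp
  thus "e i = 0" using \<open>d \<noteq> 0\<close> by simp
qed

lemma int_independent_reindex:
  assumes "bij_betw g J I" and "int_independent I b"
  shows "int_independent J (\<lambda>j. b (g j))"
  unfolding int_independent_def
proof (intro allI impI ballI)
  fix e :: "'a \<Rightarrow> int" and j
  assume relation: "(\<Sum>j\<in>J. of_int (e j) *\<^sub>R b (g j)) = 0" and "j \<in> J"
  let ?g' = "the_inv_into J g"
  have inverse: "?g' (g j) = j" if "j \<in> J" for j
    using assms(1) that by (simp add: bij_betw_def the_inv_into_f_f)
  have "(\<Sum>i\<in>I. of_int (e (?g' i)) *\<^sub>R b i) = (\<Sum>j\<in>J. of_int (e (?g' (g j))) *\<^sub>R b (g j))"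
    by (rule sum.reindex_bij_betw[OF assms(1), symmetric])
  also have "\<dots> = 0" using relation inverse by simp
  finally have "e (?g' (g j)) = 0"
    using int_independentD[OF assms(2), of "\<lambda>i. e (?g' i)" "g j"] bij_betw_apply[OF assms(1) \<open>j \<in> J\<close>]
    by simp
  thus "e j = 0" using inverse[OF \<open>j \<in> J\<close>] by simp
qed

lemma int_independent_case_sum:
  assumes "linear N" and "finite I" and "finite J"
    and image: "int_independent I (\<lambda>i. N (b i))"
    and kernel: "int_independent J c" "\<And>j. j \<in> J \<Longrightarrow> N (c j) = 0"
  shows "int_independent (I <+> J) (case_sum b c)"
  unfolding int_independent_def
proof (intro allI impI)
  fix e :: "'c + 'd \<Rightarrow> int"
  assume "(\<Sum>i\<in>I <+> J. of_int (e i) *\<^sub>R case_sum b c i) = 0"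
  hence relation: "(\<Sum>i\<in>I. of_int (e (Inl i)) *\<^sub>R b i) + (\<Sum>j\<in>J. of_int (e (Inr j)) *\<^sub>R c j) = 0"
    using \<open>finite I\<close> \<open>finite J\<close> by (simp add: sum.Plus)
  have "(\<Sum>i\<in>I. of_int (e (Inl i)) *\<^sub>R N (b i))
      = N ((\<Sum>i\<in>I. of_int (e (Inl i)) *\<^sub>R b i) + (\<Sum>j\<in>J. of_int (e (Inr j)) *\<^sub>R c j))"
    using kernel(2)
    by (simp add: linear_add[OF \<open>linear N\<close>] linear_sum[OF \<open>linear N\<close>] linear_scale[OF \<open>linear N\<close>])
  also have "\<dots> = 0" unfolding relation using \<open>linear N\<close> by (rule linear_0)
  finally have left: "e (Inl i) = 0" if "i \<in> I" for i
    using int_independentD[OF image, of "\<lambda>i. e (Inl i)"] that by blast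
  hence "(\<Sum>j\<in>J. of_int (e (Inr j)) *\<^sub>R c j) = 0" using relation by simp
  hence "e (Inr j) = 0" if "j \<in> J" for j
    using int_independentD[OF kernel(1), of "\<lambda>j. e (Inr j)"] that by blast
  thus "\<forall>i\<in>I <+> J. e i = 0" using left by auto
qed

lemma int_independent_int_matrix:
  fixes n m :: nat
  assumes "int_independent {..<n} x"
    and "\<And>j. j < n \<Longrightarrow> x j = (\<Sum>i<m. of_int (P i j) *\<^sub>R y i)"
    and "\<And>i. i < m \<Longrightarrow> (\<Sum>j<n. P i j * c j) = 0" and "j < n"
  shows "c j = (0::int)"
proof -
  have "(\<Sum>j<n. of_int (c j) *\<^sub>R x j) = (\<Sum>j<n. \<Sum>i<m. of_int (P i j * c j) *\<^sub>R y i)"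
    by (intro sum.cong) (auto simp: assms(2) scaleR_sum_right mult.commute)
  also have "\<dots> = (\<Sum>i<m. \<Sum>j<n. of_int (P i j * c j) *\<^sub>R y i)" by (rule sum.swap)
  also have "\<dots> = (\<Sum>i<m. of_int (\<Sum>j<n. P i j * c j) *\<^sub>R y i)" by (simp add: scaleR_sum_left)
  also have "\<dots> = 0" using assms(3) by simp
  finally show ?thesis using int_independentD[OF assms(1), of c j] \<open>j < n\<close> by simp
qed

lemma int_independent_length_le:
  fixes n m :: nat
  assumes "int_independent {..<n} x" and "\<And>j. j < n \<Longrightarrow> x j \<in> int_span (y ` {..<m})"
  shows "n \<le> m"
proof (rule ccontr)
  assume "\<not> n \<le> m"
  obtain P where P: "\<And>j. j \<in> {..<n} \<Longrightarrow> x j = (\<Sum>i<m. of_int (P i j) *\<^sub>R y i)"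
    by (rule int_coefficients[where J = "{..<n}" and I = "{..<m}" and x = x and b = y])
      (use assms(2) in auto)
  obtain c where "\<exists>j<n. c j \<noteq> 0" "\<And>i. i < m \<Longrightarrow> (\<Sum>j<n. P i j * c j) = 0"
    using underdetermined_system_has_solution[of m n P] \<open>\<not> n \<le> m\<close> by auto
  thus False using int_independent_int_matrix[OF assms(1), where P = P and c = c] P by auto
qed

definition lattice_basis :: "'v::real_vector set \<Rightarrow> nat \<Rightarrow> (nat \<Rightarrow> 'v) \<Rightarrow> bool" where
  "lattice_basis A n b \<longleftrightarrow> int_independent {..<n} b \<and> int_span (b ` {..<n}) = A"

lemma lattice_basis_independent: "lattice_basis A n b \<Longrightarrow> int_independent {..<n} b"
  by (simp add: lattice_basis_def)

lemma lattice_basis_span: "lattice_basis A n b \<Longrightarrow> int_span (b ` {..<n}) = A"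
  by (simp add: lattice_basis_def)

lemma lattice_basis_mem: "lattice_basis A n b \<Longrightarrow> i < n \<Longrightarrow> b i \<in> A"
  by (auto simp: lattice_basis_def intro: int_vec.span_base)

lemma lattice_basis_length_unique:
  assumes "lattice_basis A n a" and "lattice_basis A m b"
  shows "n = m"
proof (rule antisym)
  show "n \<le> m"
    using int_independent_length_le[OF lattice_basis_independent[OF assms(1)], of b m]
      lattice_basis_mem[OF assms(1)] lattice_basis_span[OF assms(2)] by blast
  show "m \<le> n"
    using int_independent_length_le[OF lattice_basis_independent[OF assms(2)], of a n]
      lattice_basis_mem[OF assms(2)] lattice_basis_span[OF assms(1)] by blast
qed


section \<open>Discrete lattices of functions\<close>

lemma real_subgroup_cyclic:
  fixes V :: "real set"
  assumes "1 \<in> V" and V: "int_subspace V" and fin: "finite (V \<inter> {0<..1})"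
  obtains g where "g \<in> V" "0 < g" "\<And>t. t \<in> V \<Longrightarrow> \<exists>m::int. t = of_int m * g"
proof -
  define g where "g = Min (V \<inter> {0<..1})"
  have g: "g \<in> V" "0 < g" "g \<le> 1"
    using Min_in[OF fin] \<open>1 \<in> V\<close> unfolding g_def by fastforce+
  have "t = of_int \<lfloor>t / g\<rfloor> * g" if "t \<in> V" for t
  proof -
    define r where "r = t - of_int \<lfloor>t / g\<rfloor> * g"
    have "r \<in> V"
      using int_vec.subspace_diff[OF V \<open>t \<in> V\<close> int_vec.subspace_scale[OF V g(1)]] by (simp add: r_def)
    have "0 \<le> r" "r < g"
      using g(2) floor_divide_lower[of g t] floor_divide_upper[of g t]
      by (auto simp: r_def algebra_simps)
    have "\<not> 0 < r"
    proof
      assume "0 < r"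
      hence "r \<in> V \<inter> {0<..1}" using \<open>r \<in> V\<close> \<open>r < g\<close> g(3) by auto
      hence "g \<le> r" unfolding g_def by (intro Min_le fin)
      thus False using \<open>r < g\<close> by simp
    qed
    thus ?thesis using \<open>0 \<le> r\<close> by (simp add: r_def)
  qed
  thus ?thesis using that g by blast
qed

definition discrete_lattice :: "'w set \<Rightarrow> ('w \<Rightarrow> real) set \<Rightarrow> bool" where
  "discrete_lattice W A \<longleftrightarrow> int_subspace A \<and> (\<forall>f\<in>A. \<forall>w. w \<notin> W \<longrightarrow> f w = 0) \<and>
     (\<forall>B. finite {f \<in> A. \<forall>w\<in>W. \<bar>f w\<bar> \<le> B})"

lemma discrete_lattice_subspace: "discrete_lattice W A \<Longrightarrow> int_subspace A"
  by (simp add: discrete_lattice_def)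

lemma discrete_lattice_subset:
  assumes "discrete_lattice W A" and "int_subspace A'" and "A' \<subseteq> A"
  shows "discrete_lattice W A'"
proof -
  have "finite {f \<in> A'. \<forall>w\<in>W. \<bar>f w\<bar> \<le> B}" for B
    by (rule finite_subset[of _ "{f \<in> A. \<forall>w\<in>W. \<bar>f w\<bar> \<le> B}"])
      (use assms in \<open>auto simp: discrete_lattice_def\<close>)
  thus ?thesis using assms unfolding discrete_lattice_def by blast
qed

definition lattice_coordinates :: "'v::real_vector set \<Rightarrow> 'v set \<Rightarrow> 'v \<Rightarrow> real set" where
  "lattice_coordinates A S x = {t. \<exists>y\<in>A. y - t *\<^sub>R x \<in> span S}"

lemma lattice_coordinates_subspace:
  assumes A: "int_subspace A" shows "int_subspace (lattice_coordinates A S x)"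
proof (rule int_subspaceI)
  show "0 \<in> lattice_coordinates A S x"
    using int_vec.subspace_0[OF A] by (auto simp: lattice_coordinates_def span_zero intro: bexI[of _ 0])
  fix t u assume "t \<in> lattice_coordinates A S x" "u \<in> lattice_coordinates A S x"
  then obtain y z where "y \<in> A" "z \<in> A" "y - t *\<^sub>R x \<in> span S" "z - u *\<^sub>R x \<in> span S"
    by (auto simp: lattice_coordinates_def)
  thus "t - u \<in> lattice_coordinates A S x"
    using span_diff[of "y - t *\<^sub>R x" S "z - u *\<^sub>R x"]
    by (auto simp: lattice_coordinates_def algebra_simps intro!: bexI[of _ "y - z"]
      int_vec.subspace_diff[OF A])
qed

lemma span_coordinate_unique:
  assumes "x \<notin> span S" and "y - t *\<^sub>R x \<in> span S" and "y - u *\<^sub>R x \<in> span S"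
  shows "t = u"
proof (rule ccontr)
  assume "t \<noteq> u"
  have "(u - t) *\<^sub>R x \<in> span S" using span_diff[OF assms(2,3)] by (simp add: algebra_simps)
  hence "x \<in> span S" using span_scale[of _ S "inverse (u - t)"] \<open>t \<noteq> u\<close> by fastforce
  thus False using \<open>x \<notin> span S\<close> by contradiction
qed

text \<open>
  Rounding down the coordinates along \<open>S\<close> moves a lattice point into the parallelepiped spanned
  by \<open>insert x S\<close>.
\<close>

lemma lattice_coordinate_in_parallelepiped:
  fixes x :: "'w \<Rightarrow> real"
  assumes A: "int_subspace A" and "finite S" "S \<subseteq> A"
    and t: "t \<in> lattice_coordinates A S x" "0 < t" "t \<le> 1"
  obtains f where "f \<in> A" "f - t *\<^sub>R x \<in> span S" "\<And>w. \<bar>f w\<bar> \<le> \<bar>x w\<bar> + (\<Sum>y\<in>S. \<bar>y w\<bar>)"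
proof -
  obtain g where g: "g \<in> A" "g - t *\<^sub>R x \<in> span S" using t(1) by (auto simp: lattice_coordinates_def)
  obtain c where c: "g - t *\<^sub>R x = (\<Sum>y\<in>S. c y *\<^sub>R y)"
    using g(2) unfolding span_finite[OF \<open>finite S\<close>] by blast
  define f where "f = g - (\<Sum>y\<in>S. of_int \<lfloor>c y\<rfloor> *\<^sub>R y)"
  have f: "f = t *\<^sub>R x + (\<Sum>y\<in>S. frac (c y) *\<^sub>R y)"
    using c unfolding f_def frac_def by (simp add: scaleR_diff_left sum_subtractf algebra_simps)
  show ?thesis
  proof
    show "f \<in> A"
      unfolding f_def using \<open>S \<subseteq> A\<close>
      by (intro int_vec.subspace_diff[OF A g(1)] int_vec.subspace_sum[OF A]
        int_vec.subspace_scale[OF A]) auto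
    show "f - t *\<^sub>R x \<in> span S" unfolding f by (auto intro!: span_sum span_scale intro: span_base)
    fix w
    have "\<bar>f w\<bar> \<le> \<bar>t * x w\<bar> + \<bar>\<Sum>y\<in>S. frac (c y) * y w\<bar>"
      unfolding f by (simp add: abs_triangle_ineq)
    also have "\<dots> \<le> \<bar>x w\<bar> + (\<Sum>y\<in>S. \<bar>y w\<bar>)"
    proof (intro add_mono order.trans[OF sum_abs] sum_mono)
      show "\<bar>t * x w\<bar> \<le> \<bar>x w\<bar>" using t by (simp add: abs_mult mult_left_le_one_le)
      show "\<bar>frac (c y) * y w\<bar> \<le> \<bar>y w\<bar>" for y
        using frac_lt_1[of "c y"] by (simp add: abs_mult mult_left_le_one_le)
    qed
    finally show "\<bar>f w\<bar> \<le> \<bar>x w\<bar> + (\<Sum>y\<in>S. \<bar>y w\<bar>)" .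
  qed
qed

lemma finite_lattice_coordinates:
  assumes A: "discrete_lattice W A" and "finite W" "finite S" "S \<subseteq> A" "x \<notin> span S"
  shows "finite (lattice_coordinates A S x \<inter> {0<..1})"
proof -
  define B where "B = (\<Sum>w\<in>W. \<bar>x w\<bar> + (\<Sum>y\<in>S. \<bar>y w\<bar>))"
  define F where "F = {f \<in> A. \<forall>w\<in>W. \<bar>f w\<bar> \<le> B}"
  have "t \<in> (\<lambda>f. THE t. f - t *\<^sub>R x \<in> span S) ` F" if t: "t \<in> lattice_coordinates A S x \<inter> {0<..1}" for t
  proof -
    obtain f where f: "f \<in> A" "f - t *\<^sub>R x \<in> span S" "\<And>w. \<bar>f w\<bar> \<le> \<bar>x w\<bar> + (\<Sum>y\<in>S. \<bar>y w\<bar>)"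
      using lattice_coordinate_in_parallelepiped[OF discrete_lattice_subspace[OF A] \<open>finite S\<close>
        \<open>S \<subseteq> A\<close>] t
      by (metis Int_iff greaterThanAtMost_iff)
    have "\<bar>f w\<bar> \<le> B" if "w \<in> W" for w
      unfolding B_def
      by (rule order.trans[OF f(3)], rule member_le_sum[OF that _ \<open>finite W\<close>])
        (simp add: sum_nonneg)
    hence "f \<in> F" using f(1) by (simp add: F_def)
    moreover have "(THE t. f - t *\<^sub>R x \<in> span S) = t"
      using f(2) span_coordinate_unique[OF \<open>x \<notin> span S\<close>] by (intro the_equality)
    ultimately show ?thesis by blast
  qed
  moreover have "finite F" using A unfolding F_def discrete_lattice_def by blast
  ultimately show ?thesis by (meson finite_imageI finite_subset subsetI)
qed

lemma int_span_insert_eq_Int_span: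
  assumes A: "int_subspace A" and B: "int_span B = A \<inter> span S" and b: "b \<in> A" "b - g *\<^sub>R x \<in> span S"
    and multiples: "\<And>t. t \<in> lattice_coordinates A S x \<Longrightarrow> \<exists>m::int. t = of_int m * g"
  shows "int_span (insert b B) = A \<inter> span (insert x S)"
proof (rule antisym)
  have "int_subspace (A \<inter> span (insert x S))"
    by (rule int_subspaceI)
      (auto intro: int_vec.subspace_0[OF A] int_vec.subspace_diff[OF A] span_zero span_diff)
  moreover have "B \<subseteq> A \<inter> span (insert x S)"
    using B int_vec.span_superset[of B] span_mono[of S "insert x S"] by blast
  moreover have "b \<in> span (insert x S)" using b(2) unfolding span_breakdown_eq by blast
  ultimately show "int_span (insert b B) \<subseteq> A \<inter> span (insert x S)"
    using b(1) by (intro int_vec.span_minimal) auto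
  show "A \<inter> span (insert x S) \<subseteq> int_span (insert b B)"
  proof
    fix y assume "y \<in> A \<inter> span (insert x S)"
    then obtain t where t: "y \<in> A" "y - t *\<^sub>R x \<in> span S" by (auto simp: span_breakdown_eq)
    hence "t \<in> lattice_coordinates A S x" by (auto simp: lattice_coordinates_def)
    then obtain m :: int where m: "t = of_int m * g" using multiples by blast
    have "y - of_int m *\<^sub>R b = (y - t *\<^sub>R x) - of_int m *\<^sub>R (b - g *\<^sub>R x)"
      unfolding m by (simp add: algebra_simps)
    also have "\<dots> \<in> span S" by (intro span_diff span_scale t b)
    finally have "y - of_int m *\<^sub>R b \<in> A \<inter> span S"
      using int_vec.subspace_diff[OF A t(1) int_vec.subspace_scale[OF A b(1)], of m] by simp
    thus "y \<in> int_span (insert b B)" unfolding int_vec.span_breakdown_eq B[symmetric] by blast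
  qed
qed

lemma discrete_lattice_Int_span:
  assumes A: "discrete_lattice W A" and "finite W" "finite S" "independent S" "S \<subseteq> A"
  shows "\<exists>B. finite B \<and> independent B \<and> int_span B = A \<inter> span S"
  using assms(3-)
proof (induction S rule: finite_induct)
  case empty
  have "int_span {} = A \<inter> span {}"
    using int_vec.subspace_0[OF discrete_lattice_subspace[OF A]] by simp
  thus ?case using independent_empty by (intro exI[of _ "{}"]) simp
next
  case (insert x S)
  note A_subspace = discrete_lattice_subspace[OF A]
  have x: "x \<in> A" "x \<notin> span S" and S: "independent S" "S \<subseteq> A"
    using insert.prems insert.hyps by (auto simp: independent_insert)
  obtain B where B: "finite B" "independent B" "int_span B = A \<inter> span S"
    using insert.IH[OF S] by blast
  have "1 \<in> lattice_coordinates A S x"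
    using x(1) by (auto simp: lattice_coordinates_def span_zero intro!: bexI[of _ x])
  then obtain g where g: "g \<in> lattice_coordinates A S x" "0 < g"
    "\<And>t. t \<in> lattice_coordinates A S x \<Longrightarrow> \<exists>m::int. t = of_int m * g"
    using real_subgroup_cyclic[OF _ lattice_coordinates_subspace[OF A_subspace]
        finite_lattice_coordinates[OF A \<open>finite W\<close> insert.hyps(1) S(2) x(2)]] by blast
  then obtain b where b: "b \<in> A" "b - g *\<^sub>R x \<in> span S" by (auto simp: lattice_coordinates_def)
  have "span B \<subseteq> span S" using B(3) int_vec.span_superset[of B] by (intro span_minimal) auto
  have "b \<notin> span B"
  proof
    assume "b \<in> span B"
    hence "g *\<^sub>R x \<in> span S" using span_diff[OF _ b(2), of b] \<open>span B \<subseteq> span S\<close> by auto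
    thus False using span_scale[of _ S "inverse g"] x(2) g(2) by fastforce
  qed
  hence "independent (insert b B)" using B(2) by (rule independent_insertI)
  moreover have "int_span (insert b B) = A \<inter> span (insert x S)"
    by (rule int_span_insert_eq_Int_span[OF A_subspace B(3) b g(3)])
  ultimately show ?case using B(1) by blast
qed

theorem discrete_lattice_has_basis:
  assumes A: "discrete_lattice W A" and "finite W"
  obtains n b where "lattice_basis A n b"
proof -
  have "A \<subseteq> span ((\<lambda>w. indicator {w}) ` W)"
  proof
    fix f assume "f \<in> A"
    have "f = (\<Sum>w\<in>W. f w *\<^sub>R indicator {w})"
    proof
      fix v
      have "(\<Sum>w\<in>W. f w *\<^sub>R indicator {w} v) = (\<Sum>w\<in>W. if w = v then f v else 0)"
        by (intro sum.cong) (auto simp: indicator_def)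
      thus "f v = (\<Sum>w\<in>W. f w *\<^sub>R indicator {w}) v"
        using A \<open>f \<in> A\<close> \<open>finite W\<close> by (auto simp: discrete_lattice_def)
    qed
    thus "f \<in> span ((\<lambda>w. indicator {w}) ` W)"
      by (metis (no_types, lifting) image_eqI span_base span_scale span_sum)
  qed
  moreover obtain S where S: "S \<subseteq> A" "independent S" "A \<subseteq> span S"
    using maximal_independent_subset[of A] by blast
  ultimately have "finite S"
    using independent_span_bound[of "(\<lambda>w. indicator {w}) ` W" S] \<open>finite W\<close> by blast
  then obtain B where B: "finite B" "independent B" "int_span B = A"
    using discrete_lattice_Int_span[OF A \<open>finite W\<close> _ S(2,1)] S(3) by (metis inf.absorb1)
  obtain b where b: "bij_betw b {..<card B} B"
    using ex_bij_betw_nat_finite[OF B(1)] by (auto simp: atLeast0LessThan)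
  have "int_independent B id"
    using real_vector.independentD[OF B(2,1) subset_refl] unfolding int_independent_def by force
  hence "lattice_basis A (card B) b"
    using int_independent_reindex[OF b, of id] bij_betw_imp_surj_on[OF b] B(3)
    by (simp add: lattice_basis_def)
  thus ?thesis by (rule that)
qed


section \<open>Integer equivalence of functionals and covolumes\<close>

definition int_functionals :: "'v::real_vector set \<Rightarrow> ('v \<Rightarrow> real) set \<Rightarrow> ('v \<Rightarrow> real) set" where
  "int_functionals A \<Phi> = {\<phi>. \<exists>\<psi>\<in>int_span \<Phi>. \<forall>x\<in>A. \<phi> x = \<psi> x}"

lemma int_functionals_subspace: "int_subspace (int_functionals A \<Phi>)"
proof (rule int_subspaceI)
  show "0 \<in> int_functionals A \<Phi>"
    unfolding int_functionals_def using int_vec.span_zero by blast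
  fix \<phi> \<chi> assume "\<phi> \<in> int_functionals A \<Phi>" "\<chi> \<in> int_functionals A \<Phi>"
  then obtain \<psi> \<omega> where "\<psi> \<in> int_span \<Phi>" "\<forall>x\<in>A. \<phi> x = \<psi> x" "\<omega> \<in> int_span \<Phi>" "\<forall>x\<in>A. \<chi> x = \<omega> x"
    by (auto simp: int_functionals_def)
  thus "\<phi> - \<chi> \<in> int_functionals A \<Phi>"
    by (auto simp: int_functionals_def intro!: bexI[of _ "\<psi> - \<omega>"] int_vec.span_diff)
qed

lemma int_functionals_base: "\<phi> \<in> \<Phi> \<Longrightarrow> \<phi> \<in> int_functionals A \<Phi>"
  by (auto simp: int_functionals_def intro: int_vec.span_base)

lemma int_functionals_cong:
  "\<phi> \<in> int_functionals A \<Phi> \<Longrightarrow> (\<And>x. x \<in> A \<Longrightarrow> \<phi> x = \<chi> x) \<Longrightarrow> \<chi> \<in> int_functionals A \<Phi>"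
  by (auto simp: int_functionals_def)

lemma int_functionals_of_zero_sum:
  assumes "finite I" and zero_sum: "\<And>x. x \<in> A \<Longrightarrow> (\<Sum>i\<in>I. \<phi> i x) = 0"
    and "i0 \<in> I" and generators: "\<And>i. i \<in> I - {i0} \<Longrightarrow> \<phi> i \<in> \<Phi>" and "i \<in> I"
  shows "\<phi> i \<in> int_functionals A \<Phi>"
proof (cases "i = i0")
  case True
  have "- (\<Sum>i\<in>I - {i0}. \<phi> i) \<in> int_functionals A \<Phi>"
    by (intro int_vec.subspace_neg int_vec.subspace_sum int_functionals_subspace
      int_functionals_base generators)
  thus ?thesis
  proof (rule int_functionals_cong)
    fix x assume "x \<in> A"
    thus "(- (\<Sum>i\<in>I - {i0}. \<phi> i)) x = \<phi> i x"
      using zero_sum sum.remove[OF \<open>finite I\<close> \<open>i0 \<in> I\<close>, of "\<lambda>i. \<phi> i x"] True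
      by (simp add: eq_neg_iff_add_eq_0 add.commute)
  qed
qed (use assms in \<open>auto intro: int_functionals_base\<close>)

lemma fdet_int_functionals:
  assumes "\<And>i. i < n \<Longrightarrow> \<tau> i \<in> int_functionals A (\<mu> ` {..<n})" and "\<And>j. j < n \<Longrightarrow> x j \<in> A"
  obtains m :: int where "fdet n (\<lambda>i j. \<tau> i (x j)) = of_int m * fdet n (\<lambda>i j. \<mu> i (x j))"
proof -
  have "\<forall>i\<in>{..<n}. \<exists>\<psi>\<in>int_span (\<mu> ` {..<n}). \<forall>x\<in>A. \<tau> i x = \<psi> x"
    using assms(1) by (auto simp: int_functionals_def)
  then obtain \<psi> where \<psi>: "\<And>i. i \<in> {..<n} \<Longrightarrow> \<psi> i \<in> int_span (\<mu> ` {..<n})"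
    "\<And>i x. i < n \<Longrightarrow> x \<in> A \<Longrightarrow> \<tau> i x = \<psi> i x"
    by (metis lessThan_iff)
  obtain P where P: "\<And>i. i \<in> {..<n} \<Longrightarrow> \<psi> i = (\<Sum>m<n. of_int (P m i) *\<^sub>R \<mu> m)"
    by (rule int_coefficients[where J = "{..<n}" and I = "{..<n}" and x = \<psi> and b = \<mu>])
      (use \<psi>(1) in auto)
  have "fdet n (\<lambda>i j. \<tau> i (x j)) = fdet n (\<lambda>i j. \<Sum>m<n. of_int (P m i) * \<mu> m (x j))"
    by (rule fdet_cong) (simp add: \<psi>(2) assms(2) P)
  also have "\<dots> = fdet n (\<lambda>i m. of_int (P m i)) * fdet n (\<lambda>i j. \<mu> i (x j))" by (rule fdet_mult)
  also have "\<dots> = of_int (fdet n (\<lambda>i m. P m i)) * fdet n (\<lambda>i j. \<mu> i (x j))" by (simp add: fdet_of_int)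
  finally show ?thesis by (rule that)
qed

lemma fdet_int_combinations:
  fixes \<phi> :: "nat \<Rightarrow> 'v::real_vector \<Rightarrow> real"
  assumes "\<And>i. i < n \<Longrightarrow> linear (\<phi> i)" and "\<And>j. j < n \<Longrightarrow> x j = (\<Sum>m<n. of_int (P m j) *\<^sub>R b m)"
  shows "fdet n (\<lambda>i j. \<phi> i (x j)) = fdet n (\<lambda>i j. \<phi> i (b j)) * of_int (fdet n P)"
proof -
  have "fdet n (\<lambda>i j. \<phi> i (x j)) = fdet n (\<lambda>i j. \<Sum>m<n. \<phi> i (b m) * of_int (P m j))"
    by (rule fdet_cong)
      (simp add: assms(2) linear_sum[OF assms(1)] linear_scale[OF assms(1)] mult.commute)
  thus ?thesis by (simp add: fdet_mult fdet_of_int)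
qed

lemma abs_eq_if_mutual_int_multiples:
  fixes x y :: real
  assumes "x = of_int m * y" and "y = of_int m' * x"
  shows "\<bar>x\<bar> = \<bar>y\<bar>"
proof (cases "x = 0")
  case True
  thus ?thesis using assms(2) by simp
next
  case False
  have "of_int (m * m') * x = x" using assms by simp
  hence "m * m' = 1" using False by (metis mult_cancel_right1 of_int_eq_1_iff)
  hence "\<bar>m\<bar> = 1" by (metis abs_mult_pos' abs_1 abs_minus_cancel zmult_eq_1_iff)
  hence "\<bar>real_of_int m\<bar> = 1" by (metis of_int_1 of_int_abs)
  thus ?thesis using assms(1) by (simp add: abs_mult)
qed

lemma abs_fdet_eq_if_int_equivalent:
  assumes bases: "lattice_basis A n a" "lattice_basis A n b"
    and rows: "\<And>i. i < n \<Longrightarrow> \<tau> i \<in> int_functionals A (\<mu> ` {..<n})"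
      "\<And>i. i < n \<Longrightarrow> \<mu> i \<in> int_functionals A (\<tau> ` {..<n})"
    and linear: "\<And>i. i < n \<Longrightarrow> linear (\<tau> i)" "\<And>i. i < n \<Longrightarrow> linear (\<mu> i)"
  shows "\<bar>fdet n (\<lambda>i j. \<tau> i (a j))\<bar> = \<bar>fdet n (\<lambda>i j. \<mu> i (b j))\<bar>"
proof -
  have multiple: "\<exists>m::int. fdet n (\<lambda>i j. \<tau> i (a j)) = of_int m * fdet n (\<lambda>i j. \<mu> i (b j))"
    if a: "lattice_basis A n a" and b: "lattice_basis A n b" and linear: "\<And>i. i < n \<Longrightarrow> linear (\<mu> i)"
      and rows: "\<And>i. i < n \<Longrightarrow> \<tau> i \<in> int_functionals A (\<mu> ` {..<n})" for a b \<tau> \<mu>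
  proof -
    obtain m where "fdet n (\<lambda>i j. \<tau> i (a j)) = of_int m * fdet n (\<lambda>i j. \<mu> i (a j))"
      using fdet_int_functionals[of n \<tau> A \<mu> a] rows lattice_basis_mem[OF a] by blast
    moreover obtain P where P: "\<And>j. j \<in> {..<n} \<Longrightarrow> a j = (\<Sum>i<n. of_int (P i j) *\<^sub>R b i)"
      by (rule int_coefficients[where J = "{..<n}" and I = "{..<n}" and x = a and b = b])
        (use lattice_basis_mem[OF a] lattice_basis_span[OF b] in auto)
    ultimately have "fdet n (\<lambda>i j. \<tau> i (a j)) = of_int (m * fdet n P) * fdet n (\<lambda>i j. \<mu> i (b j))"
      using fdet_int_combinations[OF linear, where P = P] by simp
    thus ?thesis ..
  qed
  obtain m m' :: int where "fdet n (\<lambda>i j. \<tau> i (a j)) = of_int m * fdet n (\<lambda>i j. \<mu> i (b j))"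
    "fdet n (\<lambda>i j. \<mu> i (b j)) = of_int m' * fdet n (\<lambda>i j. \<tau> i (a j))"
    using multiple[where \<tau> = \<tau> and \<mu> = \<mu>, OF bases linear(2) rows(1)]
      multiple[where \<tau> = \<mu> and \<mu> = \<tau>, OF bases(2,1) linear(1) rows(2)] by blast
  thus ?thesis by (rule abs_eq_if_mutual_int_multiples)
qed

lemma abs_fdet_lattice_basis_le:
  fixes \<phi> :: "nat \<Rightarrow> 'v::real_vector \<Rightarrow> real"
  assumes basis: "lattice_basis A n b" and x: "int_independent {..<n} x" "\<And>j. j < n \<Longrightarrow> x j \<in> A"
    and linear: "\<And>i. i < n \<Longrightarrow> linear (\<phi> i)"
  shows "\<bar>fdet n (\<lambda>i j. \<phi> i (b j))\<bar> \<le> \<bar>fdet n (\<lambda>i j. \<phi> i (x j))\<bar>"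
proof -
  obtain P where P: "\<And>j. j \<in> {..<n} \<Longrightarrow> x j = (\<Sum>i<n. of_int (P i j) *\<^sub>R b i)"
    by (rule int_coefficients[where J = "{..<n}" and I = "{..<n}" and x = x and b = b])
      (use x(2) lattice_basis_span[OF basis] in auto)
  have "fdet n P \<noteq> 0"
  proof
    assume "fdet n P = 0"
    then obtain c where "\<exists>j<n. c j \<noteq> 0" "\<And>i. i < n \<Longrightarrow> (\<Sum>j<n. P i j * c j) = 0"
      using fdet_eq_0_imp_null_vector by blast
    thus False using int_independent_int_matrix[OF x(1), where P = P and c = c] P by auto
  qed
  hence "1 \<le> \<bar>real_of_int (fdet n P)\<bar>" by (simp flip: of_int_abs)
  moreover have "\<bar>fdet n (\<lambda>i j. \<phi> i (x j))\<bar> = \<bar>fdet n (\<lambda>i j. \<phi> i (b j))\<bar> * \<bar>real_of_int (fdet n P)\<bar>"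
    using fdet_int_combinations[OF linear, where P = P] P by (simp add: abs_mult)
  ultimately show ?thesis by (simp add: mult_le_cancel_left1)
qed


section \<open>Sums over fibres\<close>

definition fiber_sum :: "('w \<Rightarrow> 'v) \<Rightarrow> 'w set \<Rightarrow> ('w \<Rightarrow> real) \<Rightarrow> 'v \<Rightarrow> real" where
  "fiber_sum \<pi> W f v = (\<Sum>w\<in>{w \<in> W. \<pi> w = v}. f w)"

lemma linear_fiber_sum: "linear (fiber_sum \<pi> W)"
  by (rule linearI) (auto simp: fiber_sum_def fun_eq_iff sum.distrib sum_distrib_left)

lemma linear_eval: "linear (\<lambda>f :: 'w \<Rightarrow> real. f w)"
  by (rule linearI) simp_all

definition append_family :: "nat \<Rightarrow> (nat \<Rightarrow> 'b) \<Rightarrow> (nat \<Rightarrow> 'b) \<Rightarrow> nat \<Rightarrow> 'b" where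
  "append_family m e f = (\<lambda>j. if j < m then e j else f (j - m))"

lemma append_family_simps [simp]:
  "j < m \<Longrightarrow> append_family m e f j = e j" "append_family m e f (m + j) = f j"
  by (simp_all add: append_family_def)

lemma append_family_image: "append_family m e f ` {..<m + n} = e ` {..<m} \<union> f ` {..<n}"
proof -
  have "{..<m + n} = {..<m} \<union> (+) m ` {..<n}"
    using image_add_atLeastLessThan[of m 0 n] by (auto simp: atLeast0LessThan)
  thus ?thesis by (simp add: image_Un image_image)
qed

lemma all_less_add_iff: "(\<forall>j<m + n. P j) \<longleftrightarrow> (\<forall>j<m. P j) \<and> (\<forall>j<n. P (m + j))" for m n :: nat
  by (metis add_less_cancel_left le_add_diff_inverse not_le trans_less_add1)

locale lattice_fibration =
  fixes W :: "'w set" and V :: "'v set" and \<pi> :: "'w \<Rightarrow> 'v"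
    and L :: "('w \<Rightarrow> real) set" and K :: "('v \<Rightarrow> real) set"
  assumes finite_W: "finite W" and finite_V: "finite V" and proj: "\<pi> ` W \<subseteq> V"
    and L_subspace: "int_subspace L" and L_zero_sum: "f \<in> L \<Longrightarrow> (\<Sum>w\<in>W. f w) = 0"
    and K_lattice: "discrete_lattice V K"
    and fiber_sum_mem: "f \<in> L \<Longrightarrow> fiber_sum \<pi> W f \<in> K"
    and fiber_sum_multiples: "\<exists>d::int. d \<noteq> 0 \<and> (\<forall>g\<in>K. of_int d *\<^sub>R g \<in> fiber_sum \<pi> W ` L)"
begin

abbreviation N :: "('w \<Rightarrow> real) \<Rightarrow> 'v \<Rightarrow> real" where "N \<equiv> fiber_sum \<pi> W"

abbreviation kernel :: "('w \<Rightarrow> real) set" where "kernel \<equiv> {f \<in> L. N f = 0}"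

lemma image_lattice: "discrete_lattice V (N ` L)"
proof (rule discrete_lattice_subset[OF K_lattice])
  show "int_subspace (N ` L)"
  proof (rule int_subspaceI)
    show "0 \<in> N ` L"
      using linear_0[OF linear_fiber_sum] int_vec.subspace_0[OF L_subspace] by (metis image_eqI)
    fix f g assume "f \<in> N ` L" "g \<in> N ` L"
    thus "f - g \<in> N ` L"
      by (auto simp flip: linear_diff[OF linear_fiber_sum] intro: int_vec.subspace_diff[OF L_subspace])
  qed
qed (use fiber_sum_mem in auto)

lemma image_basis_length:
  assumes K: "lattice_basis K n b" and h: "lattice_basis (N ` L) m h"
  shows "m = n"
proof (rule antisym)
  show "m \<le> n"
  proof (rule int_independent_length_le[OF lattice_basis_independent[OF h]])
    show "h j \<in> int_span (b ` {..<n})" if "j < m" for j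
      unfolding lattice_basis_span[OF K] using lattice_basis_mem[OF h that] fiber_sum_mem by auto
  qed
  obtain d :: int where d: "d \<noteq> 0" "\<And>g. g \<in> K \<Longrightarrow> of_int d *\<^sub>R g \<in> N ` L"
    using fiber_sum_multiples by blast
  show "n \<le> m"
  proof (rule int_independent_length_le[OF int_independent_scale[OF lattice_basis_independent[OF K]
      d(1)]])
    show "of_int d *\<^sub>R b j \<in> int_span (h ` {..<m})" if "j < n" for j
      unfolding lattice_basis_span[OF h] by (rule d(2)[OF lattice_basis_mem[OF K that]])
  qed
qed

lemma image_basis:
  assumes "lattice_basis K n b"
  obtains f where "\<And>i. i < n \<Longrightarrow> f i \<in> L" "lattice_basis (N ` L) n (\<lambda>i. N (f i))"
proof -
  obtain m h where "lattice_basis (N ` L) m h"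
    using discrete_lattice_has_basis[OF image_lattice finite_V] .
  hence h: "lattice_basis (N ` L) n h" using image_basis_length[OF assms] by blast
  hence "\<forall>i\<in>{..<n}. \<exists>f\<in>L. h i = N f" using lattice_basis_mem[OF h] by blast
  then obtain f where f: "\<And>i. i < n \<Longrightarrow> f i \<in> L" "\<And>i. i < n \<Longrightarrow> N (f i) = h i" by (metis lessThan_iff)
  have "lattice_basis (N ` L) n (\<lambda>i. N (f i))"
    using h f(2) by (simp add: lattice_basis_def int_independent_def)
  with f(1) show ?thesis by (rule that)
qed

lemma int_span_kernel_lifts:
  fixes n :: nat
  assumes e: "lattice_basis kernel m e"
    and f: "\<And>i. i < n \<Longrightarrow> f i \<in> L" "int_span ((\<lambda>i. N (f i)) ` {..<n}) = N ` L"
  shows "int_span (e ` {..<m} \<union> f ` {..<n}) = L"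
proof (rule antisym)
  show "int_span (e ` {..<m} \<union> f ` {..<n}) \<subseteq> L"
    using lattice_basis_mem[OF e] f(1) by (intro int_vec.span_minimal L_subspace) auto
  show "L \<subseteq> int_span (e ` {..<m} \<union> f ` {..<n})"
  proof
    fix g assume "g \<in> L"
    hence "N g \<in> int_span ((\<lambda>i. N (f i)) ` {..<n})" using f(2) by blast
    then obtain p :: "nat \<Rightarrow> int" where p: "N g = (\<Sum>i<n. of_int (p i) *\<^sub>R N (f i))"
      using int_span_image[OF finite_lessThan, of "\<lambda>i. N (f i)" n] by auto
    define s where "s = (\<Sum>i<n. of_int (p i) *\<^sub>R f i)"
    have "N g = N s"
      unfolding p s_def by (simp add: linear_sum[OF linear_fiber_sum] linear_scale[OF linear_fiber_sum])
    moreover have s: "s \<in> int_span (f ` {..<n})"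
      unfolding s_def by (auto intro!: int_vec.span_sum int_vec.span_scale intro: int_vec.span_base)
    moreover have "int_span (f ` {..<n}) \<subseteq> L" using f(1) by (intro int_vec.span_minimal L_subspace) auto
    ultimately have "g - s \<in> kernel"
      using \<open>g \<in> L\<close> linear_diff[OF linear_fiber_sum, of \<pi> W g s]
        int_vec.subspace_diff[OF L_subspace] by auto
    hence "g - s \<in> int_span (e ` {..<m})" using lattice_basis_span[OF e] by simp
    hence "(g - s) + s \<in> int_span (e ` {..<m} \<union> f ` {..<n})"
      using s int_vec.span_mono[of "e ` {..<m}" "e ` {..<m} \<union> f ` {..<n}"]
        int_vec.span_mono[of "f ` {..<n}" "e ` {..<m} \<union> f ` {..<n}"]
      by (intro int_vec.span_add) auto
    thus "g \<in> int_span (e ` {..<m} \<union> f ` {..<n})" by simp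
  qed
qed

lemma adapted_basis:
  assumes e: "lattice_basis kernel m e"
    and f: "\<And>i. i < n \<Longrightarrow> f i \<in> L" "lattice_basis (N ` L) n (\<lambda>i. N (f i))"
  shows "lattice_basis L (m + n) (append_family m e f)"
  unfolding lattice_basis_def append_family_image
proof
  let ?g = "\<lambda>j. if j < m then Inr j else Inl (j - m)"
  have "bij_betw ?g {..<m + n} ({..<n} <+> {..<m})"
    by (rule bij_betw_byWitness[where f' = "case_sum ((+) m) id"]) auto
  moreover have "int_independent ({..<n} <+> {..<m}) (case_sum f e)"
    by (rule int_independent_case_sum[OF linear_fiber_sum, of _ _ \<pi> W])
      (use lattice_basis_independent[OF e] lattice_basis_independent[OF f(2)]
        lattice_basis_mem[OF e] in auto)
  ultimately have "int_independent {..<m + n} (\<lambda>j. case_sum f e (?g j))"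
    by (rule int_independent_reindex)
  thus "int_independent {..<m + n} (append_family m e f)"
    by (simp add: append_family_def if_distrib cong: if_cong)
  show "int_span (e ` {..<m} \<union> f ` {..<n}) = L"
    by (rule int_span_kernel_lifts[OF e f(1) lattice_basis_span[OF f(2)]])
qed

lemma sum_fiber_sum: "(\<Sum>v\<in>V. N f v) = (\<Sum>w\<in>W. f w)"
  unfolding fiber_sum_def by (rule sum.group[OF finite_W finite_V proj])

lemma eval_int_functional:
  assumes "w0 \<in> W" and "w \<in> W"
  shows "(\<lambda>f. f w) \<in> int_functionals L ((\<lambda>w f. f w) ` (W - {w0}))"
  using int_functionals_of_zero_sum[OF finite_W L_zero_sum, of L "\<lambda>w f. f w"] assms by auto

lemma fiber_sum_int_functional:
  assumes "\<And>w. w \<in> W \<Longrightarrow> (\<lambda>f. f w) \<in> int_functionals L \<Phi>"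
  shows "(\<lambda>f. N f v) \<in> int_functionals L \<Phi>"
proof -
  have "(\<lambda>f. N f v) = (\<Sum>w\<in>{w \<in> W. \<pi> w = v}. (\<lambda>f. f w))"
    by (simp add: fun_eq_iff fiber_sum_def)
  also have "\<dots> \<in> int_functionals L \<Phi>"
    by (intro int_vec.subspace_sum int_functionals_subspace assms) auto
  finally show ?thesis .
qed

lemma eval_lift_int_functional:
  assumes lift_section: "\<And>v. v \<in> V \<Longrightarrow> lift v \<in> W" "\<And>v. v \<in> V \<Longrightarrow> \<pi> (lift v) = v"
    and "v0 \<in> V" and "w \<in> W"
  defines "\<Phi> \<equiv> (\<lambda>w f. f w) ` (W - lift ` V) \<union> (\<lambda>v f. N f v) ` (V - {v0})"
  shows "(\<lambda>f. f w) \<in> int_functionals L \<Phi>"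
proof (cases "w \<in> lift ` V")
  case True
  then obtain v where v: "v \<in> V" "w = lift v" by blast
  let ?S = "{w \<in> W. \<pi> w = v} - {w}"
  have "u \<notin> lift ` V" if "u \<in> ?S" for u using that v lift_section(2) by auto
  hence "(\<Sum>u\<in>?S. (\<lambda>f. f u)) \<in> int_functionals L \<Phi>"
    by (intro int_vec.subspace_sum int_functionals_subspace int_functionals_base) (auto simp: \<Phi>_def)
  moreover have "(\<lambda>f. N f v) \<in> int_functionals L \<Phi>"
  proof (rule int_functionals_of_zero_sum[OF finite_V _ \<open>v0 \<in> V\<close> _ v(1)])
    show "(\<Sum>v\<in>V. N f v) = 0" if "f \<in> L" for f
      unfolding sum_fiber_sum using L_zero_sum[OF that] .
  qed (auto simp: \<Phi>_def)
  ultimately have "(\<lambda>f. N f v) - (\<Sum>u\<in>?S. (\<lambda>f. f u)) \<in> int_functionals L \<Phi>"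
    by (intro int_vec.subspace_diff int_functionals_subspace)
  thus ?thesis
  proof (rule int_functionals_cong)
    fix f :: "'w \<Rightarrow> real"
    have "N f v = f w + (\<Sum>u\<in>?S. f u)"
      unfolding fiber_sum_def by (rule sum.remove) (use finite_W \<open>w \<in> W\<close> v lift_section in auto)
    thus "((\<lambda>f. N f v) - (\<Sum>u\<in>?S. (\<lambda>f. f u))) f = f w" by simp
  qed
qed (use \<open>w \<in> W\<close> in \<open>auto simp: \<Phi>_def intro: int_functionals_base\<close>)

context
  fixes lift w0 v0 row_L row_K row_E n p q
  assumes lift_section: "\<And>v. v \<in> V \<Longrightarrow> lift v \<in> W" "\<And>v. v \<in> V \<Longrightarrow> \<pi> (lift v) = v"
    and w0: "w0 \<in> W" and v0: "v0 \<in> V"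
    and row_L: "bij_betw row_L {..<n::nat} (W - {w0})"
    and row_K: "bij_betw row_K {..<p::nat} (V - {v0})"
    and row_E: "bij_betw row_E {..<q::nat} (W - lift ` V)"
begin

lemma row_count_eq: "n = q + p"
proof -
  have "inj_on lift V" by (rule inj_on_inverseI[of V \<pi>]) (rule lift_section(2))
  hence "card (lift ` V) = card V" by (rule card_image)
  moreover have "lift ` V \<subseteq> W" using lift_section(1) by blast
  ultimately have "q = card W - card V" "card V \<le> card W"
    using bij_betw_same_card[OF row_E] card_mono[OF finite_W, of "lift ` V"] finite_V
    by (auto simp: card_Diff_subset)
  moreover have "p = card V - 1" using bij_betw_same_card[OF row_K] v0 finite_V by simp
  moreover have "n = card W - 1" using bij_betw_same_card[OF row_L] w0 finite_W by simp
  moreover have "card V > 0" using v0 finite_V card_gt_0_iff by blast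
  ultimately show ?thesis by simp
qed

lemma abs_fdet_adapted_basis:
  assumes basis_L: "lattice_basis L n b" and basis_E: "lattice_basis kernel q e"
    and f: "\<And>i. i < p \<Longrightarrow> f i \<in> L" "lattice_basis (N ` L) p (\<lambda>i. N (f i))"
  shows "\<bar>fdet n (\<lambda>i j. b j (row_L i))\<bar>
    = \<bar>fdet q (\<lambda>i j. e j (row_E i))\<bar> * \<bar>fdet p (\<lambda>i j. N (f j) (row_K i))\<bar>"
proof -
  let ?a = "append_family q e f"
  let ?\<mu> = "\<lambda>i f. f (row_L i)" and ?\<tau> = "append_family q (\<lambda>i f. f (row_E i)) (\<lambda>i f. N f (row_K i))"
  have \<mu>_image: "?\<mu> ` {..<n} = (\<lambda>w f. f w) ` (W - {w0})"
    unfolding bij_betw_imp_surj_on[OF row_L, symmetric] by (simp add: image_image)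
  have \<tau>_image: "?\<tau> ` {..<n} = (\<lambda>w f. f w) ` (W - lift ` V) \<union> (\<lambda>v f. N f v) ` (V - {v0})"
    unfolding row_count_eq append_family_image bij_betw_imp_surj_on[OF row_E, symmetric]
      bij_betw_imp_surj_on[OF row_K, symmetric] by (simp add: image_image)
  have "\<bar>fdet n (\<lambda>i j. ?\<tau> i (?a j))\<bar> = \<bar>fdet n (\<lambda>i j. ?\<mu> i (b j))\<bar>"
  proof (rule abs_fdet_eq_if_int_equivalent[where A = L and \<tau> = ?\<tau> and \<mu> = ?\<mu>])
    show "lattice_basis L n ?a" unfolding row_count_eq by (rule adapted_basis[OF basis_E f])
    have "\<forall>i<n. ?\<tau> i \<in> int_functionals L ((\<lambda>w f. f w) ` (W - {w0})) \<and> linear (?\<tau> i)"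
      unfolding row_count_eq all_less_add_iff
      using eval_int_functional[OF w0] fiber_sum_int_functional[OF eval_int_functional[OF w0]]
        bij_betw_apply[OF row_E] linear_eval linear_compose[OF linear_fiber_sum linear_eval]
      by (auto simp: o_def)
    thus "?\<tau> i \<in> int_functionals L (?\<mu> ` {..<n})" "linear (?\<tau> i)" if "i < n" for i
      unfolding \<mu>_image using that by blast+
    show "?\<mu> i \<in> int_functionals L (?\<tau> ` {..<n})" if "i < n" for i
      unfolding \<tau>_image
      using eval_lift_int_functional[OF lift_section v0] bij_betw_apply[OF row_L] that by auto
  qed (fact basis_L, rule linear_eval)
  moreover have "fdet n (\<lambda>i j. ?\<tau> i (?a j))
      = fdet q (\<lambda>i j. ?\<tau> i (?a j)) * fdet p (\<lambda>i j. ?\<tau> (q + i) (?a (q + j)))"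
    unfolding row_count_eq by (rule fdet_block_triangular) (use lattice_basis_mem[OF basis_E] in auto)
  moreover have "fdet q (\<lambda>i j. ?\<tau> i (?a j)) = fdet q (\<lambda>i j. e j (row_E i))"
    by (rule fdet_cong) simp
  moreover have "fdet p (\<lambda>i j. ?\<tau> (q + i) (?a (q + j))) = fdet p (\<lambda>i j. N (f j) (row_K i))"
    by (rule fdet_cong) simp
  ultimately show ?thesis by (simp add: abs_mult)
qed

theorem fdet_mult_fdet_kernel_le:
  assumes basis_L: "lattice_basis L m b" and basis_K: "lattice_basis K p g"
    and basis_E: "lattice_basis kernel q e"
  shows "m = n"
    and "\<bar>fdet p (\<lambda>i j. g j (row_K i))\<bar> * \<bar>fdet q (\<lambda>i j. e j (row_E i))\<bar> \<le> \<bar>fdet m (\<lambda>i j. b j (row_L i))\<bar>"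
proof -
  obtain f where f: "\<And>i. i < p \<Longrightarrow> f i \<in> L" "lattice_basis (N ` L) p (\<lambda>i. N (f i))"
    using image_basis[OF basis_K] by blast
  show "m = n"
    using lattice_basis_length_unique[OF basis_L adapted_basis[OF basis_E f]] row_count_eq by simp
  have "\<bar>fdet p (\<lambda>i j. g j (row_K i))\<bar> \<le> \<bar>fdet p (\<lambda>i j. N (f j) (row_K i))\<bar>"
    by (rule abs_fdet_lattice_basis_le[OF basis_K lattice_basis_independent[OF f(2)],
          where \<phi> = "\<lambda>i h. h (row_K i)"])
      (use f(1) fiber_sum_mem linear_eval in auto)
  hence "\<bar>fdet p (\<lambda>i j. g j (row_K i))\<bar> * \<bar>fdet q (\<lambda>i j. e j (row_E i))\<bar>
      \<le> \<bar>fdet p (\<lambda>i j. N (f j) (row_K i))\<bar> * \<bar>fdet q (\<lambda>i j. e j (row_E i))\<bar>"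
    by (rule mult_right_mono) simp
  thus "\<bar>fdet p (\<lambda>i j. g j (row_K i))\<bar> * \<bar>fdet q (\<lambda>i j. e j (row_E i))\<bar> \<le> \<bar>fdet m (\<lambda>i j. b j (row_L i))\<bar>"
    using abs_fdet_adapted_basis[OF basis_L[unfolded \<open>m = n\<close>] basis_E f] \<open>m = n\<close>
    by (simp add: mult.commute)
qed

end

end


section \<open>Algebraic integers form a ring\<close>

global_interpretation int_mult: Modules.module "\<lambda>(m::int) (x::'a::comm_ring_1). of_int m * x"
  defines int_module = int_mult.span
  by standard (simp_all add: algebra_simps)

lemma int_module_mult_closed:
  assumes "\<And>s. s \<in> S \<Longrightarrow> z * s \<in> int_module T" and "x \<in> int_module S"
  shows "z * x \<in> int_module T"
  using assms(2)
proof (induction x rule: int_mult.span_induct_alt)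
  case base
  show ?case by (simp add: int_mult.span_zero)
next
  case (step m s x)
  have "z * (of_int m * s + x) = of_int m * (z * s) + z * x" by (simp add: algebra_simps)
  also have "\<dots> \<in> int_module T" by (intro int_mult.span_add int_mult.span_scale assms(1) step)
  finally show ?case .
qed

lemma int_module_product_stable:
  assumes "\<And>s. s \<in> S \<Longrightarrow> x * s \<in> int_module S" and "u \<in> (\<lambda>(s, t). s * t) ` (S \<times> T)"
  shows "x * u \<in> int_module ((\<lambda>(s, t). s * t) ` (S \<times> T))"
proof -
  obtain s t where st: "s \<in> S" "t \<in> T" "u = s * t" using assms(2) by auto
  have "t * s' \<in> int_module ((\<lambda>(s, t). s * t) ` (S \<times> T))" if "s' \<in> S" for s'
    using that st(2) by (intro int_mult.span_base image_eqI[of _ _ "(s', t)"]) auto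
  from int_module_mult_closed[OF this assms(1)[OF st(1)]] show ?thesis by (simp add: st(3) mult_ac)
qed

lemma algebraic_int_eigenvalue:
  fixes z :: "'a::field_char_0"
  assumes A: "A \<in> carrier_mat n n" and "eigenvalue (map_mat of_int A) z"
  shows "algebraic_int z"
proof -
  have "poly (char_poly (map_mat of_int A)) z = 0"
    using eigenvalue_root_char_poly[of "map_mat of_int A" n z] assms by simp
  hence "poly (map_poly of_int (char_poly A)) z = 0" by (simp add: of_int_hom.char_poly_hom[OF A])
  moreover have "Polynomial.lead_coeff (char_poly A) = 1" using degree_monic_char_poly[OF A] by simp
  ultimately show ?thesis unfolding algebraic_int_altdef_ipoly by blast
qed

lemma algebraic_int_if_int_module_stable:
  fixes z :: "'a::field_char_0"
  assumes "finite S" "s0 \<in> S" "s0 \<noteq> 0" and stable: "\<And>s. s \<in> S \<Longrightarrow> z * s \<in> int_module S"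
  shows "algebraic_int z"
proof -
  obtain b where b: "bij_betw b {0..<card S} S" using ex_bij_betw_nat_finite[OF \<open>finite S\<close>] by blast
  have "\<forall>s\<in>S. \<exists>c::'a \<Rightarrow> int. z * s = (\<Sum>t\<in>S. of_int (c t) * t)"
    using stable unfolding int_mult.span_finite[OF \<open>finite S\<close>] by blast
  then obtain c :: "'a \<Rightarrow> 'a \<Rightarrow> int" where c: "\<And>s. s \<in> S \<Longrightarrow> z * s = (\<Sum>t\<in>S. of_int (c s t) * t)"
    by metis
  define A where "A = mat (card S) (card S) (\<lambda>(i, j). c (b i) (b j))"
  define v where "v = vec (card S) b"
  have "eigenvector (map_mat of_int A) v z"
    unfolding eigenvector_def
  proof (intro conjI)
    show "v \<in> carrier_vec (dim_row (map_mat of_int A))" by (simp add: A_def v_def)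
    have "s0 \<in> b ` {0..<card S}" unfolding bij_betw_imp_surj_on[OF b] by fact
    then obtain i where "i < card S" "b i = s0" by auto
    thus "v \<noteq> 0\<^sub>v (dim_row (map_mat of_int A))" using \<open>s0 \<noteq> 0\<close> by (auto simp: A_def v_def vec_eq_iff)
    show "map_mat of_int A *\<^sub>v v = z \<cdot>\<^sub>v v"
    proof (rule eq_vecI)
      fix i assume "i < dim_vec (z \<cdot>\<^sub>v v)"
      hence i: "i < card S" by (simp add: v_def)
      have "(map_mat of_int A *\<^sub>v v) $ i = (\<Sum>j\<in>{0..<card S}. of_int (c (b i) (b j)) * b j)"
        using i by (simp add: A_def v_def scalar_prod_def)
      also have "\<dots> = (\<Sum>t\<in>S. of_int (c (b i) t) * t)" by (rule sum.reindex_bij_betw[OF b])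
      also have "\<dots> = (z \<cdot>\<^sub>v v) $ i" using i c[of "b i"] bij_betw_apply[OF b, of i] by (simp add: v_def)
      finally show "(map_mat of_int A *\<^sub>v v) $ i = (z \<cdot>\<^sub>v v) $ i" .
    qed (simp add: A_def v_def)
  qed
  hence "eigenvalue (map_mat of_int A) z" unfolding eigenvalue_def by blast
  moreover have "A \<in> carrier_mat (card S) (card S)" by (simp add: A_def)
  ultimately show ?thesis by (intro algebraic_int_eigenvalue)
qed

lemma algebraic_int_power_relation:
  fixes x :: "'a::field_char_0"
  assumes "algebraic_int x"
  obtains n c where "n > 0" "x ^ n = (\<Sum>i<n. of_int (c i) * x ^ i)"
proof -
  obtain p where p: "poly (map_poly of_int p) x = 0" "Polynomial.lead_coeff p = 1"
    using assms unfolding algebraic_int_altdef_ipoly by blast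
  let ?n = "Polynomial.degree p"
  have "poly (map_poly of_int p) x = (\<Sum>i\<le>?n. of_int (poly.coeff p i) * x ^ i)"
    by (simp add: poly_altdef degree_map_poly coeff_map_poly)
  also have "\<dots> = x ^ ?n + (\<Sum>i<?n. of_int (poly.coeff p i) * x ^ i)"
    using p(2) by (simp add: lessThan_Suc_atMost[symmetric])
  finally have relation: "x ^ ?n = (\<Sum>i<?n. of_int (- poly.coeff p i) * x ^ i)"
    using p(1) by (simp add: sum_negf eq_neg_iff_add_eq_0)
  have "?n > 0" using relation by (cases "?n = 0") auto
  thus ?thesis using that[of ?n "\<lambda>i. - poly.coeff p i"] relation by blast
qed

lemma algebraic_int_obtain_stable:
  fixes x :: "'a::field_char_0"
  assumes "algebraic_int x"
  obtains S where "finite S" "1 \<in> S" "\<And>s. s \<in> S \<Longrightarrow> x * s \<in> int_module S"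
proof -
  obtain n c where n: "n > 0" "x ^ n = (\<Sum>i<n. of_int (c i) * x ^ i)"
    using algebraic_int_power_relation[OF assms] .
  let ?S = "(\<lambda>i. x ^ i) ` {..<n}"
  have "x * x ^ i \<in> int_module ?S" if "i < n" for i
  proof (cases "Suc i = n")
    case True
    have "x * x ^ i = (\<Sum>i<n. of_int (c i) * x ^ i)" using n(2) True by (metis power_Suc)
    also have "\<dots> \<in> int_module ?S"
      by (intro int_mult.span_sum int_mult.span_scale int_mult.span_base imageI) simp
    finally show ?thesis .
  next
    case False
    hence "x ^ Suc i \<in> ?S" using that by (intro imageI) auto
    thus ?thesis using int_mult.span_base[of "x ^ Suc i" ?S] by simp
  qed
  moreover have "1 \<in> ?S" using n(1) by (intro image_eqI[of _ _ 0]) auto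
  ultimately show ?thesis by (intro that[of ?S]) auto
qed

lemma algebraic_int_common_stable:
  fixes x y :: "'a::field_char_0"
  assumes "algebraic_int x" "algebraic_int y"
  obtains S where "finite S" "1 \<in> S"
    "\<And>s. s \<in> S \<Longrightarrow> x * s \<in> int_module S" "\<And>s. s \<in> S \<Longrightarrow> y * s \<in> int_module S"
proof -
  obtain S where S: "finite S" "1 \<in> S" "\<And>s. s \<in> S \<Longrightarrow> x * s \<in> int_module S"
    using algebraic_int_obtain_stable[OF assms(1)] by blast
  obtain T where T: "finite T" "1 \<in> T" "\<And>t. t \<in> T \<Longrightarrow> y * t \<in> int_module T"
    using algebraic_int_obtain_stable[OF assms(2)] by blast
  have swap: "(\<lambda>(s, t). s * t) ` (S \<times> T) = (\<lambda>(t, s). t * s) ` (T \<times> S)"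
    unfolding product_swap[of S T, symmetric] image_image
    by (intro image_cong) (auto simp: mult.commute)
  show ?thesis
  proof (rule that)
    show "finite ((\<lambda>(s, t). s * t) ` (S \<times> T))" using S(1) T(1) by simp
    show "1 \<in> (\<lambda>(s, t). s * t) ` (S \<times> T)"
      using S(2) T(2) by (intro image_eqI[of _ _ "(1, 1)"]) auto
    fix u assume "u \<in> (\<lambda>(s, t). s * t) ` (S \<times> T)"
    thus "x * u \<in> int_module ((\<lambda>(s, t). s * t) ` (S \<times> T))"
      and "y * u \<in> int_module ((\<lambda>(s, t). s * t) ` (S \<times> T))"
      using int_module_product_stable[OF S(3), where T = T]
        int_module_product_stable[OF T(3), where T = S]
      unfolding swap by blast+
  qed
qed

lemma algebraic_int_add_mult:
  fixes x y :: "'a::field_char_0"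
  assumes "algebraic_int x" "algebraic_int y"
  shows "algebraic_int (x + y)" and "algebraic_int (x * y)"
proof -
  obtain S where S: "finite S" "1 \<in> S"
    "\<And>s. s \<in> S \<Longrightarrow> x * s \<in> int_module S" "\<And>s. s \<in> S \<Longrightarrow> y * s \<in> int_module S"
    using algebraic_int_common_stable[OF assms] by blast
  have "(x + y) * s \<in> int_module S" if "s \<in> S" for s
    using int_mult.span_add[OF S(3,4)] that by (simp add: distrib_right)
  thus "algebraic_int (x + y)" using algebraic_int_if_int_module_stable[OF S(1,2)] by simp
  have "(x * y) * s \<in> int_module S" if "s \<in> S" for s
    using int_module_mult_closed[OF S(3) S(4)[OF that]] by (simp add: mult.assoc)
  thus "algebraic_int (x * y)" using algebraic_int_if_int_module_stable[OF S(1,2)] by simp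
qed

lemma algebraic_int_sum:
  fixes f :: "'i \<Rightarrow> 'a::field_char_0"
  assumes "\<And>i. i \<in> I \<Longrightarrow> algebraic_int (f i)" shows "algebraic_int (\<Sum>i\<in>I. f i)"
  using assms by (induction I rule: infinite_finite_induct) (auto intro: algebraic_int_add_mult)

lemma algebraic_int_prod:
  fixes f :: "'i \<Rightarrow> 'a::field_char_0"
  assumes "\<And>i. i \<in> I \<Longrightarrow> algebraic_int (f i)" shows "algebraic_int (\<Prod>i\<in>I. f i)"
  using assms by (induction I rule: infinite_finite_induct) (auto intro: algebraic_int_add_mult)


section \<open>Subfields and bases\<close>

interpretation amb: domain "ambient :: 'a::field_char_0 ring"
  by (rule field.axioms(1)[OF field_from_type_algebra])

lemma ambient_simps [simp]:
  "carrier (ambient :: 'a::field_char_0 ring) = UNIV"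
  "x \<otimes>\<^bsub>ambient\<^esub> y = x * (y::'a)"
  "x \<oplus>\<^bsub>ambient\<^esub> y = x + (y::'a)"
  "\<one>\<^bsub>ambient\<^esub> = (1::'a)" "\<zero>\<^bsub>ambient\<^esub> = (0::'a)"
  by (simp_all add: ring_of_type_algebra_def)

lemma ambient_a_inv [simp]: "\<ominus>\<^bsub>ambient\<^esub> x = - (x :: 'a::field_char_0)"
  using amb.minus_equality[of "- x" x] by simp

lemma ambient_m_inv: "x \<noteq> 0 \<Longrightarrow> inv\<^bsub>ambient\<^esub> x = inverse (x :: 'a::field_char_0)"
  using amb.inv_char[of x "inverse x"] by simp

lemma ambient_pow [simp]: "x [^]\<^bsub>ambient\<^esub> (n::nat) = (x :: 'a::field_char_0) ^ n"
  by (induction n) (simp_all add: mult.commute)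

context
  fixes K :: "'a::field_char_0 set"
  assumes K: "subfield K ambient"
begin

lemma subfield_zero: "0 \<in> K" and subfield_one: "1 \<in> K"
  and subfield_add: "x \<in> K \<Longrightarrow> y \<in> K \<Longrightarrow> x + y \<in> K"
  and subfield_mult: "x \<in> K \<Longrightarrow> y \<in> K \<Longrightarrow> x * y \<in> K"
  and subfield_uminus: "x \<in> K \<Longrightarrow> - x \<in> K"
  using subringE[OF subfieldE(1)[OF K]] by auto

lemma subfield_diff: "x \<in> K \<Longrightarrow> y \<in> K \<Longrightarrow> x - y \<in> K"
  using subfield_add[OF _ subfield_uminus, of x y] by simp

lemma subfield_inverse:
  assumes "x \<in> K" shows "inverse x \<in> K"
proof (cases "x = 0")
  case False
  thus ?thesis using amb.subfield_m_inv(1)[OF K, of x] assms by (simp add: ambient_m_inv)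
qed (simp add: subfield_zero)

lemma subfield_divide: "x \<in> K \<Longrightarrow> y \<in> K \<Longrightarrow> x / y \<in> K"
  using subfield_mult[OF _ subfield_inverse, of x y] by (simp add: divide_inverse)

lemma subfield_power: "x \<in> K \<Longrightarrow> x ^ n \<in> K"
  by (induction n) (auto intro: subfield_one subfield_mult)

lemma subfield_sum: "(\<And>i. i \<in> I \<Longrightarrow> f i \<in> K) \<Longrightarrow> (\<Sum>i\<in>I. f i) \<in> K"
  by (induction I rule: infinite_finite_induct) (auto intro: subfield_zero subfield_add)

lemma subfield_prod: "(\<And>i. i \<in> I \<Longrightarrow> f i \<in> K) \<Longrightarrow> (\<Prod>i\<in>I. f i) \<in> K"
  by (induction I rule: infinite_finite_induct) (auto intro: subfield_one subfield_mult)

lemma subfield_of_nat: "of_nat n \<in> K"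
  by (induction n) (auto intro: subfield_zero subfield_add subfield_one)

lemma subfield_of_int: "of_int n \<in> K"
  by (cases n)
    (auto intro!: subfield_of_nat subfield_uminus subfield_diff subfield_one simp del: of_nat_Suc)

lemma subfield_of_rat: "of_rat q \<in> K"
  by (cases q) (auto simp: of_rat_rat intro: subfield_divide subfield_of_int)

lemma Rats_subset_subfield: "\<rat> \<subseteq> K"
  by (auto simp: Rats_def subfield_of_rat)

end

lemma subfield_ambientI:
  fixes K :: "'a::field_char_0 set"
  assumes "1 \<in> K" and diff: "\<And>x y. x \<in> K \<Longrightarrow> y \<in> K \<Longrightarrow> x - y \<in> K"
    and "\<And>x y. x \<in> K \<Longrightarrow> y \<in> K \<Longrightarrow> x * y \<in> K" and inverse: "\<And>x. x \<in> K \<Longrightarrow> inverse x \<in> K"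
  shows "subfield K ambient"
proof (rule field.subfieldI'[OF field_from_type_algebra])
  have zero: "0 \<in> K" using diff[OF assms(1) assms(1)] by simp
  have uminus: "- x \<in> K" if "x \<in> K" for x using diff[OF zero that] by simp
  have "x + y \<in> K" if "x \<in> K" "y \<in> K" for x y using diff[OF that(1) uminus[OF that(2)]] by simp
  thus "subring K ambient" by (intro amb.subringI) (use assms zero uminus in auto)
  show "inv\<^bsub>ambient\<^esub> x \<in> K" if "x \<in> K - {\<zero>\<^bsub>ambient\<^esub>}" for x
    using that inverse[of x] by (simp add: ambient_m_inv)
qed

lemma subfield_Rats: "subfield (\<rat> :: 'a::field_char_0 set) ambient"
  by (rule subfield_ambientI) auto

lemma ambient_combine:
  "length Ks = length Us \<Longrightarrow>
    ring.combine (ambient :: 'a::field_char_0 ring) Ks Us = (\<Sum>i<length Us. Ks ! i * Us ! i)"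
  by (induction Ks Us rule: list_induct2) (simp_all add: sum.lessThan_Suc_shift del: sum.lessThan_Suc)

definition field_basis :: "'a::field_char_0 set \<Rightarrow> 'a set \<Rightarrow> 'a list \<Rightarrow> bool" where
  "field_basis k l bs \<longleftrightarrow> set bs \<subseteq> l \<and>
     (\<forall>c. (\<forall>i<length bs. c i \<in> k) \<and> (\<Sum>i<length bs. c i * bs ! i) = 0 \<longrightarrow> (\<forall>i<length bs. c i = 0)) \<and>
     (\<forall>x\<in>l. \<exists>c. (\<forall>i<length bs. c i \<in> k) \<and> x = (\<Sum>i<length bs. c i * bs ! i))"

lemma field_basis_mem: "field_basis k l bs \<Longrightarrow> i < length bs \<Longrightarrow> bs ! i \<in> l"
  by (auto simp: field_basis_def)

lemma field_basis_independent:
  assumes "field_basis k l bs" "\<And>i. i < length bs \<Longrightarrow> c i \<in> k" "(\<Sum>i<length bs. c i * bs ! i) = 0"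
    and "i < length bs"
  shows "c i = 0"
  using assms unfolding field_basis_def by blast

lemma field_basis_spans:
  assumes "field_basis k l bs" "x \<in> l"
  obtains c where "\<And>i. i < length bs \<Longrightarrow> c i \<in> k" "x = (\<Sum>i<length bs. c i * bs ! i)"
  using assms unfolding field_basis_def by blast

lemma field_basis_if_independent_Span:
  fixes k l :: "'a::field_char_0 set"
  assumes k: "subfield k ambient"
    and bs: "ring.independent ambient k bs" "ring.Span ambient k bs = l"
  shows "field_basis k l bs"
  unfolding field_basis_def
proof (intro conjI allI impI ballI)
  show "set bs \<subseteq> l" using amb.Span_base_incl[OF k, of bs] bs(2) by simp
  fix c i
  assume c: "(\<forall>i<length bs. c i \<in> k) \<and> (\<Sum>i<length bs. c i * bs ! i) = 0" and "i < length bs"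
  let ?Ks = "map c [0..<length bs]"
  have "amb.combine ?Ks bs = \<zero>\<^bsub>ambient\<^esub>" using c by (simp add: ambient_combine)
  moreover have "set ?Ks \<subseteq> k" using c by auto
  ultimately have "set (take (length bs) ?Ks) \<subseteq> {\<zero>\<^bsub>ambient\<^esub>}"
    using amb.independent_imp_trivial_combine[OF k bs(1)] by blast
  thus "c i = 0" using \<open>i < length bs\<close> by (auto simp: image_subset_iff)
next
  fix x assume "x \<in> l"
  then obtain Ks where "set Ks \<subseteq> k" "length Ks = length bs" "x = amb.combine Ks bs"
    using amb.Span_mem_iff_length_version[OF k, of bs x] bs(2) by auto
  thus "\<exists>c. (\<forall>i<length bs. c i \<in> k) \<and> x = (\<Sum>i<length bs. c i * bs ! i)"
    by (intro exI[of _ "\<lambda>i. Ks ! i"]) (auto simp: ambient_combine)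
qed

lemma Span_intermediate_field:
  fixes k F l :: "'a::field_char_0 set"
  assumes k: "subfield k ambient" and F: "subfield F ambient" and l: "subfield l ambient"
    and "k \<subseteq> F" and "F \<subseteq> l" and bs: "ring.Span ambient k bs = l"
  shows "ring.Span ambient F bs = l"
proof (rule antisym)
  have "set bs \<subseteq> l" using amb.Span_base_incl[OF k, of bs] unfolding bs by simp
  hence "F <#>\<^bsub>ambient\<^esub> set bs \<subseteq> l"
    using \<open>F \<subseteq> l\<close> subfield_mult[OF l] by (auto simp: set_mult_def subset_iff)
  moreover have "subgroup l (add_monoid ambient)" by (rule subring.axioms(1)[OF subfieldE(1)[OF l]])
  ultimately show "amb.Span F bs \<subseteq> l" by (intro amb.Span_min[OF F]) auto
  show "l \<subseteq> amb.Span F bs"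
  proof
    fix x assume "x \<in> l"
    then obtain Ks where "set Ks \<subseteq> k" "length Ks = length bs" "x = amb.combine Ks bs"
      using amb.Span_mem_iff_length_version[OF k, of bs x] unfolding bs by auto
    thus "x \<in> amb.Span F bs"
      using \<open>k \<subseteq> F\<close> by (intro amb.Span_mem_iff_length_version[OF F, THEN iffD2] exI[of _ Ks]) auto
  qed
qed

locale finite_extension =
  fixes k l :: "'a::field_char_0 set"
  assumes subfield_k: "subfield k ambient" and subfield_l: "subfield l ambient"
    and k_subset_l: "k \<subseteq> l" and finite_dimension: "ring.finite_dimension ambient k l"
begin

lemma basis_exists:
  obtains bs where "ring.independent ambient k bs" "ring.Span ambient k bs = l"
  using amb.exists_base[OF subfield_k] finite_dimension unfolding amb.finite_dimension_def by metis

lemma field_basis_exists: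
  obtains bs where "field_basis k l bs"
  using basis_exists field_basis_if_independent_Span[OF subfield_k] by metis

lemma dimension_pos:
  assumes "ring.dimension ambient n k l"
  shows "n > 0"
proof (rule ccontr)
  assume "\<not> n > 0"
  hence "l = {0}" using amb.dimension_zero[OF subfield_k, of l] assms by simp
  thus False using subfield_one[OF subfield_l] by simp
qed

lemma finite_extension_over_intermediate:
  assumes F: "subfield F ambient" and "k \<subseteq> F" "F \<subseteq> l"
  shows "finite_extension F l"
proof -
  obtain bs where bs: "amb.Span k bs = l" using basis_exists by blast
  obtain Vs where "amb.independent F Vs" "amb.Span F Vs = amb.Span F bs"
    using amb.filter_base[OF F, of bs] by auto
  moreover have "amb.Span F bs = l"
    by (rule Span_intermediate_field[OF subfield_k F subfield_l assms(2,3) bs])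
  ultimately have "amb.dimension (length Vs) F l" using amb.dimensionI[OF F] by metis
  from amb.finite_dimensionI[OF this] show ?thesis
    by (rule finite_extension.intro[OF F subfield_l \<open>F \<subseteq> l\<close>])
qed

end


section \<open>Complex embeddings\<close>

definition embs :: "'a::field_char_0 set \<Rightarrow> ('a \<Rightarrow> complex) set" where
  "embs K = {\<sigma> \<in> extensional K. \<sigma> 1 = 1 \<and>
     (\<forall>x\<in>K. \<forall>y\<in>K. \<sigma> (x + y) = \<sigma> x + \<sigma> y \<and> \<sigma> (x * y) = \<sigma> x * \<sigma> y)}"

definition ext_embs :: "'a::field_char_0 set \<Rightarrow> 'a set \<Rightarrow> ('a \<Rightarrow> complex) \<Rightarrow> ('a \<Rightarrow> complex) set" where
  "ext_embs l k \<sigma> = {\<tau> \<in> embs l. \<forall>x\<in>k. \<tau> x = \<sigma> x}"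

lemma ext_embsD: "\<tau> \<in> ext_embs l k \<sigma> \<Longrightarrow> \<tau> \<in> embs l" "\<tau> \<in> ext_embs l k \<sigma> \<Longrightarrow> x \<in> k \<Longrightarrow> \<tau> x = \<sigma> x"
  by (simp_all add: ext_embs_def)

lemma embs_eqI:
  assumes "\<sigma> \<in> embs K" "\<tau> \<in> embs K" "\<And>x. x \<in> K \<Longrightarrow> \<sigma> x = \<tau> x"
  shows "\<sigma> = \<tau>"
  using assms by (auto simp: embs_def intro: extensionalityI)

context
  fixes K :: "'a::field_char_0 set" and \<sigma> :: "'a \<Rightarrow> complex"
  assumes K: "subfield K ambient" and \<sigma>: "\<sigma> \<in> embs K"
begin

lemma emb_one: "\<sigma> 1 = 1"
  and emb_add: "x \<in> K \<Longrightarrow> y \<in> K \<Longrightarrow> \<sigma> (x + y) = \<sigma> x + \<sigma> y"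
  and emb_mult: "x \<in> K \<Longrightarrow> y \<in> K \<Longrightarrow> \<sigma> (x * y) = \<sigma> x * \<sigma> y"
  using \<sigma> by (auto simp: embs_def)

lemma emb_zero: "\<sigma> 0 = 0"
  using emb_add[of 0 0] subfield_zero[OF K] by simp

lemma emb_uminus: "x \<in> K \<Longrightarrow> \<sigma> (- x) = - \<sigma> x"
  using emb_add[of x "- x"] subfield_uminus[OF K] emb_zero by (simp add: add_eq_0_iff)

lemma emb_diff: "x \<in> K \<Longrightarrow> y \<in> K \<Longrightarrow> \<sigma> (x - y) = \<sigma> x - \<sigma> y"
  using emb_add[of x "- y"] emb_uminus[of y] subfield_uminus[OF K] by simp

lemma emb_sum: "(\<And>i. i \<in> I \<Longrightarrow> f i \<in> K) \<Longrightarrow> \<sigma> (\<Sum>i\<in>I. f i) = (\<Sum>i\<in>I. \<sigma> (f i))"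
  by (induction I rule: infinite_finite_induct) (simp_all add: emb_zero emb_add subfield_sum[OF K])

lemma emb_prod: "(\<And>i. i \<in> I \<Longrightarrow> f i \<in> K) \<Longrightarrow> \<sigma> (\<Prod>i\<in>I. f i) = (\<Prod>i\<in>I. \<sigma> (f i))"
  by (induction I rule: infinite_finite_induct) (simp_all add: emb_one emb_mult subfield_prod[OF K])

lemma emb_power: "x \<in> K \<Longrightarrow> \<sigma> (x ^ n) = \<sigma> x ^ n"
  by (induction n) (simp_all add: emb_one emb_mult subfield_power[OF K])

lemma emb_eq_0_iff:
  assumes "x \<in> K" shows "\<sigma> x = 0 \<longleftrightarrow> x = 0"
proof
  show "x = 0" if "\<sigma> x = 0"
  proof (rule ccontr)
    assume "x \<noteq> 0"
    hence "1 = \<sigma> (x * inverse x)" by (simp add: emb_one)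
    also have "\<dots> = 0" using that assms by (simp add: emb_mult subfield_inverse[OF K])
    finally show False by simp
  qed
qed (simp add: emb_zero)

lemma emb_inverse:
  assumes "x \<in> K" shows "\<sigma> (inverse x) = inverse (\<sigma> x)"
proof (cases "x = 0")
  case False
  hence "\<sigma> x * \<sigma> (inverse x) = 1"
    using emb_mult[OF assms subfield_inverse[OF K assms]] by (simp add: emb_one)
  thus ?thesis by (simp add: inverse_unique)
qed (simp add: emb_zero)

lemma emb_eq_iff: "x \<in> K \<Longrightarrow> y \<in> K \<Longrightarrow> \<sigma> x = \<sigma> y \<longleftrightarrow> x = y"
  using emb_eq_0_iff[of "x - y"] by (simp add: emb_diff subfield_diff[OF K])

lemma emb_of_nat: "\<sigma> (of_nat n) = of_nat n"
  by (induction n) (simp_all add: emb_zero emb_one emb_add subfield_of_nat[OF K] subfield_one[OF K])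

lemma emb_of_int: "\<sigma> (of_int n) = of_int n"
proof (cases n rule: int_cases2)
  case (nonpos m)
  thus ?thesis by (simp add: emb_uminus emb_of_nat subfield_of_nat[OF K])
qed (simp add: emb_of_nat)

lemma emb_of_rat: "\<sigma> (of_rat q) = of_rat q"
proof (cases q)
  case (Fract a b)
  have "\<sigma> (of_int a * inverse (of_int b)) = of_int a * inverse (of_int b)"
    by (simp add: emb_mult emb_inverse emb_of_int subfield_of_int[OF K] subfield_inverse[OF K])
  thus ?thesis using Fract by (simp add: of_rat_rat divide_inverse)
qed

lemma emb_fdet:
  assumes "\<And>i j. i < n \<Longrightarrow> j < n \<Longrightarrow> f i j \<in> K"
  shows "fdet n f \<in> K" and "\<sigma> (fdet n f) = fdet n (\<lambda>i j. \<sigma> (f i j))"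
proof -
  have entry: "f i (p i) \<in> K" if "p permutes {0..<n}" "i \<in> {0..<n}" for p i
    using permutes_in_image[OF that(1), of i] that(2) assms by simp
  have term_mem: "of_int (sign p) * (\<Prod>i = 0..<n. f i (p i)) \<in> K" if "p permutes {0..<n}" for p
    by (intro subfield_mult[OF K] subfield_of_int[OF K] subfield_prod[OF K] entry that)
  thus "fdet n f \<in> K" unfolding fdet_leibniz by (intro subfield_sum[OF K]) simp
  have "\<sigma> (of_int (sign p) * (\<Prod>i = 0..<n. f i (p i))) = of_int (sign p) * (\<Prod>i = 0..<n. \<sigma> (f i (p i)))"
    if p: "p permutes {0..<n}" for p
  proof -
    have "\<sigma> (of_int (sign p) * (\<Prod>i = 0..<n. f i (p i))) = \<sigma> (of_int (sign p)) * \<sigma> (\<Prod>i = 0..<n. f i (p i))"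
      by (intro emb_mult subfield_of_int[OF K] subfield_prod[OF K] entry p)
    also have "\<sigma> (\<Prod>i = 0..<n. f i (p i)) = (\<Prod>i = 0..<n. \<sigma> (f i (p i)))"
      by (rule emb_prod) (rule entry[OF p])
    finally show ?thesis by (simp add: emb_of_int)
  qed
  thus "\<sigma> (fdet n f) = fdet n (\<lambda>i j. \<sigma> (f i j))"
    unfolding fdet_leibniz using term_mem by (subst emb_sum) auto
qed

end

lemma restrict_emb:
  assumes "k \<subseteq> l" "subfield k ambient" "\<tau> \<in> embs l"
  shows "restrict \<tau> k \<in> embs k"
  using assms subfield_add[OF assms(2)] subfield_mult[OF assms(2)] subfield_one[OF assms(2)]
  by (auto simp: embs_def subset_iff)

lemma ext_embs_eq_restrict:
  assumes "k \<subseteq> l" "subfield k ambient" "\<sigma> \<in> embs k"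
  shows "ext_embs l k \<sigma> = {\<tau> \<in> embs l. restrict \<tau> k = \<sigma>}"
proof (intro equalityI subsetI)
  fix \<tau> assume \<tau>: "\<tau> \<in> ext_embs l k \<sigma>"
  have "restrict \<tau> k = \<sigma>"
    by (rule embs_eqI[OF restrict_emb[OF assms(1,2) ext_embsD(1)[OF \<tau>]] assms(3)])
      (simp add: ext_embsD(2)[OF \<tau>])
  thus "\<tau> \<in> {\<tau> \<in> embs l. restrict \<tau> k = \<sigma>}" using ext_embsD(1)[OF \<tau>] by simp
qed (auto simp: ext_embs_def)

text \<open>
  Artin's independence of characters: applying a relation to \<open>y * x\<close> and subtracting \<open>\<sigma> y\<close> times
  the relation for \<open>x\<close> eliminates \<open>\<sigma>\<close>.
\<close>

lemma embs_linearly_independent: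
  assumes K: "subfield K ambient" and "finite T" and "T \<subseteq> embs K"
    and "\<And>x. x \<in> K \<Longrightarrow> (\<Sum>\<tau>\<in>T. c \<tau> * \<tau> x) = 0" and "\<tau> \<in> T"
  shows "c \<tau> = 0"
  using assms(2-)
proof (induction T arbitrary: c \<tau> rule: finite_induct)
  case (insert \<sigma> T)
  have \<sigma>: "\<sigma> \<in> embs K" and T: "T \<subseteq> embs K" using insert.prems(1) by auto
  have relation: "c \<sigma> * \<sigma> x + (\<Sum>\<tau>\<in>T. c \<tau> * \<tau> x) = 0" if "x \<in> K" for x
    using insert.prems(2)[OF that] insert.hyps by simp
  have c_T: "c \<tau> = 0" if "\<tau> \<in> T" for \<tau>
  proof -
    have "\<tau> \<in> embs K" "\<tau> \<noteq> \<sigma>" using that T insert.hyps by auto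
    then obtain y where y: "y \<in> K" "\<tau> y \<noteq> \<sigma> y" using embs_eqI[OF _ \<sigma>, of \<tau>] by blast
    have "(\<Sum>\<tau>\<in>T. (c \<tau> * (\<tau> y - \<sigma> y)) * \<tau> x) = 0" if x: "x \<in> K" for x
    proof -
      have "(\<Sum>\<tau>\<in>T. c \<tau> * \<tau> (y * x)) = (\<Sum>\<tau>\<in>T. c \<tau> * (\<tau> y * \<tau> x))"
        by (intro sum.cong refl) (use T in \<open>auto simp: emb_mult[OF K _ y(1) x]\<close>)
      hence "(\<Sum>\<tau>\<in>T. (c \<tau> * (\<tau> y - \<sigma> y)) * \<tau> x)
          = (\<Sum>\<tau>\<in>T. c \<tau> * \<tau> (y * x)) - \<sigma> y * (\<Sum>\<tau>\<in>T. c \<tau> * \<tau> x)"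
        by (simp add: sum_distrib_left flip: sum_subtractf) (simp add: algebra_simps)
      also have "\<dots> = (c \<sigma> * \<sigma> (y * x) + (\<Sum>\<tau>\<in>T. c \<tau> * \<tau> (y * x)))
          - \<sigma> y * (c \<sigma> * \<sigma> x + (\<Sum>\<tau>\<in>T. c \<tau> * \<tau> x))"
        unfolding emb_mult[OF K \<sigma> y(1) x] by (simp add: algebra_simps)
      also have "\<dots> = 0" using relation[OF x] relation[OF subfield_mult[OF K y(1) x]] by simp
      finally show ?thesis .
    qed
    from insert.IH[OF T this that] show ?thesis using y(2) by simp
  qed
  hence "c \<sigma> = 0" using relation[OF subfield_one[OF K]] emb_one[OF K \<sigma>] by simp
  thus ?case using c_T insert.prems(3) by auto
qed simp

context finite_extension
begin

lemma ext_emb_of_basis_comb: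
  assumes bs: "field_basis k l bs" and \<tau>: "\<tau> \<in> ext_embs l k \<sigma>" and c: "\<And>i. i < length bs \<Longrightarrow> c i \<in> k"
  shows "\<tau> (\<Sum>i<length bs. c i * bs ! i) = (\<Sum>i<length bs. \<sigma> (c i) * \<tau> (bs ! i))"
proof -
  have mem: "c i \<in> l" "bs ! i \<in> l" if "i < length bs" for i
    using c[OF that] k_subset_l field_basis_mem[OF bs that] by auto
  have "\<tau> (\<Sum>i<length bs. c i * bs ! i) = (\<Sum>i<length bs. \<tau> (c i * bs ! i))"
    by (rule emb_sum[OF subfield_l ext_embsD(1)[OF \<tau>]]) (use mem subfield_mult[OF subfield_l] in auto)
  also have "\<dots> = (\<Sum>i<length bs. \<sigma> (c i) * \<tau> (bs ! i))"
    by (intro sum.cong refl)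
      (use mem c ext_embsD(2)[OF \<tau>] in \<open>auto simp: emb_mult[OF subfield_l ext_embsD(1)[OF \<tau>]]\<close>)
  finally show ?thesis .
qed

lemma ext_embs_independent_on_basis:
  fixes m :: nat
  assumes bs: "field_basis k l bs" and t: "\<And>i. i < m \<Longrightarrow> t i \<in> ext_embs l k \<sigma>" and inj: "inj_on t {..<m}"
    and relation: "\<And>j. j < length bs \<Longrightarrow> (\<Sum>i<m. t i (bs ! j) * c i) = 0" and "i < m"
  shows "c i = 0"
proof -
  define d where "d = (\<lambda>\<tau>. c (the_inv_into {..<m} t \<tau>))"
  have d: "d (t i) = c i" if "i < m" for i
    using the_inv_into_f_f[OF inj] that by (simp add: d_def)
  have "(\<Sum>\<tau>\<in>t ` {..<m}. d \<tau> * \<tau> x) = 0" if "x \<in> l" for x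
  proof -
    obtain a where a: "\<And>i. i < length bs \<Longrightarrow> a i \<in> k" "x = (\<Sum>i<length bs. a i * bs ! i)"
      using field_basis_spans[OF bs \<open>x \<in> l\<close>] by blast
    have "c i * t i x = (\<Sum>j<length bs. \<sigma> (a j) * (t i (bs ! j) * c i))" if "i < m" for i
      unfolding a(2) using ext_emb_of_basis_comb[OF bs t[OF that], of a] a(1)
      by (simp add: sum_distrib_left mult_ac)
    hence "(\<Sum>\<tau>\<in>t ` {..<m}. d \<tau> * \<tau> x) = (\<Sum>i<m. \<Sum>j<length bs. \<sigma> (a j) * (t i (bs ! j) * c i))"
      by (simp add: sum.reindex[OF inj] d)
    also have "\<dots> = (\<Sum>j<length bs. \<Sum>i<m. \<sigma> (a j) * (t i (bs ! j) * c i))" by (rule sum.swap)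
    also have "\<dots> = (\<Sum>j<length bs. \<sigma> (a j) * (\<Sum>i<m. t i (bs ! j) * c i))"
      by (simp add: sum_distrib_left)
    also have "\<dots> = 0" using relation by simp
    finally show ?thesis .
  qed
  moreover have "t ` {..<m} \<subseteq> embs l" using t ext_embsD(1) by blast
  ultimately have "d (t i) = 0"
    using \<open>i < m\<close> by (intro embs_linearly_independent[OF subfield_l, of "t ` {..<m}" d "t i"]) auto
  thus ?thesis using d \<open>i < m\<close> by simp
qed

lemma card_subset_ext_embs_le:
  assumes bs: "field_basis k l bs" and "finite T" "T \<subseteq> ext_embs l k \<sigma>"
  shows "card T \<le> length bs"
proof (rule ccontr)
  assume "\<not> card T \<le> length bs"
  obtain t where t: "bij_betw t {..<card T} T"
    using ex_bij_betw_nat_finite[OF \<open>finite T\<close>] by (auto simp: atLeast0LessThan)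
  obtain c where c: "\<exists>j<card T. c j \<noteq> 0" "\<And>j. j < length bs \<Longrightarrow> (\<Sum>i<card T. t i (bs ! j) * c i) = 0"
    using underdetermined_system_has_solution[of "length bs" "card T" "\<lambda>j i. t i (bs ! j)"]
      \<open>\<not> card T \<le> length bs\<close> by auto
  have "c i = 0" if "i < card T" for i
    by (rule ext_embs_independent_on_basis[OF bs, of "card T" t \<sigma> c])
      (use c t bij_betw_apply[OF t] \<open>T \<subseteq> ext_embs l k \<sigma>\<close> that in \<open>auto simp: bij_betw_def\<close>)
  thus False using c(1) by blast
qed

lemma finite_ext_embs: "finite (ext_embs l k \<sigma>)"
proof (rule ccontr)
  obtain bs where bs: "field_basis k l bs" by (rule field_basis_exists)
  assume "infinite (ext_embs l k \<sigma>)"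
  then obtain T where "finite T" "card T = Suc (length bs)" "T \<subseteq> ext_embs l k \<sigma>"
    using infinite_arbitrarily_large by blast
  thus False using card_subset_ext_embs_le[OF bs, of T] by simp
qed

end


section \<open>Polynomials over a subfield\<close>

definition polys_over :: "'a::field_char_0 set \<Rightarrow> 'a poly set" where
  "polys_over K = {p. \<forall>i. poly.coeff p i \<in> K}"

lemma polys_over_coeff: "p \<in> polys_over K \<Longrightarrow> poly.coeff p i \<in> K"
  by (simp add: polys_over_def)

context
  fixes K :: "'a::field_char_0 set"
  assumes K: "subfield K ambient"
begin

lemma polys_over_monom: "c \<in> K \<Longrightarrow> Polynomial.monom c n \<in> polys_over K"
  by (simp add: polys_over_def subfield_zero[OF K])

lemma polys_over_pCons: "c \<in> K \<Longrightarrow> p \<in> polys_over K \<Longrightarrow> pCons c p \<in> polys_over K"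
  by (auto simp: polys_over_def coeff_pCons split: nat.split)

lemma polys_over_zero: "0 \<in> polys_over K"
  by (simp add: polys_over_def subfield_zero[OF K])

lemma polys_over_add: "p \<in> polys_over K \<Longrightarrow> q \<in> polys_over K \<Longrightarrow> p + q \<in> polys_over K"
  by (simp add: polys_over_def subfield_add[OF K])

lemma polys_over_diff: "p \<in> polys_over K \<Longrightarrow> q \<in> polys_over K \<Longrightarrow> p - q \<in> polys_over K"
  by (simp add: polys_over_def subfield_diff[OF K])

lemma polys_over_mult: "p \<in> polys_over K \<Longrightarrow> q \<in> polys_over K \<Longrightarrow> p * q \<in> polys_over K"
  by (simp add: polys_over_def Polynomial.coeff_mult subfield_sum[OF K] subfield_mult[OF K])

lemma polys_over_pderiv: "p \<in> polys_over K \<Longrightarrow> pderiv p \<in> polys_over K"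
  by (simp add: polys_over_def coeff_pderiv subfield_mult[OF K] subfield_of_nat[OF K] del: of_nat_Suc)

lemma poly_polys_over: "p \<in> polys_over K \<Longrightarrow> x \<in> K \<Longrightarrow> poly p x \<in> K"
  unfolding poly_altdef
  by (intro subfield_sum[OF K] subfield_mult[OF K] subfield_power[OF K] polys_over_coeff)

context
  fixes \<sigma> assumes \<sigma>: "\<sigma> \<in> embs K"
begin

lemma coeff_map_poly_emb: "poly.coeff (map_poly \<sigma> p) i = \<sigma> (poly.coeff p i)"
  by (rule coeff_map_poly) (rule emb_zero[OF K \<sigma>])

lemma map_poly_emb_add:
  "p \<in> polys_over K \<Longrightarrow> q \<in> polys_over K \<Longrightarrow> map_poly \<sigma> (p + q) = map_poly \<sigma> p + map_poly \<sigma> q"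
  by (rule poly_eqI) (simp add: coeff_map_poly_emb emb_add[OF K \<sigma>] polys_over_coeff)

lemma map_poly_emb_mult:
  "p \<in> polys_over K \<Longrightarrow> q \<in> polys_over K \<Longrightarrow> map_poly \<sigma> (p * q) = map_poly \<sigma> p * map_poly \<sigma> q"
  by (rule poly_eqI)
    (simp add: coeff_map_poly_emb Polynomial.coeff_mult emb_sum[OF K \<sigma>] emb_mult[OF K \<sigma>]
      polys_over_coeff subfield_mult[OF K])

lemma map_poly_emb_pderiv: "p \<in> polys_over K \<Longrightarrow> map_poly \<sigma> (pderiv p) = pderiv (map_poly \<sigma> p)"
  by (rule poly_eqI)
    (simp add: coeff_map_poly_emb coeff_pderiv emb_mult[OF K \<sigma>] emb_of_nat[OF K \<sigma>] polys_over_coeff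
      subfield_of_nat[OF K] del: of_nat_Suc)

lemma map_poly_emb_const: "map_poly \<sigma> [:c:] = [:\<sigma> c:]"
  by (rule poly_eqI) (simp add: coeff_map_poly_emb coeff_pCons emb_zero[OF K \<sigma>] split: nat.split)

lemma degree_map_poly_emb: "p \<in> polys_over K \<Longrightarrow> Polynomial.degree (map_poly \<sigma> p) = Polynomial.degree p"
  by (rule degree_map_poly) (simp add: emb_eq_0_iff[OF K \<sigma>] polys_over_coeff)

lemma poly_map_poly_emb:
  assumes p: "p \<in> polys_over K" and x: "x \<in> K"
  shows "poly (map_poly \<sigma> p) (\<sigma> x) = \<sigma> (poly p x)"
  unfolding poly_altdef degree_map_poly_emb[OF p]
  using polys_over_coeff[OF p] x
  by (simp add: coeff_map_poly_emb emb_sum[OF K \<sigma>] emb_mult[OF K \<sigma>] emb_power[OF K \<sigma>]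
      subfield_mult[OF K] subfield_power[OF K])

end

end


section \<open>Extending embeddings\<close>

lemma card_simple_roots:
  fixes q :: "complex poly"
  assumes "\<And>z. poly q z = 0 \<Longrightarrow> poly (pderiv q) z \<noteq> 0"
  shows "card {z. poly q z = 0} = Polynomial.degree q"
proof -
  have "rsquarefree q" using assms by (auto simp: rsquarefree_roots)
  hence q: "smult (Polynomial.lead_coeff q) (\<Prod>z | poly q z = 0. [:- z, 1:]) = q" "q \<noteq> 0"
    using complex_poly_decompose_rsquarefree[of q] by (auto simp: rsquarefree_def)
  have "Polynomial.degree q = Polynomial.degree (\<Prod>z | poly q z = 0. [:- z, 1:])"
    using q by (metis degree_smult_eq leading_coeff_0_iff)
  also have "\<dots> = (\<Sum>z | poly q z = 0. Polynomial.degree [:- z, 1:])"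
    by (rule degree_prod_eq_sum_degree) auto
  finally show ?thesis by simp
qed

locale simple_extension =
  fixes k F :: "'a::field_char_0 set" and a :: 'a and m :: "'a poly"
  assumes subfield_k: "subfield k ambient" and subfield_F: "subfield F ambient"
    and F_eq: "F = (\<lambda>p. poly p a) ` polys_over k"
    and min_poly_over: "m \<in> polys_over k" and min_poly_monic: "Polynomial.lead_coeff m = 1"
    and min_poly_root: "poly m a = 0"
    and min_poly_minimal:
      "p \<in> polys_over k \<Longrightarrow> poly p a = 0 \<Longrightarrow> Polynomial.degree p < Polynomial.degree m \<Longrightarrow> p = 0"
begin

lemma k_subset_F: "k \<subseteq> F"
proof
  fix u assume "u \<in> k"
  hence "[:u:] \<in> polys_over k" by (intro polys_over_pCons[OF subfield_k] polys_over_zero[OF subfield_k])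
  thus "u \<in> F" unfolding F_eq by (intro image_eqI[of _ _ "[:u:]"]) auto
qed

lemma degree_min_poly_pos: "Polynomial.degree m > 0"
proof (rule ccontr)
  assume "\<not> Polynomial.degree m > 0"
  then obtain c where "m = [:c:]" by (auto elim: degree_eq_zeroE)
  thus False using min_poly_monic min_poly_root by simp
qed

lemma degree_min_poly_gt_1:
  assumes "a \<notin> k"
  shows "Polynomial.degree m > 1"
proof (rule ccontr)
  assume "\<not> Polynomial.degree m > 1"
  hence "Polynomial.degree m = 1" using degree_min_poly_pos by simp
  hence "a = - poly.coeff m 0"
    using min_poly_root min_poly_monic by (simp add: poly_altdef eq_neg_iff_add_eq_0 add.commute)
  thus False using assms subfield_uminus[OF subfield_k] polys_over_coeff[OF min_poly_over] by auto
qed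

definition emb_at :: "('a \<Rightarrow> complex) \<Rightarrow> complex \<Rightarrow> 'a \<Rightarrow> complex" where
  "emb_at \<sigma> z = restrict (\<lambda>x. poly (map_poly \<sigma> (SOME p. p \<in> polys_over k \<and> x = poly p a)) z) F"

context
  fixes \<sigma> :: "'a \<Rightarrow> complex" and z :: complex
  assumes \<sigma>: "\<sigma> \<in> embs k" and z: "poly (map_poly \<sigma> m) z = 0"
begin

lemma poly_map_emb_eq_0:
  assumes "p \<in> polys_over k" "poly p a = 0"
  shows "poly (map_poly \<sigma> p) z = 0"
  using assms
proof (induction "Polynomial.degree p" arbitrary: p rule: less_induct)
  case less
  show ?case
  proof (cases "p = 0")
    case False
    hence degree_le: "Polynomial.degree m \<le> Polynomial.degree p"
      using min_poly_minimal[OF less.prems] by linarith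
    define s where
      "s = Polynomial.monom (Polynomial.lead_coeff p) (Polynomial.degree p - Polynomial.degree m)"
    have s: "s \<in> polys_over k"
      unfolding s_def by (intro polys_over_monom[OF subfield_k] polys_over_coeff less.prems)
    define q where "q = p - s * m"
    have q: "q \<in> polys_over k" "poly q a = 0"
      unfolding q_def
      by (intro polys_over_diff[OF subfield_k] polys_over_mult[OF subfield_k] less.prems s
        min_poly_over)
        (simp add: less.prems min_poly_root)
    have "q = 0 \<or> Polynomial.degree q < Polynomial.degree p"
    proof (rule eq_zero_or_degree_less)
      have degree_s: "Polynomial.degree s = Polynomial.degree p - Polynomial.degree m"
        unfolding s_def by (rule Polynomial.degree_monom_eq) (use False in simp)
      have "s \<noteq> 0" "m \<noteq> 0" using False min_poly_monic by (auto simp: s_def)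
      hence "Polynomial.degree (s * m) = Polynomial.degree p"
        using degree_s degree_le by (simp add: degree_mult_eq)
      moreover have "Polynomial.lead_coeff s = Polynomial.lead_coeff p"
        unfolding degree_s by (simp add: s_def)
      hence "Polynomial.lead_coeff (s * m) = Polynomial.lead_coeff p"
        using min_poly_monic by (simp only: lead_coeff_mult mult_1_right)
      ultimately show "Polynomial.degree q \<le> Polynomial.degree p"
        "poly.coeff q (Polynomial.degree p) = 0"
        unfolding q_def by (auto intro: degree_diff_le)
    qed
    hence "poly (map_poly \<sigma> q) z = 0" using less.hyps q by auto
    moreover have "map_poly \<sigma> p = map_poly \<sigma> q + map_poly \<sigma> s * map_poly \<sigma> m"
      using map_poly_emb_add[OF subfield_k \<sigma> q(1) polys_over_mult[OF subfield_k s min_poly_over]]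
        map_poly_emb_mult[OF subfield_k \<sigma> s min_poly_over] by (simp add: q_def)
    ultimately show ?thesis using z by simp
  qed simp
qed

lemma emb_at_poly:
  assumes p: "p \<in> polys_over k"
  shows "emb_at \<sigma> z (poly p a) = poly (map_poly \<sigma> p) z"
proof -
  define q where "q = (SOME q. q \<in> polys_over k \<and> poly p a = poly q a)"
  have q: "q \<in> polys_over k" "poly p a = poly q a"
    using someI[of "\<lambda>q. q \<in> polys_over k \<and> poly p a = poly q a" p] p unfolding q_def by auto
  have pq: "p - q \<in> polys_over k" by (rule polys_over_diff[OF subfield_k p q(1)])
  hence "poly (map_poly \<sigma> (p - q)) z = 0" using q(2) by (intro poly_map_emb_eq_0) simp_all
  moreover have "map_poly \<sigma> p = map_poly \<sigma> (p - q) + map_poly \<sigma> q"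
    using map_poly_emb_add[OF subfield_k \<sigma> pq q(1)] by simp
  moreover have "poly p a \<in> F" unfolding F_eq using p by blast
  ultimately show ?thesis by (simp add: emb_at_def flip: q_def)
qed

lemma emb_at_mem: "emb_at \<sigma> z \<in> ext_embs F k \<sigma>"
proof -
  have const: "emb_at \<sigma> z u = \<sigma> u" if "u \<in> k" for u
    using emb_at_poly[of "[:u:]"] polys_over_pCons[OF subfield_k that polys_over_zero[OF subfield_k]]
    by (simp add: map_poly_emb_const[OF subfield_k \<sigma>])
  moreover have "emb_at \<sigma> z (x + y) = emb_at \<sigma> z x + emb_at \<sigma> z y \<and>
      emb_at \<sigma> z (x * y) = emb_at \<sigma> z x * emb_at \<sigma> z y" if xy: "x \<in> F" "y \<in> F" for x y
  proof -
    obtain p q where p: "p \<in> polys_over k" "x = poly p a" and q: "q \<in> polys_over k" "y = poly q a"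
      using xy unfolding F_eq by blast
    show ?thesis
      using emb_at_poly[OF polys_over_add[OF subfield_k p(1) q(1)]]
        emb_at_poly[OF polys_over_mult[OF subfield_k p(1) q(1)]]
      by (simp add: p q emb_at_poly map_poly_emb_add[OF subfield_k \<sigma>]
        map_poly_emb_mult[OF subfield_k \<sigma>])
  qed
  moreover have "emb_at \<sigma> z 1 = 1"
    using const[OF subfield_one[OF subfield_k]] emb_one[OF subfield_k \<sigma>] by simp
  ultimately show ?thesis by (auto simp: ext_embs_def embs_def emb_at_def)
qed

lemma emb_at_generator: "emb_at \<sigma> z a = z"
proof -
  have "[:0, 1:] \<in> polys_over k"
    by (intro polys_over_pCons polys_over_zero subfield_k subfield_zero subfield_one)
  moreover have "map_poly \<sigma> [:0, 1:] = [:0, 1:]"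
    using emb_one[OF subfield_k \<sigma>] emb_zero[OF subfield_k \<sigma>] by (simp add: map_poly_pCons)
  ultimately show ?thesis using emb_at_poly[of "[:0, 1:]"] by simp
qed

text \<open>The embedding at \<open>z\<close> maps \<open>m'(a)\<close>, which is nonzero by minimality, to the derivative at \<open>z\<close>.\<close>

lemma min_poly_simple_root: "poly (pderiv (map_poly \<sigma> m)) z \<noteq> 0"
proof
  assume "poly (pderiv (map_poly \<sigma> m)) z = 0"
  hence "emb_at \<sigma> z (poly (pderiv m) a) = 0"
    using emb_at_poly[OF polys_over_pderiv[OF subfield_k min_poly_over]]
    by (simp add: map_poly_emb_pderiv[OF subfield_k \<sigma> min_poly_over])
  moreover have "poly (pderiv m) a \<in> F"
    unfolding F_eq using polys_over_pderiv[OF subfield_k min_poly_over] by blast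
  ultimately have "poly (pderiv m) a = 0"
    using emb_eq_0_iff[OF subfield_F ext_embsD(1)[OF emb_at_mem]] by blast
  hence "pderiv m = 0"
    using min_poly_minimal[OF polys_over_pderiv[OF subfield_k min_poly_over]] degree_min_poly_pos
    by (simp add: degree_pderiv)
  thus False using degree_min_poly_pos by (simp add: pderiv_eq_0_iff)
qed

end

lemma degree_min_poly_le_card_ext_embs:
  assumes \<sigma>: "\<sigma> \<in> embs k" and fin: "finite (ext_embs F k \<sigma>)"
  shows "Polynomial.degree m \<le> card (ext_embs F k \<sigma>)"
proof -
  let ?roots = "{z. poly (map_poly \<sigma> m) z = 0}"
  have "Polynomial.degree m = card ?roots"
    using card_simple_roots[of "map_poly \<sigma> m"] min_poly_simple_root[OF \<sigma>]
      degree_map_poly_emb[OF subfield_k \<sigma> min_poly_over] by simp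
  also have "\<dots> \<le> card (ext_embs F k \<sigma>)"
  proof (rule card_inj_on_le[OF _ _ fin])
    show "inj_on (emb_at \<sigma>) ?roots"
      using emb_at_generator[OF \<sigma>] by (intro inj_on_inverseI[where g = "\<lambda>\<tau>. \<tau> a"]) simp
    show "emb_at \<sigma> ` ?roots \<subseteq> ext_embs F k \<sigma>" using emb_at_mem[OF \<sigma>] by blast
  qed
  finally show ?thesis .
qed

end

lemma simple_extension_eq_polys:
  fixes k :: "'a::field_char_0 set"
  assumes k: "subfield k ambient"
  shows "ring.simple_extension ambient k a = (\<lambda>p. poly p a) ` polys_over k"
proof (intro equalityI subsetI)
  fix x assume "x \<in> amb.simple_extension k a"
  thus "x \<in> (\<lambda>p. poly p a) ` polys_over k"
  proof (induction x rule: amb.simple_extension.induct)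
    case zero
    show ?case using polys_over_zero[OF k] by (intro image_eqI[of _ _ 0]) auto
  next
    case (lin y u)
    then obtain p where "p \<in> polys_over k" "y = poly p a" by blast
    thus ?case using polys_over_pCons[OF k \<open>u \<in> k\<close>]
      by (intro image_eqI[of _ _ "pCons u p"]) (auto simp: add.commute mult.commute)
  qed
next
  fix x assume "x \<in> (\<lambda>p. poly p a) ` polys_over k"
  then obtain p where "p \<in> polys_over k" "x = poly p a" by blast
  thus "x \<in> amb.simple_extension k a"
  proof (induction p arbitrary: x)
    case 0
    thus ?case using amb.simple_extension.zero by simp
  next
    case (pCons u p)
    have "u \<in> k" "p \<in> polys_over k"
      using polys_over_coeff[OF pCons.prems(1), of 0] polys_over_coeff[OF pCons.prems(1), of "Suc _"]
      by (simp_all add: polys_over_def)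
    hence "poly p a \<otimes>\<^bsub>ambient\<^esub> a \<oplus>\<^bsub>ambient\<^esub> u \<in> amb.simple_extension k a"
      by (intro amb.simple_extension.lin pCons.IH) auto
    thus ?case using pCons.prems(2) by (simp add: add.commute mult.commute)
  qed
qed

context finite_extension
begin

lemma simple_extension_power_basis:
  assumes "a \<in> l"
  defines "F \<equiv> ring.simple_extension ambient k a"
  obtains n where "ring.dimension ambient n k F"
    "\<And>c. \<forall>i<n. c i \<in> k \<Longrightarrow> (\<Sum>i<n. c i * a ^ i) = 0 \<Longrightarrow> \<forall>i<n. c i = 0"
    "\<And>x. x \<in> F \<Longrightarrow> \<exists>c. (\<forall>i<n. c i \<in> k) \<and> x = (\<Sum>i<n. c i * a ^ i)"
proof -
  have algebraic: "(amb.algebraic over k) a"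
    by (rule amb.finite_dimension_imp_algebraic[OF subfield_k subfieldE(1)[OF subfield_l]
      finite_dimension assms(1)])
  define n where "n = Polynomials.degree (amb.Irr k a)"
  let ?bs = "amb.exp_base a n"
  have basis: "field_basis k F ?bs"
    unfolding F_def n_def
    by (rule field_basis_if_independent_Span[OF subfield_k
          amb.exp_base_independent[OF subfield_k _ algebraic]
          amb.Span_exp_base[OF subfield_k _ algebraic]]) simp_all
  have len: "length ?bs = n" by (simp add: amb.exp_base_def)
  have reindex: "(\<Sum>i<n. c i * ?bs ! i) = (\<Sum>i<n. c (n - Suc i) * a ^ i)" for c
  proof -
    have "(\<Sum>i<n. c i * ?bs ! i) = (\<Sum>i<n. c (n - Suc (n - Suc i)) * a ^ (n - Suc i))"
      by (intro sum.cong) (auto simp: amb.exp_base_def rev_nth Suc_diff_Suc)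
    also have "\<dots> = (\<Sum>i<n. c (n - Suc i) * a ^ i)" by (rule sum.nat_diff_reindex)
    finally show ?thesis .
  qed
  show ?thesis
  proof (rule that)
    show "amb.dimension n k F"
      unfolding n_def F_def by (rule amb.dimension_simple_extension[OF subfield_k _ algebraic]) simp
    fix c assume c: "\<forall>i<n. c i \<in> k" "(\<Sum>i<n. c i * a ^ i) = 0"
    let ?c = "\<lambda>i. c (n - Suc i)"
    have "(\<Sum>i<n. ?c i * ?bs ! i) = (\<Sum>i<n. c i * a ^ i)"
      unfolding reindex by (intro sum.cong) (auto simp: Suc_diff_Suc)
    hence "?c (n - Suc i) = 0" if "i < n" for i
      using field_basis_independent[OF basis, of ?c "n - Suc i"] c that len by simp
    thus "\<forall>i<n. c i = 0" by (simp add: Suc_diff_Suc)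
  next
    fix x assume "x \<in> F"
    then obtain c where "\<And>i. i < length ?bs \<Longrightarrow> c i \<in> k" "x = (\<Sum>i<length ?bs. c i * ?bs ! i)"
      using field_basis_spans[OF basis] by blast
    thus "\<exists>c. (\<forall>i<n. c i \<in> k) \<and> x = (\<Sum>i<n. c i * a ^ i)"
      using reindex[of c] len by (intro exI[of _ "\<lambda>i. c (n - Suc i)"]) simp
  qed
qed

lemma simple_extension_exists:
  assumes "a \<in> l"
  obtains F m where "simple_extension k F a m" "ring.dimension ambient (Polynomial.degree m) k F"
    "a \<in> F" "F \<subseteq> l"
proof -
  let ?F = "amb.simple_extension k a"
  have algebraic: "(amb.algebraic over k) a"
    by (rule amb.finite_dimension_imp_algebraic[OF subfield_k subfieldE(1)[OF subfield_l]
      finite_dimension assms])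
  have F: "subfield ?F ambient"
    using amb.simple_extension_is_subfield[OF subfield_k, of a] algebraic by simp
  have "a \<in> ?F" by (rule amb.simple_extension_mem[OF subfieldE(1)[OF subfield_k]]) simp
  have "?F \<subseteq> l"
    by (rule amb.simple_extension_subring_incl[OF subfieldE(1)[OF subfield_l] k_subset_l assms])
  obtain n where dim: "amb.dimension n k ?F"
    and indep: "\<And>c. \<forall>i<n. c i \<in> k \<Longrightarrow> (\<Sum>i<n. c i * a ^ i) = 0 \<Longrightarrow> \<forall>i<n. c i = 0"
    and span: "\<And>x. x \<in> ?F \<Longrightarrow> \<exists>c. (\<forall>i<n. c i \<in> k) \<and> x = (\<Sum>i<n. c i * a ^ i)"
    using simple_extension_power_basis[OF assms] by blast
  obtain r where r: "\<And>i. i < n \<Longrightarrow> r i \<in> k" "a ^ n = (\<Sum>i<n. r i * a ^ i)"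
    using span[OF subfield_power[OF F \<open>a \<in> ?F\<close>, of n]] by blast
  define m where "m = Polynomial.monom 1 n - (\<Sum>i<n. Polynomial.monom (r i) i)"
  have coeff_m: "poly.coeff m i = (if i = n then 1 else if i < n then - r i else 0)" for i
    by (simp add: m_def coeff_sum sum.If_cases)
  have degree_m: "Polynomial.degree m = n"
    by (rule antisym[OF degree_le le_degree]) (simp_all add: coeff_m)
  have "simple_extension k ?F a m"
  proof (rule simple_extension.intro[OF subfield_k F simple_extension_eq_polys[OF subfield_k]])
    show "m \<in> polys_over k"
      using r(1) subfield_zero[OF subfield_k] subfield_one[OF subfield_k] subfield_uminus[OF subfield_k]
      by (auto simp: polys_over_def coeff_m)
    show "Polynomial.lead_coeff m = 1" by (simp add: degree_m coeff_m)
    show "poly m a = 0" using r(2) by (simp add: m_def poly_sum poly_monom)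
    fix p assume p: "p \<in> polys_over k" "poly p a = 0" "Polynomial.degree p < Polynomial.degree m"
    have "poly p a = (\<Sum>i<n. poly.coeff p i * a ^ i)"
      unfolding poly_altdef using p(3) degree_m by (intro sum.mono_neutral_left) (auto simp: coeff_eq_0)
    hence "\<forall>i<n. poly.coeff p i = 0"
      using polys_over_coeff[OF p(1)] p(2) by (intro indep) simp_all
    moreover have "poly.coeff p i = 0" if "\<not> i < n" for i
      using p(3) degree_m that by (simp add: coeff_eq_0)
    ultimately show "p = 0" by (intro poly_eqI) auto
  qed
  moreover have "amb.dimension (Polynomial.degree m) k ?F" unfolding degree_m by (rule dim)
  ultimately show ?thesis using \<open>a \<in> ?F\<close> \<open>?F \<subseteq> l\<close> by (rule that)
qed

lemma ext_embs_tower: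
  assumes F: "subfield F ambient" "k \<subseteq> F" "F \<subseteq> l"
  shows "ext_embs l k \<sigma> = (\<Union>\<rho>\<in>ext_embs F k \<sigma>. ext_embs l F \<rho>)"
proof (intro equalityI subsetI)
  fix \<tau> assume \<tau>: "\<tau> \<in> ext_embs l k \<sigma>"
  hence "restrict \<tau> F \<in> ext_embs F k \<sigma>" "\<tau> \<in> ext_embs l F (restrict \<tau> F)"
    using restrict_emb[OF F(3,1) ext_embsD(1)[OF \<tau>]] F(2) by (auto simp: ext_embs_def)
  thus "\<tau> \<in> (\<Union>\<rho>\<in>ext_embs F k \<sigma>. ext_embs l F \<rho>)" by blast
qed (use F in \<open>fastforce simp: ext_embs_def\<close>)

lemma card_ext_embs_tower:
  assumes F: "subfield F ambient" "k \<subseteq> F" "F \<subseteq> l" and fin: "finite (ext_embs F k \<sigma>)"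
  shows "card (ext_embs l k \<sigma>) = (\<Sum>\<rho>\<in>ext_embs F k \<sigma>. card (ext_embs l F \<rho>))"
  unfolding ext_embs_tower[OF F]
proof (rule card_UN_disjoint[OF fin])
  show "\<forall>\<rho>\<in>ext_embs F k \<sigma>. finite (ext_embs l F \<rho>)"
    using finite_extension.finite_ext_embs[OF finite_extension_over_intermediate[OF F]] by blast
  show "\<forall>\<rho>\<in>ext_embs F k \<sigma>. \<forall>\<rho>'\<in>ext_embs F k \<sigma>. \<rho> \<noteq> \<rho>' \<longrightarrow> ext_embs l F \<rho> \<inter> ext_embs l F \<rho>' = {}"
  proof (intro ballI impI)
    fix \<rho> \<rho>' assume \<rho>: "\<rho> \<in> ext_embs F k \<sigma>" "\<rho>' \<in> ext_embs F k \<sigma>" "\<rho> \<noteq> \<rho>'"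
    then obtain x where "x \<in> F" "\<rho> x \<noteq> \<rho>' x"
      using embs_eqI[of \<rho> F \<rho>'] by (auto simp: ext_embs_def)
    thus "ext_embs l F \<rho> \<inter> ext_embs l F \<rho>' = {}" by (auto simp: ext_embs_def)
  qed
qed

lemma simple_extension_tower:
  assumes a: "a \<in> l" and dim: "ring.dimension ambient n k l"
  obtains F m d where "simple_extension k F a m" "finite_extension k F" "finite_extension F l"
    "ring.dimension ambient d F l" "n = Polynomial.degree m * d"
proof -
  obtain F m where simple: "simple_extension k F a m"
    and dim_F: "amb.dimension (Polynomial.degree m) k F"
    and "F \<subseteq> l"
    using simple_extension_exists[OF a] by blast
  interpret simple: simple_extension k F a m by (rule simple)
  interpret F: finite_extension F l
    by (rule finite_extension_over_intermediate[OF simple.subfield_F simple.k_subset_F \<open>F \<subseteq> l\<close>])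
  obtain Vs where "amb.independent F Vs" "amb.Span F Vs = l" by (rule F.basis_exists)
  note dim_l = amb.dimensionI[OF simple.subfield_F this]
  show ?thesis
  proof (rule that[OF simple _ F.finite_extension_axioms dim_l])
    show "finite_extension k F"
      by (rule finite_extension.intro[OF subfield_k simple.subfield_F simple.k_subset_F
            amb.finite_dimensionI[OF dim_F]])
    show "n = Polynomial.degree m * length Vs"
      using amb.dimension_is_inj[OF subfield_k dim]
        amb.telescopic_base[OF subfield_k simple.subfield_F dim_F dim_l] by blast
  qed
qed

end

text \<open>
  An embedding extends to \<open>k(a)\<close> in as many ways as the minimal polynomial of \<open>a\<close> has roots;
  the remaining extension has smaller degree.
\<close>

lemma dimension_le_card_ext_embs:
  fixes k l :: "'a::field_char_0 set"
  assumes "finite_extension k l" "ring.dimension ambient n k l" "\<sigma> \<in> embs k"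
  shows "n \<le> card (ext_embs l k \<sigma>)"
  using assms
proof (induction n arbitrary: k \<sigma> rule: less_induct)
  case (less n)
  interpret finite_extension k l by fact
  show ?case
  proof (cases "l = k")
    case True
    have "amb.dimension 1 k l" using amb.dimension_one[OF subfield_k] True by simp
    hence "n = 1" using amb.dimension_is_inj[OF subfield_k less.prems(2)] by blast
    moreover have "ext_embs l k \<sigma> = {\<sigma>}"
      using less.prems(3) True by (auto simp: ext_embs_def intro: embs_eqI)
    ultimately show ?thesis by simp
  next
    case False
    then obtain a where a: "a \<in> l" "a \<notin> k" using k_subset_l by blast
    obtain F m d where simple: "simple_extension k F a m" and kF: "finite_extension k F"
      and F: "finite_extension F l" and dim: "amb.dimension d F l" and n: "n = Polynomial.degree m * d"
      using simple_extension_tower[OF a(1) less.prems(2)] .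
    interpret simple: simple_extension k F a m by (rule simple)
    interpret kF: finite_extension k F by (rule kF)
    have "d < n"
      using dimension_pos[OF less.prems(2)] n simple.degree_min_poly_gt_1[OF a(2)] by simp
    have "n \<le> (\<Sum>\<rho>\<in>ext_embs F k \<sigma>. d)"
      using simple.degree_min_poly_le_card_ext_embs[OF less.prems(3) kF.finite_ext_embs] n by simp
    also have "\<dots> \<le> (\<Sum>\<rho>\<in>ext_embs F k \<sigma>. card (ext_embs l F \<rho>))"
      using less.IH[OF \<open>d < n\<close> F dim] ext_embsD(1) by (intro sum_mono) blast
    also have "\<dots> = card (ext_embs l k \<sigma>)"
      by (rule card_ext_embs_tower[OF simple.subfield_F simple.k_subset_F _ kF.finite_ext_embs,
        symmetric])
        (rule finite_extension.k_subset_l[OF F])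
    finally show ?thesis .
  qed
qed

context finite_extension
begin

lemma card_ext_embs:
  assumes bs: "ring.independent ambient k bs" "ring.Span ambient k bs = l" and \<sigma>: "\<sigma> \<in> embs k"
  shows "card (ext_embs l k \<sigma>) = length bs"
proof (rule antisym)
  show "card (ext_embs l k \<sigma>) \<le> length bs"
    by (rule card_subset_ext_embs_le[OF field_basis_if_independent_Span[OF subfield_k bs]
      finite_ext_embs subset_refl])
  show "length bs \<le> card (ext_embs l k \<sigma>)"
    by (rule dimension_le_card_ext_embs[OF finite_extension_axioms amb.dimensionI[OF subfield_k bs] \<sigma>])
qed

end


section \<open>Norm and trace\<close>

definition mult_matrix :: "'a::field_char_0 set \<Rightarrow> 'a list \<Rightarrow> 'a \<Rightarrow> (nat \<Rightarrow> nat \<Rightarrow> 'a) \<Rightarrow> bool" where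
  "mult_matrix k bs x A \<longleftrightarrow> (\<forall>i<length bs. \<forall>j<length bs. A i j \<in> k) \<and>
     (\<forall>j<length bs. x * bs ! j = (\<Sum>i<length bs. A i j * bs ! i))"

lemma mult_matrix_exists:
  assumes l: "subfield l ambient" and basis: "field_basis k l bs" and "x \<in> l"
  obtains A where "mult_matrix k bs x A"
proof -
  have "\<exists>c. (\<forall>i<length bs. c i \<in> k) \<and> x * bs ! j = (\<Sum>i<length bs. c i * bs ! i)"
    if "j < length bs" for j
    using field_basis_spans[OF basis subfield_mult[OF l \<open>x \<in> l\<close> field_basis_mem[OF basis that]]] by metis
  hence "\<forall>j\<in>{..<length bs}. \<exists>c. (\<forall>i<length bs. c i \<in> k) \<and> x * bs ! j = (\<Sum>i<length bs. c i * bs ! i)"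
    by blast
  then obtain c where
    "\<forall>j\<in>{..<length bs}. (\<forall>i<length bs. c j i \<in> k) \<and> x * bs ! j = (\<Sum>i<length bs. c j i * bs ! i)"
    by (rule bchoice[THEN exE])
  hence "mult_matrix k bs x (\<lambda>i j. c j i)" by (simp add: mult_matrix_def)
  thus ?thesis by (rule that)
qed

locale embedding_matrix = finite_extension k l for k l :: "'a::field_char_0 set" +
  fixes bs :: "'a list" and \<sigma> :: "'a \<Rightarrow> complex" and t :: "nat \<Rightarrow> 'a \<Rightarrow> complex"
  assumes basis: "field_basis k l bs" and \<sigma>: "\<sigma> \<in> embs k"
    and enum: "bij_betw t {..<length bs} (ext_embs l k \<sigma>)"
begin

lemma enum_mem: "i < length bs \<Longrightarrow> t i \<in> ext_embs l k \<sigma>"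
  using bij_betw_apply[OF enum] by simp

lemma det_nonzero: "fdet (length bs) (\<lambda>i j. t i (bs ! j)) \<noteq> 0"
proof
  assume "fdet (length bs) (\<lambda>i j. t i (bs ! j)) = 0"
  hence "fdet (length bs) (\<lambda>j i. t i (bs ! j)) = 0"
    using fdet_transpose[of "length bs" "\<lambda>i j. t i (bs ! j)"] by simp
  then obtain c where c: "\<exists>i<length bs. c i \<noteq> 0"
    "\<And>j. j < length bs \<Longrightarrow> (\<Sum>i<length bs. t i (bs ! j) * c i) = 0"
    using fdet_eq_0_imp_null_vector by blast
  have "c i = 0" if "i < length bs" for i
    by (rule ext_embs_independent_on_basis[OF basis enum_mem])
      (use c that enum in \<open>auto simp: bij_betw_def\<close>)
  thus False using c(1) by blast
qed

definition inverse_matrix :: "nat \<Rightarrow> nat \<Rightarrow> complex" where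
  "inverse_matrix = (SOME g. \<forall>i<length bs. \<forall>m<length bs.
     (\<Sum>j<length bs. t i (bs ! j) * g j m) = (if i = m then 1 else 0) \<and>
     (\<Sum>j<length bs. g i j * t j (bs ! m)) = (if i = m then 1 else 0))"

lemma inverse_matrix:
  assumes "i < length bs" "m < length bs"
  shows "(\<Sum>j<length bs. t i (bs ! j) * inverse_matrix j m) = (if i = m then 1 else 0)"
    and "(\<Sum>j<length bs. inverse_matrix i j * t j (bs ! m)) = (if i = m then 1 else 0)"
proof -
  let ?P = "\<lambda>g. \<forall>i<length bs. \<forall>m<length bs.
     (\<Sum>j<length bs. t i (bs ! j) * g j m) = (if i = m then 1 else 0) \<and>
     (\<Sum>j<length bs. g i j * t j (bs ! m)) = (if i = m then 1 else 0)"
  have "\<exists>g. ?P g"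
    by (rule fdet_nonzero_imp_inverse[OF det_nonzero]) blast
  hence "?P inverse_matrix" unfolding inverse_matrix_def by (rule someI_ex)
  thus "(\<Sum>j<length bs. t i (bs ! j) * inverse_matrix j m) = (if i = m then 1 else 0)"
    and "(\<Sum>j<length bs. inverse_matrix i j * t j (bs ! m)) = (if i = m then 1 else 0)"
    using assms by blast+
qed

lemma emb_coordinate:
  assumes c: "\<And>m. m < length bs \<Longrightarrow> c m \<in> k" and j: "j < length bs"
  shows "\<sigma> (c j) = (\<Sum>i<length bs. inverse_matrix j i * t i (\<Sum>m<length bs. c m * bs ! m))"
proof -
  let ?n = "length bs"
  have "(\<Sum>i<?n. inverse_matrix j i * t i (\<Sum>m<?n. c m * bs ! m))
      = (\<Sum>i<?n. \<Sum>m<?n. inverse_matrix j i * t i (bs ! m) * \<sigma> (c m))"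
    by (intro sum.cong refl)
      (simp add: ext_emb_of_basis_comb[OF basis enum_mem c] sum_distrib_left mult_ac)
  also have "\<dots> = (\<Sum>m<?n. \<Sum>i<?n. inverse_matrix j i * t i (bs ! m) * \<sigma> (c m))" by (rule sum.swap)
  also have "\<dots> = (\<Sum>m<?n. (\<Sum>i<?n. inverse_matrix j i * t i (bs ! m)) * \<sigma> (c m))"
    by (simp add: sum_distrib_right)
  also have "\<dots> = (\<Sum>m<?n. if j = m then \<sigma> (c m) else 0)"
    by (intro sum.cong refl) (use inverse_matrix(2) j in auto)
  also have "\<dots> = \<sigma> (c j)" using j by simp
  finally show ?thesis by simp
qed

lemma mult_matrix_diagonalized:
  assumes A: "mult_matrix k bs x A" and "x \<in> l" and "i < length bs" "j < length bs"
  shows "(\<Sum>m<length bs. t i (bs ! m) * \<sigma> (A m j)) = t i x * t i (bs ! j)"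
proof -
  have "t i (x * bs ! j) = (\<Sum>m<length bs. \<sigma> (A m j) * t i (bs ! m))"
    using A assms(4) ext_emb_of_basis_comb[OF basis enum_mem[OF assms(3)], of "\<lambda>m. A m j"]
    by (simp add: mult_matrix_def)
  moreover have "t i (x * bs ! j) = t i x * t i (bs ! j)"
    by (rule emb_mult[OF subfield_l ext_embsD(1)[OF enum_mem[OF assms(3)]] assms(2)
          field_basis_mem[OF basis assms(4)]])
  ultimately show ?thesis by (simp add: mult.commute)
qed

lemma emb_det_mult_matrix:
  assumes A: "mult_matrix k bs x A" and x: "x \<in> l"
  shows "\<sigma> (fdet (length bs) A) = (\<Prod>\<tau>\<in>ext_embs l k \<sigma>. \<tau> x)"
proof -
  let ?n = "length bs" and ?T = "\<lambda>i j. t i (bs ! j)"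
  have "fdet ?n ?T * fdet ?n (\<lambda>i j. \<sigma> (A i j)) = fdet ?n (\<lambda>i j. \<Sum>m<?n. ?T i m * \<sigma> (A m j))"
    by (rule fdet_mult[symmetric])
  also have "\<dots> = fdet ?n (\<lambda>i j. t i x * ?T i j)"
    by (rule fdet_cong) (rule mult_matrix_diagonalized[OF A x])
  also have "\<dots> = (\<Prod>i<?n. t i x) * fdet ?n ?T" by (rule fdet_scale_rows)
  finally have "fdet ?n (\<lambda>i j. \<sigma> (A i j)) = (\<Prod>i<?n. t i x)" using det_nonzero by simp
  also have "\<dots> = (\<Prod>\<tau>\<in>ext_embs l k \<sigma>. \<tau> x)" by (rule prod.reindex_bij_betw[OF enum])
  finally show ?thesis using emb_fdet(2)[OF subfield_k \<sigma>, of ?n A] A by (simp add: mult_matrix_def)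
qed

lemma emb_trace_mult_matrix:
  assumes A: "mult_matrix k bs x A" and x: "x \<in> l"
  shows "\<sigma> (\<Sum>j<length bs. A j j) = (\<Sum>\<tau>\<in>ext_embs l k \<sigma>. \<tau> x)"
proof -
  let ?n = "length bs"
  have entry: "\<sigma> (A j j) = (\<Sum>i<?n. inverse_matrix j i * (t i x * t i (bs ! j)))" if j: "j < ?n" for j
  proof -
    have "\<sigma> (A j j) = (\<Sum>i<?n. inverse_matrix j i * t i (x * bs ! j))"
      using emb_coordinate[of "\<lambda>m. A m j" j] A j by (simp add: mult_matrix_def)
    thus ?thesis
      using emb_mult[OF subfield_l ext_embsD(1)[OF enum_mem] x field_basis_mem[OF basis j]] by simp
  qed
  have "\<sigma> (\<Sum>j<?n. A j j) = (\<Sum>j<?n. \<sigma> (A j j))"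
    by (rule emb_sum[OF subfield_k \<sigma>]) (use A in \<open>simp add: mult_matrix_def\<close>)
  also have "\<dots> = (\<Sum>j<?n. \<Sum>i<?n. inverse_matrix j i * (t i x * t i (bs ! j)))" using entry by simp
  also have "\<dots> = (\<Sum>i<?n. \<Sum>j<?n. inverse_matrix j i * (t i x * t i (bs ! j)))" by (rule sum.swap)
  also have "\<dots> = (\<Sum>i<?n. t i x * (\<Sum>j<?n. t i (bs ! j) * inverse_matrix j i))"
    by (simp add: sum_distrib_left mult_ac)
  also have "\<dots> = (\<Sum>i<?n. t i x)" using inverse_matrix(1) by simp
  also have "\<dots> = (\<Sum>\<tau>\<in>ext_embs l k \<sigma>. \<tau> x)" by (rule sum.reindex_bij_betw[OF enum])
  finally show ?thesis .
qed

lemma coordinates_bounded: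
  obtains M where "M \<ge> 0" "\<And>c j. \<forall>m<length bs. c m \<in> k \<Longrightarrow> j < length bs \<Longrightarrow>
    cmod (\<sigma> (c j)) \<le> M * (\<Sum>\<tau>\<in>ext_embs l k \<sigma>. cmod (\<tau> (\<Sum>m<length bs. c m * bs ! m)))"
proof -
  let ?n = "length bs"
  define M where "M = (\<Sum>j<?n. \<Sum>i<?n. cmod (inverse_matrix j i))"
  have "cmod (\<sigma> (c j)) \<le> M * (\<Sum>\<tau>\<in>ext_embs l k \<sigma>. cmod (\<tau> (\<Sum>m<?n. c m * bs ! m)))"
    if c: "\<forall>m<?n. c m \<in> k" and j: "j < ?n" for c j
  proof -
    let ?x = "\<Sum>m<?n. c m * bs ! m"
    have "cmod (\<sigma> (c j)) \<le> (\<Sum>i<?n. cmod (inverse_matrix j i) * cmod (t i ?x))"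
      using c j by (subst emb_coordinate) (auto simp: norm_mult intro!: order.trans[OF norm_sum])
    also have "\<dots> \<le> (\<Sum>i<?n. M * cmod (t i ?x))"
    proof (intro sum_mono mult_right_mono)
      fix i assume "i \<in> {..<?n}"
      hence "cmod (inverse_matrix j i) \<le> (\<Sum>i<?n. cmod (inverse_matrix j i))"
        by (rule member_le_sum) auto
      also have "\<dots> \<le> M"
        unfolding M_def by (rule member_le_sum) (use j in \<open>auto intro: sum_nonneg\<close>)
      finally show "cmod (inverse_matrix j i) \<le> M" .
    qed simp
    also have "\<dots> = M * (\<Sum>i<?n. cmod (t i ?x))" by (simp add: sum_distrib_left)
    also have "(\<Sum>i<?n. cmod (t i ?x)) = (\<Sum>\<tau>\<in>ext_embs l k \<sigma>. cmod (\<tau> ?x))"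
      by (rule sum.reindex_bij_betw[OF enum])
    finally show ?thesis .
  qed
  moreover have "M \<ge> 0" unfolding M_def by (intro sum_nonneg) simp
  ultimately show ?thesis by (intro that)
qed

end

context finite_extension
begin

lemma embedding_matrix_exists:
  assumes bs: "ring.independent ambient k bs" "ring.Span ambient k bs = l" and \<sigma>: "\<sigma> \<in> embs k"
  obtains t where "embedding_matrix k l bs \<sigma> t"
proof -
  obtain t where "bij_betw t {..<length bs} (ext_embs l k \<sigma>)"
    using ex_bij_betw_nat_finite[OF finite_ext_embs, of \<sigma>] card_ext_embs[OF bs \<sigma>]
    by (auto simp: atLeast0LessThan)
  hence "embedding_matrix k l bs \<sigma> t"
    using field_basis_if_independent_Span[OF subfield_k bs] \<sigma>
    by (intro embedding_matrix.intro embedding_matrix_axioms.intro finite_extension_axioms)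
  thus ?thesis by (rule that)
qed

lemma field_norm_mult_matrix:
  assumes "x \<in> l"
  obtains bs A where "ring.independent ambient k bs" "ring.Span ambient k bs = l"
    "mult_matrix k bs x A" "field_norm l k x = fdet (length bs) A"
proof -
  let ?P = "\<lambda>d. \<exists>bs A. amb.independent k bs \<and> amb.Span k bs = l \<and>
     A \<in> carrier_mat (length bs) (length bs) \<and>
     (\<forall>i<length bs. \<forall>j<length bs. A $$ (i, j) \<in> k) \<and>
     (\<forall>j<length bs. x * bs ! j = (\<Sum>i<length bs. A $$ (i, j) * bs ! i)) \<and>
     d = Determinant.det A"
  obtain bs where bs: "amb.independent k bs" "amb.Span k bs = l" by (rule basis_exists)
  obtain A where A: "mult_matrix k bs x A"
    using mult_matrix_exists[OF subfield_l field_basis_if_independent_Span[OF subfield_k bs] assms] .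
  let ?A = "mat (length bs) (length bs) (\<lambda>(i, j). A i j)"
  have "?P (Determinant.det ?A)"
    by (intro exI[of _ bs] exI[of _ ?A]) (use bs A in \<open>auto simp: mult_matrix_def\<close>)
  hence "?P (field_norm l k x)" unfolding field_norm_def by (rule someI)
  then obtain bs A where "amb.independent k bs" "amb.Span k bs = l"
    and A: "A \<in> carrier_mat (length bs) (length bs)" "mult_matrix k bs x (\<lambda>i j. A $$ (i, j))"
    and norm: "field_norm l k x = Determinant.det A"
    unfolding mult_matrix_def by blast
  moreover have "mat (length bs) (length bs) (\<lambda>(i, j). A $$ (i, j)) = A"
    by (rule eq_matI) (use A(1) in auto)
  ultimately show ?thesis using that[of bs "\<lambda>i j. A $$ (i, j)"] by (simp add: fdet_def)
qed

lemma emb_field_norm: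
  assumes "x \<in> l" and \<sigma>: "\<sigma> \<in> embs k"
  shows "field_norm l k x \<in> k" and "\<sigma> (field_norm l k x) = (\<Prod>\<tau>\<in>ext_embs l k \<sigma>. \<tau> x)"
proof -
  obtain bs A where bs: "amb.independent k bs" "amb.Span k bs = l"
    and A: "mult_matrix k bs x A" and norm: "field_norm l k x = fdet (length bs) A"
    using field_norm_mult_matrix[OF assms(1)] .
  obtain t where "embedding_matrix k l bs \<sigma> t" using embedding_matrix_exists[OF bs \<sigma>] .
  then interpret embedding_matrix k l bs \<sigma> t .
  show "field_norm l k x \<in> k"
    unfolding norm by (rule emb_fdet(1)[OF subfield_k \<sigma>]) (use A in \<open>simp add: mult_matrix_def\<close>)
  show "\<sigma> (field_norm l k x) = (\<Prod>\<tau>\<in>ext_embs l k \<sigma>. \<tau> x)"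
    unfolding norm by (rule emb_det_mult_matrix[OF A assms(1)])
qed

lemma emb_trace_mem:
  assumes "x \<in> l" and \<sigma>: "\<sigma> \<in> embs k"
  shows "(\<Sum>\<tau>\<in>ext_embs l k \<sigma>. \<tau> x) \<in> \<sigma> ` k"
proof -
  obtain bs where bs: "amb.independent k bs" "amb.Span k bs = l" by (rule basis_exists)
  obtain t where "embedding_matrix k l bs \<sigma> t" using embedding_matrix_exists[OF bs \<sigma>] .
  then interpret embedding_matrix k l bs \<sigma> t .
  obtain A where A: "mult_matrix k bs x A" using mult_matrix_exists[OF subfield_l basis assms(1)] .
  have "(\<Sum>j<length bs. A j j) \<in> k"
    by (rule subfield_sum[OF subfield_k]) (use A in \<open>simp add: mult_matrix_def\<close>)
  thus ?thesis using emb_trace_mult_matrix[OF A assms(1)] by (metis image_eqI)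
qed

lemma card_ext_embs_const:
  obtains d where "d > 0" "\<And>\<sigma>. \<sigma> \<in> embs k \<Longrightarrow> card (ext_embs l k \<sigma>) = d"
proof -
  obtain bs where bs: "amb.independent k bs" "amb.Span k bs = l" by (rule basis_exists)
  have "length bs > 0" by (rule dimension_pos[OF amb.dimensionI[OF subfield_k bs]])
  thus ?thesis using card_ext_embs[OF bs] by (rule that)
qed

lemma ext_embs_nonempty: "\<sigma> \<in> embs k \<Longrightarrow> ext_embs l k \<sigma> \<noteq> {}"
  using card_ext_embs_const by (metis card.empty less_irrefl)

end


section \<open>Number fields\<close>

lemma number_field_subfield: "number_field L \<Longrightarrow> subfield L ambient"
  by (simp add: number_field_def)

lemma number_field_extension_Rats: "number_field L \<Longrightarrow> finite_extension \<rat> L"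
  by (intro finite_extension.intro subfield_Rats Rats_subset_subfield number_field_subfield)
    (simp_all add: number_field_def)

lemma number_field_finite_extension:
  assumes "subfield k ambient" "number_field l" "k \<subseteq> l"
  shows "finite_extension k l"
  by (rule finite_extension.finite_extension_over_intermediate[OF number_field_extension_Rats])
    (use assms Rats_subset_subfield in auto)

definition rat_emb :: "'a::field_char_0 \<Rightarrow> complex" where
  "rat_emb = restrict (\<lambda>x. of_rat (inv_into UNIV of_rat x)) \<rat>"

lemma rat_emb_of_rat: "rat_emb (of_rat q :: 'a::field_char_0) = of_rat q"
proof -
  have "inj (of_rat :: rat \<Rightarrow> 'a)" by (simp add: inj_def)
  thus ?thesis by (simp add: rat_emb_def)
qed

lemma rat_emb_in_embs: "(rat_emb :: 'a::field_char_0 \<Rightarrow> complex) \<in> embs \<rat>"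
proof -
  have "rat_emb (1::'a) = 1" using rat_emb_of_rat[of 1, where 'a = 'a] by simp
  moreover have "rat_emb (x + y) = rat_emb x + rat_emb y \<and> rat_emb (x * y) = rat_emb x * rat_emb y"
    if "x \<in> \<rat>" "y \<in> \<rat>" for x y :: 'a
  proof -
    obtain p q where "x = of_rat p" "y = of_rat q" using \<open>x \<in> \<rat>\<close> \<open>y \<in> \<rat>\<close> by (auto elim!: Rats_cases)
    thus ?thesis by (simp add: rat_emb_of_rat of_rat_add of_rat_mult flip: of_rat_add of_rat_mult)
  qed
  ultimately show ?thesis by (auto simp: embs_def rat_emb_def)
qed

lemma embs_eq_ext_embs_Rats:
  fixes L :: "'a::field_char_0 set"
  assumes L: "subfield L ambient"
  shows "embs L = ext_embs L \<rat> rat_emb"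
  unfolding ext_embs_def by (auto simp: emb_of_rat[OF L] rat_emb_of_rat elim!: Rats_cases)

lemma finite_embs: "number_field L \<Longrightarrow> finite (embs L)"
  by (simp add: embs_eq_ext_embs_Rats number_field_subfield
      finite_extension.finite_ext_embs[OF number_field_extension_Rats])

lemma embs_nonempty: "number_field L \<Longrightarrow> embs L \<noteq> {}"
  by (simp add: embs_eq_ext_embs_Rats number_field_subfield rat_emb_in_embs
      finite_extension.ext_embs_nonempty[OF number_field_extension_Rats])


section \<open>Absolute values\<close>

context
  fixes L :: "'a::field_char_0 set" and w :: "'a \<Rightarrow> real"
  assumes L: "subfield L ambient" and w: "absolute_value L w"
begin

lemma absval_nonneg: "x \<in> L \<Longrightarrow> w x \<ge> 0"
  and absval_eq_0: "x \<in> L \<Longrightarrow> w x = 0 \<longleftrightarrow> x = 0"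
  and absval_mult: "x \<in> L \<Longrightarrow> y \<in> L \<Longrightarrow> w (x * y) = w x * w y"
  and absval_add: "x \<in> L \<Longrightarrow> y \<in> L \<Longrightarrow> w (x + y) \<le> w x + w y"
  using w by (auto simp: absolute_value_def)

lemma absval_one: "w 1 = 1"
  using absval_mult[of 1 1] absval_eq_0[of 1] subfield_one[OF L] by simp

lemma absval_power: "x \<in> L \<Longrightarrow> w (x ^ n) = w x ^ n"
  by (induction n) (simp_all add: absval_one absval_mult subfield_power[OF L])

lemma absval_minus_one: "w (- 1) = 1"
proof -
  have minus_one_mem: "- 1 \<in> L" by (rule subfield_uminus[OF L subfield_one[OF L]])
  have "w (- 1) ^ 2 = 1" using absval_power[OF minus_one_mem, of 2] absval_one by simp
  thus ?thesis using absval_nonneg[OF minus_one_mem] power2_eq_1_iff by fastforce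
qed

lemma absval_uminus: "x \<in> L \<Longrightarrow> w (- x) = w x"
  using absval_mult[of "- 1" x] subfield_uminus[OF L subfield_one[OF L]] absval_minus_one by simp

lemma absval_diff_ge: "x \<in> L \<Longrightarrow> y \<in> L \<Longrightarrow> w (x + y) \<ge> w x - w y"
  using absval_add[of "x + y" "- y"] absval_uminus[of y] subfield_add[OF L] subfield_uminus[OF L]
  by simp

lemma absval_inverse:
  assumes "x \<in> L" shows "w (inverse x) = inverse (w x)"
proof (cases "x = 0")
  case False
  hence "w x * w (inverse x) = 1"
    using absval_mult[OF assms subfield_inverse[OF L assms]] absval_one by simp
  thus ?thesis by (simp add: inverse_unique)
qed (use absval_eq_0[of 0] subfield_zero[OF L] in simp)

lemma absval_divide: "x \<in> L \<Longrightarrow> y \<in> L \<Longrightarrow> w (x / y) = w x / w y"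
  by (simp add: divide_inverse absval_mult absval_inverse subfield_inverse[OF L])

lemma absval_sum: "(\<And>i. i \<in> I \<Longrightarrow> f i \<in> L) \<Longrightarrow> w (\<Sum>i\<in>I. f i) \<le> (\<Sum>i\<in>I. w (f i))"
proof (induction I rule: infinite_finite_induct)
  case (insert i I)
  thus ?case using absval_add[of "f i" "\<Sum>i\<in>I. f i"] subfield_sum[OF L, of I f] by force
qed (use absval_eq_0[of 0] subfield_zero[OF L] in auto)

lemma absval_one_plus_power_tendsto:
  assumes "x \<in> L" "w x < 1"
  shows "(\<lambda>m. w (1 + x ^ m)) \<longlonglongrightarrow> 1"
proof (rule tendsto_sandwich)
  have power: "(\<lambda>m. w x ^ m) \<longlonglongrightarrow> 0"
    using assms absval_nonneg by (intro LIMSEQ_realpow_zero) auto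
  show "(\<lambda>m. 1 - w x ^ m) \<longlonglongrightarrow> 1" using tendsto_diff[OF tendsto_const power] by simp
  show "(\<lambda>m. 1 + w x ^ m) \<longlonglongrightarrow> 1" using tendsto_add[OF tendsto_const power] by simp
  have "1 - w x ^ m \<le> w (1 + x ^ m)" "w (1 + x ^ m) \<le> 1 + w x ^ m" for m
    using absval_diff_ge[OF subfield_one[OF L] subfield_power[OF L assms(1)], of m]
      absval_add[OF subfield_one[OF L] subfield_power[OF L assms(1)], of m] absval_one
      absval_power[OF assms(1)]
    by simp_all
  thus "\<forall>\<^sub>F m in sequentially. 1 - w x ^ m \<le> w (1 + x ^ m)"
    and "\<forall>\<^sub>F m in sequentially. w (1 + x ^ m) \<le> 1 + w x ^ m" by simp_all
qed

lemma absval_quotient_tendsto_0: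
  assumes "x \<in> L" "y \<in> L" "w x < 1"
  shows "(\<lambda>m. w (x ^ m * y / (1 + x ^ m))) \<longlonglongrightarrow> 0"
proof -
  have "(\<lambda>m. w x ^ m) \<longlonglongrightarrow> 0"
    using assms absval_nonneg by (intro LIMSEQ_realpow_zero) auto
  hence "(\<lambda>m. w x ^ m * w y / w (1 + x ^ m)) \<longlonglongrightarrow> 0 * w y / 1"
    by (intro tendsto_divide tendsto_mult tendsto_const
      absval_one_plus_power_tendsto[OF assms(1,3)]) simp_all
  thus ?thesis
    using assms
    by (simp add: absval_divide absval_mult absval_power subfield_add[OF L] subfield_mult[OF L]
        subfield_one[OF L] subfield_power[OF L])
qed

lemma absval_quotient_tendsto:
  assumes "x \<in> L" "y \<in> L" "1 < w x"
  shows "(\<lambda>m. w (x ^ m * y / (1 + x ^ m))) \<longlonglongrightarrow> w y"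
proof -
  have "x \<noteq> 0" using assms absval_eq_0[of x] by auto
  hence "x ^ m * y / (1 + x ^ m) = y / (1 + inverse x ^ m)" for m
    using mult_divide_mult_cancel_left[of "x ^ m" y "1 + inverse x ^ m"]
    by (simp add: distrib_left power_inverse add.commute)
  moreover have "w (inverse x) < 1" using assms by (simp add: absval_inverse inverse_less_1_iff)
  hence "(\<lambda>m. w y / w (1 + inverse x ^ m)) \<longlonglongrightarrow> w y / 1"
    using assms
    by (intro tendsto_divide tendsto_const absval_one_plus_power_tendsto subfield_inverse[OF L])
      auto
  ultimately show ?thesis
    using assms
    by (simp add: absval_divide subfield_add[OF L] subfield_one[OF L] subfield_power[OF L]
      subfield_inverse[OF L])
qed

end

definition separates :: "'a::field_char_0 set \<Rightarrow> ('a \<Rightarrow> real) \<Rightarrow> ('a \<Rightarrow> real) set \<Rightarrow> 'a \<Rightarrow> bool" where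
  "separates L w S x \<longleftrightarrow> x \<in> L \<and> 1 < w x \<and> (\<forall>u\<in>S. u x < 1)"

text \<open>
  Weak approximation. According to the size of \<open>x\<close> at the new place \<open>v\<close>, the element \<open>x\<^sup>m y\<close> or
  \<open>x\<^sup>m y / (1 + x\<^sup>m)\<close> works for large \<open>m\<close>.
\<close>

context
  fixes L :: "'a::field_char_0 set" and v w :: "'a \<Rightarrow> real" and S :: "('a \<Rightarrow> real) set" and x y :: 'a
  assumes L: "subfield L ambient" and "finite S"
    and absval: "absolute_value L v" "absolute_value L w" "\<And>u. u \<in> S \<Longrightarrow> absolute_value L u"
    and x: "separates L w S x" and y: "separates L w {v} y"
begin

private lemma x_mem: "x \<in> L" and y_mem: "y \<in> L"
  using x y by (simp_all add: separates_def)

private lemma absval_power_mult: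
  assumes "absolute_value L u" shows "u (x ^ m * y) = u x ^ m * u y"
  by (simp add: absval_mult[OF L assms subfield_power[OF L x_mem] y_mem] absval_power[OF L assms x_mem])

lemma separates_insert_if_le_1:
  assumes "v x \<le> 1"
  obtains z where "separates L w (insert v S) z"
proof -
  have "\<forall>\<^sub>F m in sequentially. \<forall>u\<in>S. u (x ^ m * y) < 1"
  proof (rule eventually_ball_finite[OF \<open>finite S\<close>], rule ballI)
    fix u assume u: "u \<in> S"
    have "(\<lambda>m. u x ^ m * u y) \<longlonglongrightarrow> 0 * u y"
      using x u absval_nonneg[OF L absval(3)[OF u] x_mem]
      by (intro tendsto_intros LIMSEQ_realpow_zero) (auto simp: separates_def)
    hence "\<forall>\<^sub>F m in sequentially. u x ^ m * u y < 1" by (rule order_tendstoD) simp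
    thus "\<forall>\<^sub>F m in sequentially. u (x ^ m * y) < 1" by (simp add: absval_power_mult[OF absval(3)[OF u]])
  qed
  then obtain m where m: "\<forall>u\<in>S. u (x ^ m * y) < 1" unfolding eventually_sequentially by blast
  have "v x ^ m * v y \<le> 1 * v y"
    using assms absval_nonneg[OF L absval(1)] x_mem y_mem by (intro mult_right_mono power_le_one)
  hence "v (x ^ m * y) < 1" using y by (simp add: absval_power_mult[OF absval(1)] separates_def)
  moreover have "1 * w y \<le> w x ^ m * w y"
    using x y by (intro mult_right_mono one_le_power) (auto simp: separates_def)
  hence "1 < w x ^ m * w y" using y unfolding separates_def by linarith
  hence "1 < w (x ^ m * y)" by (simp add: absval_power_mult[OF absval(2)])
  ultimately have "separates L w (insert v S) (x ^ m * y)"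
    using m by (simp add: separates_def subfield_mult[OF L subfield_power[OF L x_mem] y_mem])
  thus ?thesis by (rule that)
qed

lemma separates_insert_if_gt_1:
  assumes "v x > 1"
  obtains z where "separates L w (insert v S) z"
proof -
  define z where "z = (\<lambda>m. x ^ m * y / (1 + x ^ m))"
  have "\<forall>\<^sub>F m in sequentially. \<forall>u\<in>S. u (z m) < 1"
  proof (rule eventually_ball_finite[OF \<open>finite S\<close>], rule ballI)
    fix u assume u: "u \<in> S"
    hence "u x < 1" using x by (simp add: separates_def)
    thus "\<forall>\<^sub>F m in sequentially. u (z m) < 1"
      unfolding z_def
      using order_tendstoD(2)[OF absval_quotient_tendsto_0[OF L absval(3)[OF u] x_mem y_mem]] by simp
  qed
  moreover have "\<forall>\<^sub>F m in sequentially. v (z m) < 1"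
    unfolding z_def
    by (rule order_tendstoD(2)[OF absval_quotient_tendsto[OF L absval(1) x_mem y_mem assms]])
      (use y in \<open>simp add: separates_def\<close>)
  moreover have "\<forall>\<^sub>F m in sequentially. 1 < w (z m)"
    unfolding z_def
    by (rule order_tendstoD(1)[OF absval_quotient_tendsto[OF L absval(2) x_mem y_mem]])
      (use x y in \<open>simp_all add: separates_def\<close>)
  ultimately have "\<forall>\<^sub>F m in sequentially. (\<forall>u\<in>S. u (z m) < 1) \<and> v (z m) < 1 \<and> 1 < w (z m)"
    by (intro eventually_conj)
  then obtain m where "\<forall>u\<in>S. u (z m) < 1" "v (z m) < 1" "1 < w (z m)"
    unfolding eventually_sequentially by blast
  moreover have "z m \<in> L"
    unfolding z_def
    by (intro subfield_divide[OF L] subfield_mult[OF L] subfield_add[OF L] subfield_one[OF L]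
        subfield_power[OF L] x_mem y_mem)
  ultimately have "separates L w (insert v S) (z m)" by (simp add: separates_def)
  thus ?thesis by (rule that)
qed

end


section \<open>Archimedean places\<close>

lemma arch_place_absval: "w \<in> arch_places L \<Longrightarrow> absolute_value L w"
  and arch_place_of_rat: "w \<in> arch_places L \<Longrightarrow> w (of_rat q) = \<bar>of_rat q\<bar>"
  by (simp_all add: arch_places_def)

lemma absolute_value_eqI:
  assumes "absolute_value L v" "absolute_value L w" "\<And>x. x \<in> L \<Longrightarrow> v x = w x"
  shows "v = w"
  using assms by (auto simp: absolute_value_def intro: extensionalityI)

lemma distinct_arch_places_compare:
  assumes L: "subfield L ambient" and v: "v \<in> arch_places L" and w: "w \<in> arch_places L" and "v \<noteq> w"
  obtains x where "x \<in> L" "v x < w x"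
proof -
  note v_absval = arch_place_absval[OF v] and w_absval = arch_place_absval[OF w]
  obtain x where x: "x \<in> L" "v x \<noteq> w x" using absolute_value_eqI[OF v_absval w_absval] \<open>v \<noteq> w\<close> by blast
  show ?thesis
  proof (cases "v x < w x")
    case True
    thus ?thesis using that x(1) by blast
  next
    case False
    hence "w x < v x" using x(2) by simp
    moreover have "x \<noteq> 0"
      using x absval_eq_0[OF L v_absval x(1)] absval_eq_0[OF L w_absval x(1)] by auto
    hence "w x > 0" using absval_nonneg[OF L w_absval x(1)] absval_eq_0[OF L w_absval x(1)] by simp
    ultimately have "v (inverse x) < w (inverse x)"
      by (simp add: absval_inverse[OF L v_absval x(1)] absval_inverse[OF L w_absval x(1)])
    thus ?thesis using that subfield_inverse[OF L x(1)] by blast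
  qed
qed

lemma separate_two_arch_places:
  assumes L: "subfield L ambient" and v: "v \<in> arch_places L" and w: "w \<in> arch_places L" and "v \<noteq> w"
  obtains x where "x \<in> L" "v x < 1" "1 < w x"
proof -
  note v_absval = arch_place_absval[OF v] and w_absval = arch_place_absval[OF w]
  obtain x where x: "x \<in> L" "v x < w x" using distinct_arch_places_compare[OF assms] .
  obtain q where q: "v x < of_rat q" "of_rat q < w x" using of_rat_dense[OF x(2)] by blast
  have q_pos: "(of_rat q :: real) > 0" using q(1) absval_nonneg[OF L v_absval x(1)] by linarith
  show ?thesis
  proof (rule that[of "x / of_rat q"])
    show "x / of_rat q \<in> L" by (rule subfield_divide[OF L x(1) subfield_of_rat[OF L]])
    show "v (x / of_rat q) < 1" using q(1) q_pos
      by (simp add: absval_divide[OF L v_absval x(1) subfield_of_rat[OF L]] arch_place_of_rat[OF v])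
    show "1 < w (x / of_rat q)" using q(2) q_pos
      by (simp add: absval_divide[OF L w_absval x(1) subfield_of_rat[OF L]] arch_place_of_rat[OF w])
  qed
qed

lemma separate_arch_place:
  assumes L: "subfield L ambient" and w: "w \<in> arch_places L"
    and "finite S" "S \<subseteq> arch_places L" "w \<notin> S"
  shows "\<exists>x. separates L w S x"
  using assms(3-)
proof (induction S rule: finite_induct)
  case empty
  have "w (of_rat 2) = 2" using arch_place_of_rat[OF w, of 2] by simp
  hence "separates L w {} (of_rat 2)" using subfield_of_rat[OF L, of 2] by (simp add: separates_def)
  thus ?case ..
next
  case (insert v S)
  have v: "v \<in> arch_places L" "v \<noteq> w" using insert.prems by auto
  obtain x where x: "separates L w S x" using insert by auto
  obtain y where y: "separates L w {v} y"
    using separate_two_arch_places[OF L v(1) w v(2)] by (auto simp: separates_def)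
  have absval: "absolute_value L v" "absolute_value L w" "\<And>u. u \<in> S \<Longrightarrow> absolute_value L u"
    using v(1) w insert.prems arch_place_absval by blast+
  show ?case
  proof (cases "v x \<le> 1")
    case True
    obtain z where "separates L w (insert v S) z"
      by (rule separates_insert_if_le_1[OF L insert.hyps(1) absval x y True])
    thus ?thesis ..
  next
    case False
    hence "v x > 1" by simp
    obtain z where "separates L w (insert v S) z"
      by (rule separates_insert_if_gt_1[OF L insert.hyps(1) absval x y \<open>v x > 1\<close>])
    thus ?thesis ..
  qed
qed

definition emb_abs :: "'a set \<Rightarrow> ('a \<Rightarrow> complex) \<Rightarrow> 'a \<Rightarrow> real" where
  "emb_abs L \<sigma> = restrict (\<lambda>x. cmod (\<sigma> x)) L"

lemma emb_abs_apply [simp]: "x \<in> L \<Longrightarrow> emb_abs L \<sigma> x = cmod (\<sigma> x)"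
  by (simp add: emb_abs_def)

lemma cmod_of_rat: "cmod (of_rat q) = \<bar>of_rat q\<bar>"
  by (cases q) (simp add: of_rat_rat norm_divide)

lemma emb_abs_arch_place:
  assumes L: "subfield L ambient" and \<sigma>: "\<sigma> \<in> embs L"
  shows "emb_abs L \<sigma> \<in> arch_places L"
proof -
  have "absolute_value L (emb_abs L \<sigma>)"
    unfolding absolute_value_def
    using emb_eq_0_iff[OF L \<sigma>] emb_add[OF L \<sigma>] emb_mult[OF L \<sigma>] subfield_add[OF L] subfield_mult[OF L]
    by (auto simp: norm_mult norm_triangle_ineq emb_abs_def)
  moreover have "emb_abs L \<sigma> (of_rat q) = \<bar>of_rat q\<bar>" for q
    by (simp add: subfield_of_rat[OF L] emb_of_rat[OF L \<sigma>] cmod_of_rat)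
  ultimately show ?thesis by (simp add: arch_places_def)
qed

lemma arch_place_bounded:
  assumes L: "number_field L" and w: "w \<in> arch_places L"
  obtains C where "\<And>x. x \<in> L \<Longrightarrow> w x \<le> C * (\<Sum>\<sigma>\<in>embs L. cmod (\<sigma> x))"
proof -
  interpret finite_extension \<rat> L by (rule number_field_extension_Rats[OF L])
  note w_absval = arch_place_absval[OF w]
  obtain bs where bs: "amb.independent \<rat> bs" "amb.Span \<rat> bs = L" by (rule basis_exists)
  obtain t where "embedding_matrix \<rat> L bs rat_emb t"
    using embedding_matrix_exists[OF bs rat_emb_in_embs] .
  then interpret embedding_matrix \<rat> L bs rat_emb t .
  obtain M where M: "M \<ge> 0" "\<And>c j. \<forall>m<length bs. c m \<in> \<rat> \<Longrightarrow> j < length bs \<Longrightarrow>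
    cmod (rat_emb (c j)) \<le> M * (\<Sum>\<sigma>\<in>ext_embs L \<rat> rat_emb. cmod (\<sigma> (\<Sum>m<length bs. c m * bs ! m)))"
    using coordinates_bounded by blast
  have "w x \<le> (M * (\<Sum>j<length bs. w (bs ! j))) * (\<Sum>\<sigma>\<in>embs L. cmod (\<sigma> x))" if x: "x \<in> L" for x
  proof -
    obtain c where c: "\<And>i. i < length bs \<Longrightarrow> c i \<in> \<rat>" "x = (\<Sum>i<length bs. c i * bs ! i)"
      using field_basis_spans[OF basis x] by blast
    have mem: "c j \<in> L" "bs ! j \<in> L" if "j < length bs" for j
      using c(1)[OF that] k_subset_l field_basis_mem[OF basis that] by auto
    have coefficient: "w (c j) \<le> M * (\<Sum>\<sigma>\<in>embs L. cmod (\<sigma> x))" if j: "j < length bs" for j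
    proof -
      obtain q where q: "c j = of_rat q" using c(1)[OF j] by (auto elim!: Rats_cases)
      have "w (c j) = cmod (rat_emb (c j))"
        unfolding q by (simp add: arch_place_of_rat[OF w] rat_emb_of_rat cmod_of_rat)
      also have "\<dots> \<le> M * (\<Sum>\<sigma>\<in>embs L. cmod (\<sigma> x))"
        unfolding embs_eq_ext_embs_Rats[OF subfield_l] c(2) using c(1) j by (intro M(2)) auto
      finally show ?thesis .
    qed
    have "w x \<le> (\<Sum>j<length bs. w (c j * bs ! j))"
      unfolding c(2)
      by (rule absval_sum[OF subfield_l w_absval]) (use mem subfield_mult[OF subfield_l] in auto)
    also have "\<dots> = (\<Sum>j<length bs. w (c j) * w (bs ! j))"
      using mem by (simp add: absval_mult[OF subfield_l w_absval])
    also have "\<dots> \<le> (\<Sum>j<length bs. (M * (\<Sum>\<sigma>\<in>embs L. cmod (\<sigma> x))) * w (bs ! j))"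
      using coefficient mem absval_nonneg[OF subfield_l w_absval]
      by (intro sum_mono mult_right_mono) auto
    also have "\<dots> = (M * (\<Sum>j<length bs. w (bs ! j))) * (\<Sum>\<sigma>\<in>embs L. cmod (\<sigma> x))"
      by (simp add: sum_distrib_left mult_ac)
    finally show ?thesis .
  qed
  thus ?thesis by (rule that)
qed

theorem arch_places_eq:
  assumes L: "number_field L"
  shows "arch_places L = emb_abs L ` embs L"
proof (intro equalityI subsetI)
  note subfield_L = number_field_subfield[OF L]
  show "w \<in> arch_places L" if "w \<in> emb_abs L ` embs L" for w
    using that emb_abs_arch_place[OF subfield_L] by auto
  fix w assume w: "w \<in> arch_places L"
  note w_absval = arch_place_absval[OF w]
  show "w \<in> emb_abs L ` embs L"
  proof (rule ccontr)
    assume "w \<notin> emb_abs L ` embs L"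
    hence "\<exists>x. separates L w (emb_abs L ` embs L) x"
      by (intro separate_arch_place[OF subfield_L w] finite_imageI finite_embs[OF L])
        (use emb_abs_arch_place[OF subfield_L] in auto)
    then obtain x where x: "x \<in> L" "1 < w x" "\<And>\<sigma>. \<sigma> \<in> embs L \<Longrightarrow> cmod (\<sigma> x) < 1"
      by (auto simp: separates_def)
    obtain C where C: "\<And>x. x \<in> L \<Longrightarrow> w x \<le> C * (\<Sum>\<sigma>\<in>embs L. cmod (\<sigma> x))"
      using arch_place_bounded[OF L w] by blast
    have bound: "w x ^ m \<le> \<bar>C\<bar> * card (embs L)" for m
    proof -
      have power_le_1: "cmod (\<sigma> (x ^ m)) \<le> 1" if "\<sigma> \<in> embs L" for \<sigma>
        using x(3)[OF that] by (simp add: emb_power[OF subfield_L that x(1)] norm_power power_le_one)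
      have "w x ^ m = w (x ^ m)" by (simp add: absval_power[OF subfield_L w_absval x(1)])
      also have "\<dots> \<le> C * (\<Sum>\<sigma>\<in>embs L. cmod (\<sigma> (x ^ m)))"
        by (rule C[OF subfield_power[OF subfield_L x(1)]])
      also have "\<dots> \<le> \<bar>C\<bar> * (\<Sum>\<sigma>\<in>embs L. 1)"
        by (intro mult_mono sum_mono power_le_1 sum_nonneg) auto
      finally show ?thesis by simp
    qed
    obtain m where "\<bar>C\<bar> * card (embs L) < w x ^ m" using real_arch_pow[OF x(2)] by blast
    thus False using bound[of m] by linarith
  qed
qed

lemma finite_arch_places: "number_field L \<Longrightarrow> finite (arch_places L)"
  by (simp add: arch_places_eq finite_embs)

lemma arch_places_nonempty: "number_field L \<Longrightarrow> arch_places L \<noteq> {}"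
  by (simp add: arch_places_eq embs_nonempty)

definition emb_cnj :: "'a set \<Rightarrow> ('a \<Rightarrow> complex) \<Rightarrow> 'a \<Rightarrow> complex" where
  "emb_cnj L \<sigma> = restrict (\<lambda>x. cnj (\<sigma> x)) L"

lemma emb_cnj_in_embs:
  fixes L :: "'a::field_char_0 set"
  assumes L: "subfield L ambient" and \<sigma>: "\<sigma> \<in> embs L"
  shows "emb_cnj L \<sigma> \<in> embs L"
  using \<sigma> subfield_add[OF L] subfield_mult[OF L] subfield_one[OF L] by (auto simp: embs_def emb_cnj_def)

lemma emb_abs_cnj: "emb_abs L (emb_cnj L \<sigma>) = emb_abs L \<sigma>"
  by (auto simp: emb_abs_def emb_cnj_def)

lemma complex_eq_or_cnj:
  assumes "cmod z = cmod w" and "cmod (z + 1) = cmod (w + 1)"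
  shows "z = w \<or> z = cnj w"
proof -
  have shift: "(cmod (z + 1))\<^sup>2 = (cmod z)\<^sup>2 + 2 * Re z + 1" for z
    unfolding cmod_power2 by (simp add: power2_eq_square algebra_simps)
  have "Re z = Re w" using shift[of z] shift[of w] assms by simp
  moreover from this have "(Im z)\<^sup>2 = (Im w)\<^sup>2"
    using assms(1) cmod_power2[of z] cmod_power2[of w] by simp
  ultimately show ?thesis by (auto simp: power2_eq_iff complex_eq_iff)
qed

lemma emb_abs_eq_cases:
  fixes L :: "'a::field_char_0 set"
  assumes L: "subfield L ambient" and \<sigma>: "\<sigma> \<in> embs L" and \<tau>: "\<tau> \<in> embs L"
    and eq: "emb_abs L \<tau> = emb_abs L \<sigma>"
  shows "\<tau> = \<sigma> \<or> \<tau> = emb_cnj L \<sigma>"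
proof -
  have norm_eq: "cmod (\<tau> x) = cmod (\<sigma> x)" if "x \<in> L" for x
    using fun_cong[OF eq, of x] that by simp
  have pointwise: "\<tau> x = \<sigma> x \<or> \<tau> x = cnj (\<sigma> x)" if x: "x \<in> L" for x
  proof -
    have "cmod (\<tau> x + 1) = cmod (\<sigma> x + 1)"
      using norm_eq[OF subfield_add[OF L x subfield_one[OF L]]]
      by (simp add: emb_add[OF L \<sigma> x subfield_one[OF L]] emb_add[OF L \<tau> x subfield_one[OF L]]
          emb_one[OF L \<sigma>] emb_one[OF L \<tau>])
    thus ?thesis by (rule complex_eq_or_cnj[OF norm_eq[OF x]])
  qed
  show ?thesis
  proof (rule ccontr)
    assume neg: "\<not> (\<tau> = \<sigma> \<or> \<tau> = emb_cnj L \<sigma>)"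
    obtain x where x: "x \<in> L" "\<tau> x \<noteq> \<sigma> x" using neg embs_eqI[OF \<tau> \<sigma>] by blast
    obtain y where y: "y \<in> L" "\<tau> y \<noteq> cnj (\<sigma> y)"
      using neg embs_eqI[OF \<tau> emb_cnj_in_embs[OF L \<sigma>]] by (auto simp: emb_cnj_def)
    have \<tau>_x: "\<tau> x = cnj (\<sigma> x)" using pointwise[OF x(1)] x(2) by blast
    have \<tau>_y: "\<tau> y = \<sigma> y" using pointwise[OF y(1)] y(2) by blast
    have "\<tau> (x + y) = \<sigma> (x + y) \<or> \<tau> (x + y) = cnj (\<sigma> (x + y))"
      by (rule pointwise[OF subfield_add[OF L x(1) y(1)]])
    thus False using x y \<tau>_x \<tau>_y by (simp add: emb_add[OF L \<sigma> x(1) y(1)] emb_add[OF L \<tau> x(1) y(1)])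
  qed
qed

definition place_embs :: "'a::field_char_0 set \<Rightarrow> ('a \<Rightarrow> real) \<Rightarrow> ('a \<Rightarrow> complex) set" where
  "place_embs L w = {\<sigma> \<in> embs L. emb_abs L \<sigma> = w}"

lemma place_embs_emb_abs:
  fixes L :: "'a::field_char_0 set"
  assumes L: "subfield L ambient" and \<sigma>: "\<sigma> \<in> embs L"
  shows "place_embs L (emb_abs L \<sigma>) = {\<sigma>, emb_cnj L \<sigma>}"
  using emb_abs_eq_cases[OF L \<sigma>] \<sigma> emb_cnj_in_embs[OF L \<sigma>] emb_abs_cnj[of L \<sigma>]
  by (auto simp: place_embs_def)


section \<open>Local degrees\<close>

lemma rational_sequence_tendsto:
  fixes r :: real
  obtains q :: "nat \<Rightarrow> rat" where "(\<lambda>n. of_rat (q n)) \<longlonglongrightarrow> r"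
proof -
  have "\<forall>n. \<exists>q. r < of_rat q \<and> of_rat q < r + inverse (real (Suc n))"
  proof
    fix n
    have "r < r + inverse (real (Suc n))" by simp
    thus "\<exists>q. r < of_rat q \<and> of_rat q < r + inverse (real (Suc n))" using of_rat_dense by blast
  qed
  then obtain q where q: "\<And>n. r < of_rat (q n) \<and> of_rat (q n) < r + inverse (real (Suc n))" by metis
  have "(\<lambda>n. r + inverse (real (Suc n))) \<longlonglongrightarrow> r + 0"
    by (intro tendsto_intros LIMSEQ_inverse_real_of_nat)
  hence "(\<lambda>n. of_rat (q n)) \<longlonglongrightarrow> r"
    by (intro tendsto_sandwich[of "\<lambda>_. r" "\<lambda>n. of_rat (q n)" sequentially
      "\<lambda>n. r + inverse (real (Suc n))" r])
      (use q in \<open>auto intro!: always_eventually less_imp_le\<close>)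
  thus ?thesis by (rule that)
qed

lemma complex_of_rat: "complex_of_real (of_rat q) = of_rat q"
  by (cases q) (simp add: of_rat_rat)

lemma Reals_LIMSEQ:
  fixes f :: "nat \<Rightarrow> complex"
  assumes "\<And>n. f n \<in> \<real>" "f \<longlonglongrightarrow> z" shows "z \<in> \<real>"
proof -
  have "(\<lambda>n. Im (f n)) \<longlonglongrightarrow> Im z" by (rule tendsto_Im[OF assms(2)])
  moreover have "Im (f n) = 0" for n using assms(1)[of n] by (simp add: complex_is_Real_iff)
  ultimately have "Im z = 0" by (simp add: LIMSEQ_const_iff)
  thus ?thesis by (simp add: complex_is_Real_iff)
qed

lemma subfield_Reals: "subfield (\<real> :: complex set) ambient"
  by (rule subfield_ambientI) auto

lemma complex_dimension_Reals: "ring.dimension (ambient :: complex ring) 2 \<real> UNIV"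
proof -
  have "amb.dimension 1 \<real> (\<real> :: complex set)" by (rule amb.dimension_one[OF subfield_Reals])
  moreover have "\<i> \<notin> \<real>" by (simp add: complex_is_Real_iff)
  ultimately have "amb.dimension (Suc 1) \<real> (amb.line_extension \<real> \<i> \<real>)" by (intro amb.Suc_dim) auto
  moreover have "amb.line_extension \<real> \<i> \<real> = UNIV"
  proof -
    have "z \<in> amb.line_extension \<real> \<i> \<real>" for z
      unfolding amb.line_extension_mem_iff
      by (intro bexI[of _ "of_real (Im z)"] bexI[of _ "of_real (Re z)"]) (auto simp: complex_eq_iff)
    thus ?thesis by blast
  qed
  ultimately show ?thesis by (simp add: numeral_2_eq_2)
qed

lemma ring_iso_dimension:
  assumes A: "ring A" and B: "ring B" and iso: "f \<in> ring_iso A B" and K: "subfield K A"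
    and dim: "ring.dimension A n K (carrier A)"
  shows "subfield (f ` K) B" and "ring.dimension B n (f ` K) (carrier B)"
proof -
  interpret f: ring_hom_ring A B f
    by (rule ring_hom_ringI2[OF A B]) (use iso in \<open>simp add: ring_iso_def\<close>)
  have bij: "bij_betw f (carrier A) (carrier B)" using iso by (simp add: ring_iso_def)
  have "\<one>\<^bsub>A\<^esub> \<noteq> \<zero>\<^bsub>A\<^esub>"
    by (rule subdomain.sub_one_not_zero[OF subfield.axioms(1)[OF K]])
  hence one_neq_zero: "\<one>\<^bsub>B\<^esub> \<noteq> \<zero>\<^bsub>B\<^esub>"
    using bij_betw_imp_inj_on[OF bij] f.R.one_closed f.R.zero_closed
    by (metis f.hom_one f.hom_zero inj_onD)
  show "subfield (f ` K) B" by (rule f.img_is_subfield(2)[OF K one_neq_zero])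
  show "ring.dimension B n (f ` K) (carrier B)"
    using f.inj_hom_dimension[OF K one_neq_zero _ dim] bij by (simp add: bij_betw_def)
qed

locale emb_completion =
  fixes L :: "'a::field_char_0 set" and \<sigma> :: "'a \<Rightarrow> complex"
  assumes L: "subfield L ambient" and \<sigma>: "\<sigma> \<in> embs L"
begin

abbreviation w :: "'a \<Rightarrow> real" where "w \<equiv> emb_abs L \<sigma>"

abbreviation R :: "(nat \<Rightarrow> 'a) ring" where "R \<equiv> cauchy_ring L w"

abbreviation S :: "complex ring" where "S \<equiv> ambient"

definition limit_emb :: "(nat \<Rightarrow> 'a) \<Rightarrow> complex" where
  "limit_emb s = lim (\<lambda>n. \<sigma> (s n))"

lemma cauchy_ring_iff: "s \<in> carrier R \<longleftrightarrow> (\<forall>n. s n \<in> L) \<and> Cauchy (\<lambda>n. \<sigma> (s n))"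
proof -
  have "w (s m - s n) = dist (\<sigma> (s m)) (\<sigma> (s n))" if "\<forall>n. s n \<in> L" for m n
    using that by (simp add: subfield_diff[OF L] emb_diff[OF L \<sigma>] dist_norm)
  thus ?thesis unfolding cauchy_ring_def Cauchy_def by auto
qed

lemma limit_emb_tendsto:
  assumes "s \<in> carrier R" shows "(\<lambda>n. \<sigma> (s n)) \<longlonglongrightarrow> limit_emb s"
  using assms unfolding cauchy_ring_iff limit_emb_def
  by (auto dest!: Cauchy_convergent simp: convergent_LIMSEQ_iff)

lemma cauchy_ring_if_tendsto:
  "(\<And>n. s n \<in> L) \<Longrightarrow> (\<lambda>n. \<sigma> (s n)) \<longlonglongrightarrow> z \<Longrightarrow> s \<in> carrier R"
  by (auto simp: cauchy_ring_iff intro: LIMSEQ_imp_Cauchy)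

lemma limit_emb_eqI: "(\<lambda>n. \<sigma> (s n)) \<longlonglongrightarrow> z \<Longrightarrow> limit_emb s = z"
  unfolding limit_emb_def by (rule limI)

lemma cauchy_ring_mem: "s \<in> carrier R \<Longrightarrow> s n \<in> L"
  by (simp add: cauchy_ring_iff)

lemma
  assumes s: "s \<in> carrier R" and t: "t \<in> carrier R"
  shows cauchy_ring_add: "(\<lambda>n. s n + t n) \<in> carrier R"
    and limit_emb_add: "limit_emb (\<lambda>n. s n + t n) = limit_emb s + limit_emb t"
proof -
  have "(\<lambda>n. \<sigma> (s n + t n)) \<longlonglongrightarrow> limit_emb s + limit_emb t"
    using tendsto_add[OF limit_emb_tendsto[OF s] limit_emb_tendsto[OF t]]
    by (simp add: emb_add[OF L \<sigma>] cauchy_ring_mem[OF s] cauchy_ring_mem[OF t])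
  note limit = subfield_add[OF L cauchy_ring_mem[OF s] cauchy_ring_mem[OF t]] this
  show "(\<lambda>n. s n + t n) \<in> carrier R" by (rule cauchy_ring_if_tendsto[OF limit])
  show "limit_emb (\<lambda>n. s n + t n) = limit_emb s + limit_emb t" by (rule limit_emb_eqI[OF limit(2)])
qed

lemma
  assumes s: "s \<in> carrier R" and t: "t \<in> carrier R"
  shows cauchy_ring_mult: "(\<lambda>n. s n * t n) \<in> carrier R"
    and limit_emb_mult: "limit_emb (\<lambda>n. s n * t n) = limit_emb s * limit_emb t"
proof -
  have "(\<lambda>n. \<sigma> (s n * t n)) \<longlonglongrightarrow> limit_emb s * limit_emb t"
    using tendsto_mult[OF limit_emb_tendsto[OF s] limit_emb_tendsto[OF t]]
    by (simp add: emb_mult[OF L \<sigma>] cauchy_ring_mem[OF s] cauchy_ring_mem[OF t])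
  note limit = subfield_mult[OF L cauchy_ring_mem[OF s] cauchy_ring_mem[OF t]] this
  show "(\<lambda>n. s n * t n) \<in> carrier R" by (rule cauchy_ring_if_tendsto[OF limit])
  show "limit_emb (\<lambda>n. s n * t n) = limit_emb s * limit_emb t" by (rule limit_emb_eqI[OF limit(2)])
qed

lemma cauchy_ring_uminus:
  assumes s: "s \<in> carrier R" shows "(\<lambda>n. - s n) \<in> carrier R"
proof (rule cauchy_ring_if_tendsto)
  show "(\<lambda>n. \<sigma> (- s n)) \<longlonglongrightarrow> - limit_emb s"
    using tendsto_minus[OF limit_emb_tendsto[OF s]]
    by (simp add: emb_uminus[OF L \<sigma>] cauchy_ring_mem[OF s])
qed (rule subfield_uminus[OF L cauchy_ring_mem[OF s]])

lemma cauchy_ring_const: "x \<in> L \<Longrightarrow> (\<lambda>n. x) \<in> carrier R"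
  by (rule cauchy_ring_if_tendsto[of _ "\<sigma> x"]) simp_all

lemma limit_emb_const: "limit_emb (\<lambda>n. x) = \<sigma> x"
  by (rule limit_emb_eqI) simp

lemma cauchy_ring_simps:
  "s \<otimes>\<^bsub>R\<^esub> t = (\<lambda>n. s n * t n)" "s \<oplus>\<^bsub>R\<^esub> t = (\<lambda>n. s n + t n)" "\<one>\<^bsub>R\<^esub> = (\<lambda>n. 1)" "\<zero>\<^bsub>R\<^esub> = (\<lambda>n. 0)"
  by (simp_all add: cauchy_ring_def)

lemma cauchy_ring_cring: "cring R"
proof (rule cringI)
  show "abelian_group R"
  proof (rule abelian_groupI)
    fix s assume s: "s \<in> carrier R"
    show "\<exists>t\<in>carrier R. t \<oplus>\<^bsub>R\<^esub> s = \<zero>\<^bsub>R\<^esub>"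
      using cauchy_ring_uminus[OF s] by (intro bexI[of _ "\<lambda>n. - s n"]) (auto simp: cauchy_ring_simps)
  qed (use cauchy_ring_add cauchy_ring_const[OF subfield_zero[OF L]]
      in \<open>auto simp: cauchy_ring_simps algebra_simps\<close>)
  show "comm_monoid R"
    by (rule comm_monoidI)
      (use cauchy_ring_mult cauchy_ring_const[OF subfield_one[OF L]]
        in \<open>auto simp: cauchy_ring_simps algebra_simps\<close>)
qed (auto simp: cauchy_ring_simps algebra_simps)

lemma limit_emb_hom: "ring_hom_ring R S limit_emb"
proof (rule ring_hom_ringI2)
  show "ring R" by (rule cring.axioms(1)[OF cauchy_ring_cring])
  show "ring S" by (rule ring_from_type_algebra)
  show "limit_emb \<in> Ring.ring_hom R S"
    by (rule ring_hom_memI)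
      (simp_all add: cauchy_ring_simps limit_emb_add limit_emb_mult limit_emb_const emb_one[OF L \<sigma>])
qed

lemma null_ideal_eq: "null_ideal L w = a_kernel R S limit_emb"
proof -
  have "(\<lambda>n. w (s n)) \<longlonglongrightarrow> 0 \<longleftrightarrow> limit_emb s = 0" if s: "s \<in> carrier R" for s
  proof -
    have "(\<lambda>n. w (s n)) \<longlonglongrightarrow> 0 \<longleftrightarrow> (\<lambda>n. \<sigma> (s n)) \<longlonglongrightarrow> 0"
      using cauchy_ring_mem[OF s] by (simp add: tendsto_norm_zero_iff)
    also have "\<dots> \<longleftrightarrow> limit_emb s = 0"
    proof
      assume "(\<lambda>n. \<sigma> (s n)) \<longlonglongrightarrow> 0"
      from LIMSEQ_unique[OF limit_emb_tendsto[OF s] this] show "limit_emb s = 0" .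
    next
      assume "limit_emb s = 0"
      thus "(\<lambda>n. \<sigma> (s n)) \<longlonglongrightarrow> 0" using limit_emb_tendsto[OF s] by simp
    qed
    finally show ?thesis .
  qed
  hence "{s \<in> carrier R. (\<lambda>n. w (s n)) \<longlonglongrightarrow> 0} = {s \<in> carrier R. limit_emb s = 0}"
    by (intro Collect_cong conj_cong refl)
  thus ?thesis unfolding null_ideal_def a_kernel_def' by simp
qed

lemma limit_emb_rational:
  "limit_emb ` {s \<in> carrier R. \<forall>n. s n \<in> \<rat>} = \<real>"
proof (intro equalityI subsetI)
  fix z assume "z \<in> limit_emb ` {s \<in> carrier R. \<forall>n. s n \<in> \<rat>}"
  then obtain s where s: "s \<in> carrier R" "\<And>n. s n \<in> \<rat>" "z = limit_emb s" by blast
  have "\<sigma> (s n) \<in> \<real>" for n using s(2)[of n]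
    by (auto elim!: Rats_cases simp: emb_of_rat[OF L \<sigma>] simp flip: complex_of_rat)
  thus "z \<in> \<real>" unfolding s(3) by (rule Reals_LIMSEQ[OF _ limit_emb_tendsto[OF s(1)]])
next
  fix z :: complex assume "z \<in> \<real>"
  then obtain r where r: "z = of_real r" by (auto elim: Reals_cases)
  obtain q where q: "(\<lambda>n. of_rat (q n)) \<longlonglongrightarrow> r" by (rule rational_sequence_tendsto)
  have "(\<lambda>n. \<sigma> (of_rat (q n))) \<longlonglongrightarrow> z"
    using tendsto_of_real[OF q, where 'a = complex] by (simp add: emb_of_rat[OF L \<sigma>] r complex_of_rat)
  note limit = subfield_of_rat[OF L] this
  have "(\<lambda>n. of_rat (q n)) \<in> {s \<in> carrier R. \<forall>n. s n \<in> \<rat>}"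
    using cauchy_ring_if_tendsto[OF limit] by simp
  thus "z \<in> limit_emb ` {s \<in> carrier R. \<forall>n. s n \<in> \<rat>}" using limit_emb_eqI[OF limit(2)] by blast
qed

lemma limit_emb_carrier_real:
  assumes "\<sigma> ` L \<subseteq> \<real>" shows "limit_emb ` carrier R = \<real>"
proof (rule antisym)
  show "limit_emb ` carrier R \<subseteq> \<real>"
  proof
    fix z assume "z \<in> limit_emb ` carrier R"
    then obtain s where s: "s \<in> carrier R" "z = limit_emb s" by blast
    have "\<sigma> (s n) \<in> \<real>" for n using assms cauchy_ring_mem[OF s(1)] by blast
    thus "z \<in> \<real>" unfolding s(2) by (rule Reals_LIMSEQ[OF _ limit_emb_tendsto[OF s(1)]])
  qed
  show "\<real> \<subseteq> limit_emb ` carrier R" unfolding limit_emb_rational[symmetric] by blast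
qed

lemma limit_emb_carrier_complex:
  assumes "\<not> \<sigma> ` L \<subseteq> \<real>" shows "limit_emb ` carrier R = UNIV"
proof -
  obtain x where "x \<in> L" "\<sigma> x \<notin> \<real>" using assms by blast
  hence x: "x \<in> L" "Im (\<sigma> x) \<noteq> 0" by (simp_all add: complex_is_Real_iff)
  note x_const = cauchy_ring_const[OF x(1)]
  have "z \<in> limit_emb ` carrier R" for z
  proof -
    define b where "b = Im z / Im (\<sigma> x)"
    define a where "a = Re z - b * Re (\<sigma> x)"
    have real: "\<exists>s. s \<in> carrier R \<and> of_real r = limit_emb s" for r
    proof -
      have "of_real r \<in> limit_emb ` {s \<in> carrier R. \<forall>n. s n \<in> \<rat>}"
        unfolding limit_emb_rational by (rule Reals_of_real)
      thus ?thesis by auto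
    qed
    obtain s where s: "s \<in> carrier R" "of_real a = limit_emb s" using real by blast
    obtain t where t: "t \<in> carrier R" "of_real b = limit_emb t" using real by blast
    have "z = of_real a + of_real b * \<sigma> x" using x(2) by (simp add: complex_eq_iff a_def b_def)
    also have "\<dots> = limit_emb (\<lambda>n. s n + t n * x)"
      by (simp add: s t limit_emb_const
          limit_emb_add[OF s(1) cauchy_ring_mult[OF t(1) x_const]] limit_emb_mult[OF t(1) x_const])
    finally show ?thesis using cauchy_ring_add[OF s(1) cauchy_ring_mult[OF t(1) x_const]] by blast
  qed
  thus ?thesis by blast
qed

definition completion_emb :: "(nat \<Rightarrow> 'a) set \<Rightarrow> complex" where
  "completion_emb c = the_elem (limit_emb ` c)"

lemma completion_emb_coset:
  assumes s: "s \<in> carrier R"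
  shows "completion_emb (null_ideal L w +>\<^bsub>R\<^esub> s) = limit_emb s"
proof -
  interpret h: ring_hom_ring R S limit_emb by (rule limit_emb_hom)
  let ?K = "a_kernel R S limit_emb"
  have "\<zero>\<^bsub>R\<^esub> \<in> ?K" by (rule additive_subgroup.zero_closed[OF ideal.axioms(1)[OF h.kernel_is_ideal]])
  hence nonempty: "?K \<noteq> {}" by (metis empty_iff)
  have "limit_emb (t \<oplus>\<^bsub>R\<^esub> s) = limit_emb s" if "t \<in> ?K" for t
  proof -
    have t: "t \<in> carrier R" "limit_emb t = 0" using that unfolding a_kernel_def' by simp_all
    show ?thesis unfolding cauchy_ring_simps limit_emb_add[OF t(1) s] t(2) by simp
  qed
  hence "(\<Union>t\<in>?K. {limit_emb (t \<oplus>\<^bsub>R\<^esub> s)}) = (\<Union>t\<in>?K. {limit_emb s})"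
    by (intro SUP_cong refl arg_cong[of _ _ "\<lambda>z. {z}"])
  also have "\<dots> = {limit_emb s}" by (rule SUP_const[OF nonempty])
  finally have "limit_emb ` (?K +>\<^bsub>R\<^esub> s) = {limit_emb s}"
    unfolding a_r_coset_def' image_UN image_insert image_empty .
  thus ?thesis by (simp add: completion_emb_def null_ideal_eq)
qed

abbreviation limit_ring :: "complex ring" where
  "limit_ring \<equiv> S\<lparr>carrier := limit_emb ` carrier R\<rparr>"

lemma limit_ring_dimension:
  "subfield \<real> limit_ring"
  "ring.dimension limit_ring (if \<sigma> ` L \<subseteq> \<real> then 1 else 2) \<real> (carrier limit_ring)"
proof -
  have "subfield \<real> limit_ring \<and>
    ring.dimension limit_ring (if \<sigma> ` L \<subseteq> \<real> then 1 else 2) \<real> (carrier limit_ring)"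
  proof (cases "\<sigma> ` L \<subseteq> \<real>")
    case True
    have "field (S\<lparr>carrier := \<real>\<rparr>)" using amb.subfield_iff(2)[OF subfield_Reals] .
    from field.carrier_is_subfield[OF this] have subfield: "subfield \<real> (S\<lparr>carrier := \<real>\<rparr>)" by simp
    have "ring (S\<lparr>carrier := \<real>\<rparr>)"
      by (rule amb.subring_is_ring[OF subfieldE(1)[OF subfield_Reals]])
    from ring.dimension_one[OF this subfield] show ?thesis
      using subfield True by (simp add: limit_emb_carrier_real)
  next
    case False
    have "limit_ring = S"
      unfolding limit_emb_carrier_complex[OF False] by (simp add: ring_of_type_algebra_def)
    thus ?thesis using subfield_Reals complex_dimension_Reals False by simp
  qed
  thus "subfield \<real> limit_ring"
    "ring.dimension limit_ring (if \<sigma> ` L \<subseteq> \<real> then 1 else 2) \<real> (carrier limit_ring)" by simp_all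
qed

lemma completion_ring_iso: "completion_emb \<in> ring_iso (completion L w) limit_ring"
proof -
  interpret h: ring_hom_ring R S limit_emb by (rule limit_emb_hom)
  show ?thesis
    unfolding completion_def null_ideal_eq completion_emb_def by (rule h.FactRing_iso_set_aux)
qed

lemma completion_ring: "ring (completion L w)"
proof -
  interpret h: ring_hom_ring R S limit_emb by (rule limit_emb_hom)
  show ?thesis unfolding completion_def null_ideal_eq
    by (rule ideal.quotient_is_ring[OF h.kernel_is_ideal])
qed

lemma limit_ring: "ring limit_ring"
proof -
  interpret h: ring_hom_ring R S limit_emb by (rule limit_emb_hom)
  show ?thesis by (rule amb.subring_is_ring) (rule h.img_is_subring[OF h.R.carrier_is_subring])
qed

lemma completion_emb_rat: "completion_emb ` rat_completion L w = \<real>"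
proof -
  have "completion_emb ` rat_completion L w = limit_emb ` {s \<in> carrier R. \<forall>n. s n \<in> \<rat>}"
    unfolding rat_completion_def image_image
    by (intro image_cong refl) (auto simp: completion_emb_coset)
  thus ?thesis by (simp add: limit_emb_rational)
qed

lemma rat_completion_subset: "rat_completion L w \<subseteq> carrier (completion L w)"
  unfolding rat_completion_def completion_def FactRing_def A_RCOSETS_def RCOSETS_def a_r_coset_def
  by auto

lemma local_degree_eq: "local_degree L w = (if \<sigma> ` L \<subseteq> \<real> then 1 else 2)"
proof -
  define g where "g = inv_into (carrier (completion L w)) completion_emb"
  have "g \<in> ring_iso limit_ring (completion L w)"
    unfolding g_def by (rule ring_iso_set_sym[OF completion_ring completion_ring_iso])
  note image = ring_iso_dimension[OF limit_ring completion_ring this limit_ring_dimension]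
  have "inj_on completion_emb (carrier (completion L w))"
    using completion_ring_iso by (simp add: ring_iso_def bij_betw_def)
  hence "g ` \<real> = rat_completion L w"
    unfolding completion_emb_rat[symmetric] g_def using rat_completion_subset
    by (rule inv_into_image_cancel)
  thus ?thesis
    using ring.dimI[OF completion_ring image] unfolding local_degree_def over_def by simp
qed

lemma card_place_embs: "card (place_embs L w) = local_degree L w"
proof -
  have "\<sigma> = emb_cnj L \<sigma> \<longleftrightarrow> \<sigma> ` L \<subseteq> \<real>"
  proof
    assume eq: "\<sigma> = emb_cnj L \<sigma>"
    show "\<sigma> ` L \<subseteq> \<real>"
    proof safe
      fix x assume "x \<in> L"
      hence "\<sigma> x = cnj (\<sigma> x)" using fun_cong[OF eq, of x] by (simp add: emb_cnj_def)
      thus "\<sigma> x \<in> \<real>" by (simp add: Reals_cnj_iff)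
    qed
  next
    assume "\<sigma> ` L \<subseteq> \<real>"
    thus "\<sigma> = emb_cnj L \<sigma>"
      by (intro embs_eqI[OF \<sigma> emb_cnj_in_embs[OF L \<sigma>]]) (auto simp: emb_cnj_def Reals_cnj_iff)
  qed
  thus ?thesis unfolding place_embs_emb_abs[OF L \<sigma>] local_degree_eq by auto
qed

end

lemma card_place_embs_eq_local_degree:
  fixes L :: "'a::field_char_0 set"
  assumes L: "number_field L" and w: "w \<in> arch_places L"
  shows "card (place_embs L w) = local_degree L w"
proof -
  obtain \<sigma> where \<sigma>: "\<sigma> \<in> embs L" "w = emb_abs L \<sigma>" using w arch_places_eq[OF L] by blast
  show ?thesis unfolding \<sigma>(2)
    by (rule emb_completion.card_place_embs[OF emb_completion.intro[OF number_field_subfield[OF L]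
      \<sigma>(1)]])
qed


section \<open>Finiteness of algebraic integers with bounded conjugates\<close>

lemma algebraic_int_emb_iff:
  assumes L: "subfield L ambient" and \<sigma>: "\<sigma> \<in> embs L" and x: "x \<in> L"
  shows "algebraic_int (\<sigma> x) \<longleftrightarrow> algebraic_int x"
proof -
  have "poly (map_poly of_int p) (\<sigma> x) = 0 \<longleftrightarrow> poly (map_poly of_int p) x = 0" for p
  proof -
    let ?p = "map_poly of_int p :: 'a poly"
    have p: "?p \<in> polys_over L" by (simp add: polys_over_def coeff_map_poly subfield_of_int[OF L])
    have "map_poly \<sigma> ?p = map_poly of_int p"
      by (rule poly_eqI) (simp add: coeff_map_poly_emb[OF L \<sigma>] coeff_map_poly emb_of_int[OF L \<sigma>])
    thus ?thesis
      using poly_map_poly_emb[OF L \<sigma> p x] emb_eq_0_iff[OF L \<sigma> poly_polys_over[OF L p x]] by simp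
  qed
  thus ?thesis unfolding algebraic_int_altdef_ipoly by simp
qed

lemma rat_emb_Rats: "rat_emb ` \<rat> \<subseteq> \<rat>"
  by (auto elim!: Rats_cases simp: rat_emb_of_rat)

lemma prod_embs_Ints:
  assumes L: "number_field L" and x: "x \<in> L" "algebraic_int x"
  shows "(\<Prod>\<sigma>\<in>embs L. \<sigma> x) \<in> \<int>"
proof (rule rational_algebraic_int_is_int)
  interpret finite_extension \<rat> L by (rule number_field_extension_Rats[OF L])
  show "algebraic_int (\<Prod>\<sigma>\<in>embs L. \<sigma> x)"
    by (intro algebraic_int_prod) (simp add: algebraic_int_emb_iff[OF subfield_l _ x(1)] x(2))
  show "(\<Prod>\<sigma>\<in>embs L. \<sigma> x) \<in> \<rat>"
    using emb_field_norm[OF x(1) rat_emb_in_embs] rat_emb_Rats embs_eq_ext_embs_Rats[OF subfield_l]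
    by (metis image_subset_iff)
qed

lemma sum_embs_Ints:
  assumes L: "number_field L" and x: "x \<in> L" "algebraic_int x"
  shows "(\<Sum>\<sigma>\<in>embs L. \<sigma> x) \<in> \<int>"
proof (rule rational_algebraic_int_is_int)
  interpret finite_extension \<rat> L by (rule number_field_extension_Rats[OF L])
  show "algebraic_int (\<Sum>\<sigma>\<in>embs L. \<sigma> x)"
    by (intro algebraic_int_sum) (simp add: algebraic_int_emb_iff[OF subfield_l _ x(1)] x(2))
  show "(\<Sum>\<sigma>\<in>embs L. \<sigma> x) \<in> \<rat>"
    using emb_trace_mem[OF x(1) rat_emb_in_embs] rat_emb_Rats embs_eq_ext_embs_Rats[OF subfield_l]
    by auto
qed

lemma common_denominator:
  assumes "finite S" "S \<subseteq> (\<rat> :: 'a::field_char_0 set)"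
  shows "\<exists>D::int. D \<noteq> 0 \<and> (\<forall>q\<in>S. of_int D * q \<in> \<int>)"
  using assms
proof (induction S rule: finite_induct)
  case empty
  show ?case by (rule exI[of _ 1]) simp
next
  case (insert q S)
  then obtain D :: int where D: "D \<noteq> 0" "\<forall>q\<in>S. of_int D * q \<in> \<int>" by auto
  have "q \<in> \<rat>" using insert.prems by simp
  then obtain a b :: int where ab: "b > 0" "q = of_int a / of_int b" by (auto elim: Rats_cases')
  have "of_int (D * b) * q = of_int (D * a)" using ab by simp
  hence "of_int (D * b) * q \<in> \<int>" by (metis Ints_of_int)
  moreover have "of_int (D * b) * p \<in> \<int>" if "p \<in> S" for p
  proof -
    have "of_int (D * b) * p = of_int b * (of_int D * p)" by simp
    also have "\<dots> \<in> \<int>" by (rule Ints_mult[OF Ints_of_int]) (use D(2) that in blast)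
    finally show ?thesis .
  qed
  ultimately show ?case using D(1) ab(1) by (intro exI[of _ "D * b"]) auto
qed

lemma field_basis_nonzero:
  fixes k l :: "'a::field_char_0 set"
  assumes k: "subfield k ambient" and basis: "field_basis k l bs" and "i < length bs"
  shows "bs ! i \<noteq> 0"
proof
  assume "bs ! i = 0"
  let ?c = "\<lambda>j. if j = i then 1 else 0 :: 'a"
  have "(\<Sum>j<length bs. ?c j * bs ! j) = 0" using \<open>bs ! i = 0\<close> by (intro sum.neutral) auto
  hence "?c i = 0"
    by (intro field_basis_independent[OF basis, of ?c i])
      (use \<open>i < length bs\<close> subfield_zero[OF k] subfield_one[OF k] in auto)
  thus False by simp
qed

lemma algebraic_int_multiple:
  assumes L: "number_field L" and y: "y \<in> L"
  shows "\<exists>D::int. D \<noteq> 0 \<and> algebraic_int (of_int D * y)"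
proof -
  interpret finite_extension \<rat> L by (rule number_field_extension_Rats[OF L])
  obtain bs where bs: "amb.independent \<rat> bs" "amb.Span \<rat> bs = L" by (rule basis_exists)
  have basis: "field_basis \<rat> L bs" by (rule field_basis_if_independent_Span[OF subfield_Rats bs])
  let ?n = "length bs"
  have "?n > 0" by (rule dimension_pos[OF amb.dimensionI[OF subfield_Rats bs]])
  obtain A where A: "mult_matrix \<rat> bs y A" using mult_matrix_exists[OF subfield_l basis y] .
  have "\<exists>D::int. D \<noteq> 0 \<and> (\<forall>q\<in>(\<lambda>(i, j). A i j) ` ({..<?n} \<times> {..<?n}). of_int D * q \<in> \<int>)"
    by (rule common_denominator) (use A in \<open>auto simp: mult_matrix_def\<close>)
  then obtain D :: int where D: "D \<noteq> 0" "\<And>i j. i < ?n \<Longrightarrow> j < ?n \<Longrightarrow> of_int D * A i j \<in> \<int>" by auto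
  have "algebraic_int (of_int D * y)"
  proof (rule algebraic_int_if_int_module_stable[of "set bs" "bs ! 0"])
    show "bs ! 0 \<noteq> 0" by (rule field_basis_nonzero[OF subfield_Rats basis \<open>?n > 0\<close>])
    fix s assume "s \<in> set bs"
    then obtain j where j: "j < ?n" "s = bs ! j" by (auto simp: in_set_conv_nth)
    have "of_int D * y * s = of_int D * (\<Sum>i<?n. A i j * bs ! i)"
      using A j by (simp add: mult_matrix_def mult.assoc)
    also have "\<dots> = (\<Sum>i<?n. (of_int D * A i j) * bs ! i)" by (simp add: sum_distrib_left mult.assoc)
    also have "\<dots> \<in> int_module (set bs)"
    proof (rule int_mult.span_sum)
      fix i assume "i \<in> {..<?n}"
      then obtain e where "of_int D * A i j = of_int e" using D(2)[OF _ j(1)] by (auto elim: Ints_cases)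
      thus "of_int D * A i j * bs ! i \<in> int_module (set bs)"
        using int_mult.span_scale[OF int_mult.span_base, of "bs ! i" "set bs" e] \<open>i \<in> {..<?n}\<close> by simp
    qed
    finally show "of_int D * y * s \<in> int_module (set bs)" .
  qed (use \<open>?n > 0\<close> in auto)
  thus ?thesis using D(1) by blast
qed

definition bounded_integers :: "'a::field_char_0 set \<Rightarrow> real \<Rightarrow> 'a set" where
  "bounded_integers L B = {x \<in> L. algebraic_int x \<and> (\<forall>\<sigma>\<in>embs L. cmod (\<sigma> x) \<le> B)}"

lemma finite_traces_bounded_integers:
  assumes L: "number_field L" and c: "c \<in> L" "algebraic_int c"
  shows "finite ((\<lambda>x. \<Sum>\<sigma>\<in>embs L. \<sigma> (x * c)) ` bounded_integers L B)"
proof -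
  note subfield_L = number_field_subfield[OF L]
  define M where "M = (\<Sum>\<sigma>\<in>embs L. B * cmod (\<sigma> c))"
  have "(\<Sum>\<sigma>\<in>embs L. \<sigma> (x * c)) \<in> of_int ` {- \<lceil>M\<rceil>..\<lceil>M\<rceil>}" if "x \<in> bounded_integers L B" for x
  proof -
    have x: "x \<in> L" "algebraic_int x" "\<And>\<sigma>. \<sigma> \<in> embs L \<Longrightarrow> cmod (\<sigma> x) \<le> B"
      using that by (auto simp: bounded_integers_def)
    have "(\<Sum>\<sigma>\<in>embs L. \<sigma> (x * c)) \<in> \<int>"
      by (rule sum_embs_Ints[OF L])
        (use x c subfield_mult[OF subfield_L] algebraic_int_add_mult in auto)
    then obtain m where m: "(\<Sum>\<sigma>\<in>embs L. \<sigma> (x * c)) = of_int m" by (auto elim: Ints_cases)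
    have "real_of_int \<bar>m\<bar> = cmod (\<Sum>\<sigma>\<in>embs L. \<sigma> (x * c))" unfolding m by simp
    also have "\<dots> \<le> (\<Sum>\<sigma>\<in>embs L. cmod (\<sigma> (x * c)))" by (rule norm_sum)
    also have "\<dots> \<le> M"
      unfolding M_def
    proof (rule sum_mono)
      fix \<sigma> assume \<sigma>: "\<sigma> \<in> embs L"
      show "cmod (\<sigma> (x * c)) \<le> B * cmod (\<sigma> c)"
        unfolding emb_mult[OF subfield_L \<sigma> x(1) c(1)] norm_mult by (intro mult_right_mono x(3) \<sigma>) simp
    qed
    finally have "\<bar>m\<bar> \<le> \<lceil>M\<rceil>" by linarith
    thus ?thesis unfolding m by (intro imageI) auto
  qed
  thus ?thesis by (intro finite_subset[OF _ finite_imageI[OF finite_atLeastAtMost_int]]) blast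
qed

lemma eq_0_if_traces_eq_0:
  assumes L: "number_field L" and bs: "ring.independent ambient \<rat> bs" "ring.Span ambient \<rat> bs = L"
    and x: "x \<in> L" and traces: "\<And>j. j < length bs \<Longrightarrow> (\<Sum>\<sigma>\<in>embs L. \<sigma> (x * bs ! j)) = 0"
  shows "x = 0"
proof -
  interpret finite_extension \<rat> L by (rule number_field_extension_Rats[OF L])
  obtain t where "embedding_matrix \<rat> L bs rat_emb t"
    using embedding_matrix_exists[OF bs rat_emb_in_embs] .
  then interpret embedding_matrix \<rat> L bs rat_emb t .
  let ?n = "length bs"
  have relation: "(\<Sum>i<?n. t i (bs ! j) * t i x) = 0" if j: "j < ?n" for j
  proof -
    have "(\<Sum>i<?n. t i (bs ! j) * t i x) = (\<Sum>i<?n. t i (x * bs ! j))"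
      using emb_mult[OF subfield_l ext_embsD(1)[OF enum_mem] x field_basis_mem[OF basis j]]
      by (simp add: mult.commute)
    also have "\<dots> = (\<Sum>\<sigma>\<in>embs L. \<sigma> (x * bs ! j))"
      unfolding embs_eq_ext_embs_Rats[OF subfield_l] by (rule sum.reindex_bij_betw[OF enum])
    finally show ?thesis using traces[OF j] by simp
  qed
  have vanish: "t i x = 0" if "i < ?n" for i
    by (rule ext_embs_independent_on_basis[OF basis enum_mem, where m = ?n and c = "\<lambda>i. t i x"])
      (use relation enum that in \<open>auto simp: bij_betw_def\<close>)
  have "?n > 0" by (rule dimension_pos[OF amb.dimensionI[OF subfield_Rats bs]])
  thus ?thesis using emb_eq_0_iff[OF subfield_l ext_embsD(1)[OF enum_mem] x] vanish by blast
qed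

lemma eq_if_multiple_traces_eq:
  assumes L: "number_field L" and bs: "ring.independent ambient \<rat> bs" "ring.Span ambient \<rat> bs = L"
    and D: "\<And>j. j < length bs \<Longrightarrow> D j \<noteq> (0::int)" and x: "x \<in> L" and y: "y \<in> L"
    and traces: "\<And>j. j < length bs \<Longrightarrow>
      (\<Sum>\<sigma>\<in>embs L. \<sigma> (x * (of_int (D j) * bs ! j))) = (\<Sum>\<sigma>\<in>embs L. \<sigma> (y * (of_int (D j) * bs ! j)))"
  shows "x = y"
proof -
  note subfield_L = number_field_subfield[OF L]
  have xy: "x - y \<in> L" by (rule subfield_diff[OF subfield_L x y])
  have "(\<Sum>\<sigma>\<in>embs L. \<sigma> ((x - y) * bs ! j)) = 0" if j: "j < length bs" for j
  proof -
    have bs_mem: "bs ! j \<in> L"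
      by (rule field_basis_mem[OF field_basis_if_independent_Span[OF subfield_Rats bs] j])
    have multiple: "\<sigma> (z * (of_int (D j) * bs ! j)) = of_int (D j) * (\<sigma> z * \<sigma> (bs ! j))"
      if "\<sigma> \<in> embs L" "z \<in> L" for \<sigma> z
      by (simp add: emb_mult[OF subfield_L that(1)] emb_of_int[OF subfield_L that(1)] that(2) bs_mem
          subfield_mult[OF subfield_L] subfield_of_int[OF subfield_L])
    have "of_int (D j) * (\<Sum>\<sigma>\<in>embs L. \<sigma> ((x - y) * bs ! j))
        = (\<Sum>\<sigma>\<in>embs L. \<sigma> (x * (of_int (D j) * bs ! j)) - \<sigma> (y * (of_int (D j) * bs ! j)))"
      unfolding sum_distrib_left
    proof (rule sum.cong[OF refl])
      fix \<sigma> assume \<sigma>: "\<sigma> \<in> embs L"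
      show "of_int (D j) * \<sigma> ((x - y) * bs ! j)
          = \<sigma> (x * (of_int (D j) * bs ! j)) - \<sigma> (y * (of_int (D j) * bs ! j))"
        unfolding multiple[OF \<sigma> x] multiple[OF \<sigma> y] emb_mult[OF subfield_L \<sigma> xy bs_mem]
          emb_diff[OF subfield_L \<sigma> x y] by (simp add: algebra_simps)
    qed
    thus ?thesis using D[OF j] traces[OF j] by (simp add: sum_subtractf)
  qed
  hence "x - y = 0" by (rule eq_0_if_traces_eq_0[OF L bs xy])
  thus ?thesis by simp
qed

text \<open>
  An algebraic integer is determined by the traces of its products with an integral basis, and
  these traces are bounded integers.
\<close>

lemma finite_bounded_integers:
  assumes L: "number_field L"
  shows "finite (bounded_integers L B)"
proof -
  interpret finite_extension \<rat> L by (rule number_field_extension_Rats[OF L])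
  obtain bs where bs: "amb.independent \<rat> bs" "amb.Span \<rat> bs = L" by (rule basis_exists)
  let ?n = "length bs"
  have bs_mem: "bs ! j \<in> L" if "j < ?n" for j
    by (rule field_basis_mem[OF field_basis_if_independent_Span[OF subfield_Rats bs] that])
  have "\<forall>j\<in>{..<?n}. \<exists>D::int. D \<noteq> 0 \<and> algebraic_int (of_int D * bs ! j)"
    using algebraic_int_multiple[OF L bs_mem] by blast
  then obtain D :: "nat \<Rightarrow> int" where
    D: "\<And>j. j < ?n \<Longrightarrow> D j \<noteq> 0" "\<And>j. j < ?n \<Longrightarrow> algebraic_int (of_int (D j) * bs ! j)"
    by (metis lessThan_iff)
  define trace where "trace = (\<lambda>x j. \<Sum>\<sigma>\<in>embs L. \<sigma> (x * (of_int (D j) * bs ! j)))"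
  have "inj_on (\<lambda>x. restrict (trace x) {..<?n}) (bounded_integers L B)"
  proof (rule inj_onI)
    fix x y assume "x \<in> bounded_integers L B" "y \<in> bounded_integers L B"
    hence mem: "x \<in> L" "y \<in> L" by (simp_all add: bounded_integers_def)
    assume eq: "restrict (trace x) {..<?n} = restrict (trace y) {..<?n}"
    show "x = y"
    proof (rule eq_if_multiple_traces_eq[OF L bs D(1) mem])
      fix j assume "j < ?n"
      thus "(\<Sum>\<sigma>\<in>embs L. \<sigma> (x * (of_int (D j) * bs ! j)))
          = (\<Sum>\<sigma>\<in>embs L. \<sigma> (y * (of_int (D j) * bs ! j)))"
        using fun_cong[OF eq, of j] by (simp add: trace_def)
    qed
  qed
  moreover have "(\<lambda>x. restrict (trace x) {..<?n}) ` bounded_integers L B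
      \<subseteq> PiE {..<?n} (\<lambda>j. (\<lambda>x. trace x j) ` bounded_integers L B)"
    by (intro image_subsetI) (simp add: restrict_PiE_iff)
  moreover have "finite (PiE {..<?n} (\<lambda>j. (\<lambda>x. trace x j) ` bounded_integers L B))"
    unfolding trace_def
    by (intro finite_PiE finite_traces_bounded_integers[OF L] subfield_mult[OF subfield_l]
        subfield_of_int[OF subfield_l] bs_mem D(2)) auto
  ultimately show ?thesis using finite_imageD finite_subset by blast
qed


section \<open>Units and their logarithms\<close>

definition units :: "'a::field_char_0 set \<Rightarrow> 'a set" where
  "units L = carrier (unit_group L)"

lemma unit_group_simps:
  "x \<otimes>\<^bsub>unit_group L\<^esub> y = x * y" "\<one>\<^bsub>unit_group L\<^esub> = 1"
  by (simp_all add: unit_group_def units_of_def integers_ring_def ring_of_type_algebra_def)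

lemma units_iff:
  fixes L :: "'a::field_char_0 set"
  assumes L: "subfield L ambient"
  shows "u \<in> units L \<longleftrightarrow> u \<in> L \<and> u \<noteq> 0 \<and> algebraic_int u \<and> algebraic_int (inverse u)"
proof
  assume "u \<in> units L"
  then obtain v where u: "u \<in> L" "algebraic_int u" and v: "algebraic_int v" "u * v = 1"
    by (auto simp: units_def unit_group_def units_of_def Units_def integers_ring_def)
  have "v = inverse u" using v(2) by (simp add: inverse_unique)
  thus "u \<in> L \<and> u \<noteq> 0 \<and> algebraic_int u \<and> algebraic_int (inverse u)" using u v by auto
next
  assume u: "u \<in> L \<and> u \<noteq> 0 \<and> algebraic_int u \<and> algebraic_int (inverse u)"
  show "u \<in> units L"
    using u subfield_inverse[OF L, of u]
    by (auto simp: units_def unit_group_def units_of_def Units_def integers_ring_def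
      intro!: bexI[of _ "inverse u"])
qed

definition log_vec :: "'a::field_char_0 set \<Rightarrow> 'a \<Rightarrow> ('a \<Rightarrow> real) \<Rightarrow> real" where
  "log_vec L u = (\<lambda>w. if w \<in> arch_places L then real (local_degree L w) * ln (w u) else 0)"

context
  fixes L :: "'a::field_char_0 set"
  assumes L: "number_field L"
begin

private lemma subfield_L: "subfield L ambient"
  by (rule number_field_subfield[OF L])

lemma units_mult: "u \<in> units L \<Longrightarrow> v \<in> units L \<Longrightarrow> u * v \<in> units L"
  using subfield_mult[OF subfield_L]
  by (auto simp: units_iff[OF subfield_L] intro: algebraic_int_add_mult)

lemma units_one: "1 \<in> units L"
  using subfield_one[OF subfield_L]
  by (auto simp: units_iff[OF subfield_L])

lemma units_inverse: "u \<in> units L \<Longrightarrow> inverse u \<in> units L"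
  using subfield_inverse[OF subfield_L]
  by (auto simp: units_iff[OF subfield_L])

lemma units_power: "u \<in> units L \<Longrightarrow> u ^ n \<in> units L"
  by (induction n) (auto intro: units_one units_mult)

lemma units_mem: "u \<in> units L \<Longrightarrow> u \<in> L" and units_nonzero: "u \<in> units L \<Longrightarrow> u \<noteq> 0"
  by (auto simp: units_iff[OF subfield_L])

lemma unit_group_comm_group: "comm_group (unit_group L)"
proof (rule comm_groupI)
  fix u assume u: "u \<in> carrier (unit_group L)"
  show "\<exists>v\<in>carrier (unit_group L). v \<otimes>\<^bsub>unit_group L\<^esub> u = \<one>\<^bsub>unit_group L\<^esub>"
    using units_inverse[of u] units_nonzero[of u] u
    by (intro bexI[of _ "inverse u"]) (auto simp: unit_group_simps units_def)
qed (use units_mult units_one in \<open>auto simp: unit_group_simps units_def\<close>)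

lemma place_unit_pos:
  assumes "u \<in> units L" "w \<in> arch_places L" shows "w u > 0"
  using absval_nonneg[OF subfield_L arch_place_absval[OF assms(2)]
    units_mem[OF assms(1)]]
    absval_eq_0[OF subfield_L arch_place_absval[OF assms(2)]
        units_mem[OF assms(1)]] units_nonzero[OF assms(1)] by linarith

lemma log_vec_eq_sum:
  assumes u: "u \<in> L" and w: "w \<in> arch_places L"
  shows "log_vec L u w = (\<Sum>\<sigma>\<in>place_embs L w. ln (cmod (\<sigma> u)))"
proof -
  have "ln (cmod (\<sigma> u)) = ln (w u)" if "\<sigma> \<in> place_embs L w" for \<sigma>
    using that u by (auto simp: place_embs_def)
  hence "(\<Sum>\<sigma>\<in>place_embs L w. ln (cmod (\<sigma> u))) = (\<Sum>\<sigma>\<in>place_embs L w. ln (w u))"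
    by (rule sum.cong[OF refl])
  thus ?thesis using w by (simp add: log_vec_def card_place_embs_eq_local_degree[OF L w])
qed

lemma log_vec_mult:
  assumes "u \<in> units L" "v \<in> units L"
  shows "log_vec L (u * v) = log_vec L u + log_vec L v"
proof
  fix w
  show "log_vec L (u * v) w = (log_vec L u + log_vec L v) w"
  proof (cases "w \<in> arch_places L")
    case True
    have "w (u * v) = w u * w v"
      by (rule absval_mult[OF subfield_L arch_place_absval[OF True]
        assms[THEN units_mem]])
    thus ?thesis using True place_unit_pos[OF assms(1) True] place_unit_pos[OF assms(2) True]
      by (simp add: log_vec_def ln_mult distrib_left)
  qed (simp add: log_vec_def)
qed

lemma log_vec_one: "log_vec L 1 = 0"
  using log_vec_mult[OF units_one units_one] by simp

lemma log_vec_power: "u \<in> units L \<Longrightarrow> log_vec L (u ^ n) = of_nat n *\<^sub>R log_vec L u"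
  by (induction n) (simp_all add: log_vec_one log_vec_mult units_power algebra_simps)

lemma log_vec_inverse: "u \<in> units L \<Longrightarrow> log_vec L (inverse u) = - log_vec L u"
  using log_vec_mult[of u "inverse u"] units_inverse[of u] units_nonzero[of u]
  by (simp add: log_vec_one eq_neg_iff_add_eq_0 add.commute)

lemma prod_cmod_embs_unit:
  assumes u: "u \<in> units L" shows "(\<Prod>\<sigma>\<in>embs L. cmod (\<sigma> u)) = 1"
proof -
  have inverse: "\<sigma> u * \<sigma> (inverse u) = 1" if "\<sigma> \<in> embs L" for \<sigma>
    using emb_inverse[OF subfield_L that units_mem[OF u]]
      emb_eq_0_iff[OF subfield_L that units_mem[OF u]]
      units_nonzero[OF u] by simp
  obtain m where m: "(\<Prod>\<sigma>\<in>embs L. \<sigma> u) = of_int m"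
    using prod_embs_Ints[OF L units_mem[OF u]] u
    by (auto simp: units_iff[OF subfield_L] elim: Ints_cases)
  obtain n where n: "(\<Prod>\<sigma>\<in>embs L. \<sigma> (inverse u)) = of_int n"
    using prod_embs_Ints[OF L units_mem[OF units_inverse[OF u]]] u
    by (auto simp: units_iff[OF subfield_L] elim: Ints_cases)
  have "(\<Prod>\<sigma>\<in>embs L. \<sigma> u * \<sigma> (inverse u)) = 1" using inverse by simp
  hence "of_int (m * n) = (1 :: complex)" by (simp add: prod.distrib m n)
  hence "m * n = 1" using of_int_eq_1_iff by blast
  hence "\<bar>m\<bar> = 1" by (metis abs_mult_pos' zmult_eq_1_iff abs_1 abs_minus_cancel)
  moreover have "(\<Prod>\<sigma>\<in>embs L. cmod (\<sigma> u)) = cmod (of_int m)" unfolding m[symmetric] by (rule prod_norm)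
  ultimately show ?thesis by simp
qed

lemma sum_log_vec:
  assumes u: "u \<in> units L" shows "(\<Sum>w\<in>arch_places L. log_vec L u w) = 0"
proof -
  have "(\<Sum>w\<in>arch_places L. log_vec L u w)
      = (\<Sum>w\<in>arch_places L. \<Sum>\<sigma>\<in>{\<sigma>\<in>embs L. emb_abs L \<sigma> = w}. ln (cmod (\<sigma> u)))"
    by (intro sum.cong refl) (simp add: log_vec_eq_sum[OF units_mem[OF u]] place_embs_def)
  also have "\<dots> = (\<Sum>\<sigma>\<in>embs L. ln (cmod (\<sigma> u)))"
    by (rule sum.group[OF finite_embs[OF L] finite_arch_places[OF L]]) (simp add: arch_places_eq[OF L])
  also have "\<dots> = ln (\<Prod>\<sigma>\<in>embs L. cmod (\<sigma> u))"
    by (rule ln_prod[symmetric])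
      (use finite_embs[OF L] emb_eq_0_iff[OF subfield_L _ units_mem[OF u]]
        units_nonzero[OF u] in auto)
  finally show ?thesis by (simp add: prod_cmod_embs_unit[OF u])
qed

lemma local_degree_pos:
  assumes w: "w \<in> arch_places L" shows "local_degree L w > 0"
proof -
  obtain \<sigma> where "\<sigma> \<in> embs L" "w = emb_abs L \<sigma>" using w arch_places_eq[OF L] by blast
  hence "place_embs L w \<noteq> {}" by (auto simp: place_embs_def)
  moreover have "finite (place_embs L w)" using finite_embs[OF L] by (simp add: place_embs_def)
  ultimately show ?thesis unfolding card_place_embs_eq_local_degree[OF L w, symmetric]
    by (simp add: card_gt_0_iff)
qed

lemma finite_bounded_units: "finite {u \<in> units L. \<forall>w\<in>arch_places L. \<bar>log_vec L u w\<bar> \<le> B}"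
proof (rule finite_subset[OF _ finite_bounded_integers[OF L, of "exp B"]], safe)
  fix u assume u: "u \<in> units L" "\<forall>w\<in>arch_places L. \<bar>log_vec L u w\<bar> \<le> B"
  have "cmod (\<sigma> u) \<le> exp B" if \<sigma>: "\<sigma> \<in> embs L" for \<sigma>
  proof -
    have w: "emb_abs L \<sigma> \<in> arch_places L" by (rule emb_abs_arch_place[OF subfield_L \<sigma>])
    let ?d = "real (local_degree L (emb_abs L \<sigma>))"
    have "cmod (\<sigma> u) > 0" using place_unit_pos[OF u(1) w] units_mem[OF u(1)] by simp
    have "\<bar>?d * ln (cmod (\<sigma> u))\<bar> \<le> B"
      using u(2)[rule_format, OF w] w units_mem[OF u(1)] by (simp add: log_vec_def)
    moreover have "1 * \<bar>ln (cmod (\<sigma> u))\<bar> \<le> ?d * \<bar>ln (cmod (\<sigma> u))\<bar>"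
      using local_degree_pos[OF w] by (intro mult_right_mono) auto
    ultimately have "ln (cmod (\<sigma> u)) \<le> B" by (simp add: abs_mult)
    thus ?thesis using \<open>cmod (\<sigma> u) > 0\<close> by (metis exp_le_cancel_iff exp_ln)
  qed
  thus "u \<in> bounded_integers L (exp B)"
    using u(1) by (auto simp: bounded_integers_def units_iff[OF subfield_L])
qed

text \<open>Kronecker: the powers of a unit with vanishing logarithms form a finite set.\<close>

lemma log_vec_zero_iff_torsion:
  assumes u: "u \<in> units L"
  shows "log_vec L u = 0 \<longleftrightarrow> (\<exists>n>0. u ^ n = 1)"
proof
  assume "\<exists>n>0. u ^ n = 1"
  then obtain n where n: "n > 0" "u ^ n = 1" by blast
  hence "of_nat n *\<^sub>R log_vec L u = 0" using log_vec_power[OF u, of n] by (simp add: log_vec_one)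
  thus "log_vec L u = 0" using n(1) by simp
next
  assume "log_vec L u = 0"
  hence "range (\<lambda>n. u ^ n) \<subseteq> {u \<in> units L. \<forall>w\<in>arch_places L. \<bar>log_vec L u w\<bar> \<le> 0}"
    using units_power[OF u] log_vec_power[OF u] by auto
  hence "finite (range (\<lambda>n. u ^ n))" using finite_subset finite_bounded_units by blast
  hence "\<not> inj (\<lambda>n. u ^ n)" using finite_imageD infinite_UNIV_nat by blast
  then obtain i j where "u ^ i = u ^ j" "i < j" by (metis injI linorder_neqE_nat)
  hence "u ^ i * u ^ (j - i) = u ^ i * 1" using power_add[of u i "j - i"] by simp
  hence "u ^ (j - i) = 1" using units_nonzero[OF u] by simp
  thus "\<exists>n>0. u ^ n = 1" using \<open>i < j\<close> by (intro exI[of _ "j - i"]) auto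
qed

end


section \<open>Groups with an additive injection into a vector space\<close>

locale log_group = comm_group G for G :: "('g, 'b) monoid_scheme" (structure) +
  fixes lg :: "'g \<Rightarrow> 'v::real_vector"
  assumes lg_mult: "x \<in> carrier G \<Longrightarrow> y \<in> carrier G \<Longrightarrow> lg (x \<otimes> y) = lg x + lg y"
    and lg_eq_zeroD: "x \<in> carrier G \<Longrightarrow> lg x = 0 \<Longrightarrow> x = \<one>"
begin

lemma lg_one: "lg \<one> = 0"
  using lg_mult[OF one_closed one_closed] by simp

lemma lg_inv: "x \<in> carrier G \<Longrightarrow> lg (inv x) = - lg x"
  using lg_mult[of x "inv x"] by (simp add: lg_one eq_neg_iff_add_eq_0 add.commute)

lemma lg_nat_pow: "x \<in> carrier G \<Longrightarrow> lg (x [^] (n::nat)) = of_nat n *\<^sub>R lg x"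
  by (induction n) (simp_all add: lg_one lg_mult algebra_simps)

lemma lg_int_pow:
  assumes x: "x \<in> carrier G" shows "lg (x [^] (e::int)) = of_int e *\<^sub>R lg x"
proof (cases "e < 0")
  case True
  have "lg (x [^] e) = - (of_nat (nat (- e)) *\<^sub>R lg x)"
    unfolding int_pow_def2 using True
    by (simp only: if_True lg_inv[OF nat_pow_closed[OF x]] lg_nat_pow[OF x])
  thus ?thesis using True by simp
next
  case False
  have "lg (x [^] e) = of_nat (nat e) *\<^sub>R lg x"
    unfolding int_pow_def2 using False by (simp only: if_False lg_nat_pow[OF x])
  thus ?thesis using False by simp
qed

lemma lg_eq_zero_iff: "x \<in> carrier G \<Longrightarrow> lg x = 0 \<longleftrightarrow> x = \<one>"
  using lg_eq_zeroD lg_one by blast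

lemma lg_inj_on: "inj_on lg (carrier G)"
proof (rule inj_onI)
  fix x y assume x: "x \<in> carrier G" and y: "y \<in> carrier G" and "lg x = lg y"
  hence "lg (x \<otimes> inv y) = 0" by (simp add: lg_mult lg_inv)
  hence "x \<otimes> inv y = \<one>" using lg_eq_zeroD x y by simp
  thus "x = y" using inv_solve_right'[of \<one> x y] x y by simp
qed

lemma lg_finprod:
  assumes "finite I" "f \<in> I \<rightarrow> carrier G" shows "lg (finprod G f I) = (\<Sum>i\<in>I. lg (f i))"
  using assms by (induction I rule: finite_induct) (simp_all add: lg_one lg_mult Pi_iff)

lemma mult_independent_iff:
  "mult_independent G I x \<longleftrightarrow> finite I \<and> x \<in> I \<rightarrow> carrier G \<and> int_independent I (\<lambda>i. lg (x i))"
proof (cases "finite I \<and> x \<in> I \<rightarrow> carrier G")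
  case True
  have "finprod G (\<lambda>i. x i [^] (e i :: int)) I = \<one> \<longleftrightarrow> (\<Sum>i\<in>I. of_int (e i) *\<^sub>R lg (x i)) = 0" for e
  proof -
    have "lg (finprod G (\<lambda>i. x i [^] e i) I) = (\<Sum>i\<in>I. lg (x i [^] e i))"
      using True by (intro lg_finprod) auto
    also have "\<dots> = (\<Sum>i\<in>I. of_int (e i) *\<^sub>R lg (x i))"
      using True by (intro sum.cong refl lg_int_pow) auto
    finally show ?thesis
      using lg_eq_zero_iff[of "finprod G (\<lambda>i. x i [^] e i) I"] True by (simp add: Pi_iff)
  qed
  thus ?thesis using True unfolding mult_independent_def int_independent_def by simp
qed (auto simp: mult_independent_def)

lemma int_subspace_lg_image:
  assumes H: "subgroup H G" shows "int_subspace (lg ` H)"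
proof (rule int_subspaceI)
  interpret H: subgroup H G by (rule H)
  show "0 \<in> lg ` H" using lg_one H.one_closed by (metis image_eqI)
  fix f g assume "f \<in> lg ` H" "g \<in> lg ` H"
  then obtain x y where xy: "x \<in> H" "y \<in> H" "f = lg x" "g = lg y" by blast
  hence "lg (x \<otimes> inv y) = f - g" by (simp add: lg_mult lg_inv)
  thus "f - g \<in> lg ` H" using xy by (metis H.m_closed H.m_inv_closed image_eqI)
qed

lemma lg_generate:
  assumes S: "S \<subseteq> carrier G"
  shows "lg ` generate G S = int_span (lg ` S)"
proof (rule antisym)
  have "lg g \<in> int_span (lg ` S)" if "g \<in> generate G S" for g
    using that
  proof (induction g rule: generate.induct)
    case (inv h)
    thus ?case using S lg_inv[of h] int_vec.span_neg[OF int_vec.span_base, of "lg h"] by auto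
  next
    case (eng h g)
    hence "h \<in> carrier G" "g \<in> carrier G" using generate_in_carrier[OF S] by blast+
    thus ?case using eng.IH by (simp add: lg_mult int_vec.span_add)
  qed (auto simp: lg_one int_vec.span_zero intro: int_vec.span_base)
  thus "lg ` generate G S \<subseteq> int_span (lg ` S)" by blast
  show "int_span (lg ` S) \<subseteq> lg ` generate G S"
    by (intro int_vec.span_minimal int_subspace_lg_image generate_is_subgroup[OF S] image_mono)
      (auto intro: generate.incl)
qed

lemma group_basis_iff_lattice_basis:
  assumes us: "set us \<subseteq> carrier G"
  shows "group_basis G us \<longleftrightarrow> lattice_basis (lg ` carrier G) (length us) (\<lambda>i. lg (us ! i))"
proof -
  have "(\<lambda>i. lg (us ! i)) ` {..<length us} = lg ` set us"
    by (auto simp: set_conv_nth)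
  moreover have "generate G (set us) = carrier G \<longleftrightarrow> lg ` generate G (set us) = lg ` carrier G"
    using inj_on_image_eq_iff[OF lg_inj_on generate_incl[OF us] subset_refl] by simp
  moreover have "(\<lambda>i. us ! i) \<in> {..<length us} \<rightarrow> carrier G" using us by auto
  ultimately show ?thesis
    by (simp add: group_basis_def mult_independent_iff lattice_basis_def lg_generate[OF us])
qed

lemma lattice_basis_if_group_basis:
  assumes "group_basis G us"
  shows "lattice_basis (lg ` carrier G) (length us) (\<lambda>i. lg (us ! i))"
proof -
  have "set us \<subseteq> carrier G"
    using assms by (auto simp: group_basis_def mult_independent_def in_set_conv_nth)
  thus ?thesis using assms group_basis_iff_lattice_basis by blast
qed

lemma group_basis_exists:
  assumes b: "lattice_basis (lg ` carrier G) n b"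
  obtains us where "group_basis G us"
proof -
  define us where "us = map (\<lambda>i. inv_into (carrier G) lg (b i)) [0..<n]"
  have "lg (us ! i) = b i" if "i < n" for i
    using f_inv_into_f[OF lattice_basis_mem[OF b that]] that by (simp add: us_def)
  hence "lattice_basis (lg ` carrier G) (length us) (\<lambda>i. lg (us ! i))"
    using b by (simp add: lattice_basis_def us_def int_independent_def)
  moreover have "set us \<subseteq> carrier G"
    using lattice_basis_mem[OF b] by (auto simp: us_def intro: inv_into_into)
  ultimately show ?thesis using group_basis_iff_lattice_basis that by blast
qed

lemma log_group_subgroup:
  assumes H: "subgroup H G" shows "log_group (G\<lparr>carrier := H\<rparr>) lg"
proof -
  interpret H: subgroup H G by (rule H)
  have "group (G\<lparr>carrier := H\<rparr>)" by (rule subgroup_imp_group[OF H])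
  hence "comm_group (G\<lparr>carrier := H\<rparr>)"
    by (rule group.group_comm_groupI) (simp add: m_comm)
  thus ?thesis
    by (rule log_group.intro) (unfold_locales, auto simp: lg_mult intro: lg_eq_zeroD)
qed

end

section \<open>Units modulo torsion\<close>

definition unit_coset :: "'a::field_char_0 set \<Rightarrow> 'a \<Rightarrow> 'a set" where
  "unit_coset L u = torsion (unit_group L) #>\<^bsub>unit_group L\<^esub> u"

definition F_log :: "'a::field_char_0 set \<Rightarrow> 'a set \<Rightarrow> ('a \<Rightarrow> real) \<Rightarrow> real" where
  "F_log L A = (\<lambda>w. if w \<in> arch_places L then real (local_degree L w) * ln (F_abs w A) else 0)"

lemma image_eq_singletonI: "x \<in> A \<Longrightarrow> (\<And>y. y \<in> A \<Longrightarrow> f y = c) \<Longrightarrow> f ` A = {c}"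
  by auto

lemma unit_group_pow: "x [^]\<^bsub>unit_group L\<^esub> (n::nat) = x ^ n"
  by (induction n) (simp_all add: nat_pow_def unit_group_simps mult.commute)

lemma mem_unit_coset: "x \<in> unit_coset L u \<longleftrightarrow> (\<exists>t\<in>torsion (unit_group L). x = t * u)"
  by (auto simp: unit_coset_def r_coset_def unit_group_simps)

context
  fixes L :: "'a::field_char_0 set"
  assumes L: "number_field L"
begin

interpretation U: comm_group "unit_group L"
  by (rule unit_group_comm_group[OF L])

lemma torsion_iff: "t \<in> torsion (unit_group L) \<longleftrightarrow> t \<in> units L \<and> log_vec L t = 0"
  unfolding torsion_def unit_group_pow unit_group_simps units_def[symmetric]
  by (simp add: log_vec_zero_iff_torsion[OF L] cong: conj_cong)

lemma one_mem_torsion: "1 \<in> torsion (unit_group L)"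
  by (simp add: torsion_iff units_one[OF L] log_vec_one[OF L])

lemma torsion_mult:
  "s \<in> torsion (unit_group L) \<Longrightarrow> t \<in> torsion (unit_group L) \<Longrightarrow> s * t \<in> torsion (unit_group L)"
  by (simp add: torsion_iff units_mult[OF L] log_vec_mult[OF L])

lemma subgroup_torsion: "subgroup (torsion (unit_group L)) (unit_group L)"
proof (rule U.subgroupI)
  show "torsion (unit_group L) \<subseteq> carrier (unit_group L)" by (auto simp: torsion_def)
  show "torsion (unit_group L) \<noteq> {}" using one_mem_torsion by blast
  fix a assume a: "a \<in> torsion (unit_group L)"
  hence "a \<in> units L" by (simp add: torsion_iff)
  hence "inv\<^bsub>unit_group L\<^esub> a = inverse a"
    using units_inverse[OF L] units_nonzero[OF L]
    by (intro U.inv_equality) (auto simp: unit_group_simps units_def)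
  thus "inv\<^bsub>unit_group L\<^esub> a \<in> torsion (unit_group L)"
    using a by (simp add: torsion_iff units_inverse[OF L] log_vec_inverse[OF L])
  fix b assume "b \<in> torsion (unit_group L)"
  thus "a \<otimes>\<^bsub>unit_group L\<^esub> b \<in> torsion (unit_group L)"
    using a by (simp add: unit_group_simps torsion_mult)
qed

lemma normal_torsion: "torsion (unit_group L) \<lhd> unit_group L"
  by (rule U.subgroup_imp_normal[OF subgroup_torsion])

lemma carrier_units_mod_tor: "carrier (units_mod_tor L) = unit_coset L ` units L"
  unfolding units_mod_tor_def FactGroup_def RCOSETS_def unit_coset_def units_def by auto

lemma unit_coset_mult:
  assumes "u \<in> units L" "v \<in> units L"
  shows "unit_coset L u \<otimes>\<^bsub>units_mod_tor L\<^esub> unit_coset L v = unit_coset L (u * v)"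
  using normal.rcos_sum[OF normal_torsion, of u v] assms
  by (simp add: units_mod_tor_def FactGroup_def unit_coset_def units_def unit_group_simps)

lemma absval_torsion:
  assumes w: "absolute_value L w" and t: "t \<in> torsion (unit_group L)" shows "w t = 1"
proof -
  obtain n where n: "t \<in> units L" "n > 0" "t ^ n = 1"
    using t by (auto simp: torsion_def unit_group_pow unit_group_simps units_def)
  have tL: "t \<in> L" by (rule units_mem[OF L n(1)])
  have "w t ^ n = 1" using absval_power[OF number_field_subfield[OF L] w tL, of n] n(3)
      absval_one[OF number_field_subfield[OF L] w] by simp
  thus ?thesis
    using power_eq_imp_eq_base[of "w t" n 1] n(2) absval_nonneg[OF number_field_subfield[OF L] w tL]
    by simp
qed

lemma absval_unit_coset:
  assumes w: "absolute_value L w" and u: "u \<in> units L" and x: "x \<in> unit_coset L u"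
  shows "w x = w u"
proof -
  obtain t where t: "t \<in> torsion (unit_group L)" "x = t * u" using x by (auto simp: mem_unit_coset)
  have "t \<in> L" using t(1) units_mem[OF L] by (simp add: torsion_iff)
  thus ?thesis unfolding t(2)
    using absval_mult[OF number_field_subfield[OF L] w _ units_mem[OF L u]]
      absval_torsion[OF w t(1)] by simp
qed

lemma unit_coset_self: "u \<in> unit_coset L u"
  using one_mem_torsion by (auto simp: mem_unit_coset)

lemma F_abs_unit_coset:
  assumes w: "absolute_value L w" and u: "u \<in> units L" shows "F_abs w (unit_coset L u) = w u"
proof -
  have "w ` unit_coset L u = {w u}"
    by (rule image_eq_singletonI[OF unit_coset_self absval_unit_coset[OF w u]])
  thus ?thesis by (simp add: F_abs_def)
qed

lemma F_height_nonneg: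
  assumes A: "A \<in> carrier (units_mod_tor L)" shows "F_height L A \<ge> 0"
proof -
  obtain u where u: "u \<in> units L" "A = unit_coset L u" using A by (auto simp: carrier_units_mod_tor)
  have "weil_height L x = weil_height L u" if x: "x \<in> A" for x
    unfolding weil_height_def
  proof (rule infsum_cong)
    fix w assume "w \<in> arch_places L \<union> finite_places L"
    hence "absolute_value L w" by (auto simp: arch_places_def finite_places_def)
    from absval_unit_coset[OF this u(1)] x u(2) have "w x = w u" by simp
    thus "ln (max 1 (w x powr (real (local_degree L w) / real (field_degree L)))) =
          ln (max 1 (w u powr (real (local_degree L w) / real (field_degree L))))" by simp
  qed
  moreover have "u \<in> A" unfolding u(2) by (rule unit_coset_self)
  ultimately have "weil_height L ` A = {weil_height L u}" by (intro image_eq_singletonI)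
  hence "F_height L A = weil_height L u" by (simp add: F_height_def)
  also have "\<dots> \<ge> 0" unfolding weil_height_def by (intro infsum_nonneg) simp
  finally show ?thesis .
qed

lemma F_log_unit_coset: "u \<in> units L \<Longrightarrow> F_log L (unit_coset L u) = log_vec L u"
  by (auto simp: F_log_def log_vec_def F_abs_unit_coset[OF arch_place_absval])

lemma log_group_units_mod_tor: "log_group (units_mod_tor L) (F_log L)"
proof (rule log_group.intro)
  show "comm_group (units_mod_tor L)"
    unfolding units_mod_tor_def by (rule U.abelian_FactGroup[OF subgroup_torsion])
  show "log_group_axioms (units_mod_tor L) (F_log L)"
  proof
    fix x y assume "x \<in> carrier (units_mod_tor L)" "y \<in> carrier (units_mod_tor L)"
    then obtain u v where "u \<in> units L" "v \<in> units L" "x = unit_coset L u" "y = unit_coset L v"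
      by (auto simp: carrier_units_mod_tor)
    thus "F_log L (x \<otimes>\<^bsub>units_mod_tor L\<^esub> y) = F_log L x + F_log L y"
      by (simp add: unit_coset_mult F_log_unit_coset units_mult[OF L] log_vec_mult[OF L])
  next
    fix x assume "x \<in> carrier (units_mod_tor L)" and "F_log L x = 0"
    moreover from this obtain u where u: "u \<in> units L" "x = unit_coset L u"
      by (auto simp: carrier_units_mod_tor)
    ultimately have "u \<in> torsion (unit_group L)" by (simp add: torsion_iff F_log_unit_coset)
    hence "x = torsion (unit_group L)"
      unfolding u(2) unit_coset_def using u(1)
      by (intro U.coset_join2 subgroup_torsion) (simp_all add: units_def)
    thus "x = \<one>\<^bsub>units_mod_tor L\<^esub>" by (simp add: units_mod_tor_def FactGroup_def)
  qed
qed

lemma F_log_image: "F_log L ` carrier (units_mod_tor L) = log_vec L ` units L"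
  unfolding carrier_units_mod_tor image_image by (intro image_cong refl) (simp add: F_log_unit_coset)

lemma log_lattice_discrete: "discrete_lattice (arch_places L) (log_vec L ` units L)"
proof -
  interpret log_group "units_mod_tor L" "F_log L" by (rule log_group_units_mod_tor)
  have "finite {f \<in> log_vec L ` units L. \<forall>w\<in>arch_places L. \<bar>f w\<bar> \<le> B}" for B
  proof (rule finite_subset)
    show "{f \<in> log_vec L ` units L. \<forall>w\<in>arch_places L. \<bar>f w\<bar> \<le> B}
        \<subseteq> log_vec L ` {u \<in> units L. \<forall>w\<in>arch_places L. \<bar>log_vec L u w\<bar> \<le> B}" by auto
  qed (rule finite_imageI[OF finite_bounded_units[OF L]])
  moreover have "int_subspace (log_vec L ` units L)"
    using int_subspace_lg_image[OF subgroup_self] by (simp add: F_log_image)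
  ultimately show ?thesis unfolding discrete_lattice_def by (auto simp: log_vec_def)
qed

end


section \<open>Relative units\<close>

abbreviation rel_sum :: "'a::field_char_0 set \<Rightarrow> 'a set \<Rightarrow> (('a \<Rightarrow> real) \<Rightarrow> real)
    \<Rightarrow> ('a \<Rightarrow> real) \<Rightarrow> real" where
  "rel_sum l k \<equiv> fiber_sum (\<lambda>w. restrict w k) (arch_places l)"

locale number_field_extension =
  fixes k l :: "'a::field_char_0 set"
  assumes number_field_k: "number_field k" and number_field_l: "number_field l" and subset: "k \<subseteq> l"
begin

sublocale finite_extension k l
  by (rule number_field_finite_extension[OF number_field_subfield[OF number_field_k] number_field_l
    subset])

lemma norm_mem: "u \<in> l \<Longrightarrow> field_norm l k u \<in> k"
  using emb_field_norm(1) embs_nonempty[OF number_field_k] by blast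

lemma norm_mult:
  assumes u: "u \<in> l" and v: "v \<in> l"
  shows "field_norm l k (u * v) = field_norm l k u * field_norm l k v"
proof -
  obtain \<sigma> where \<sigma>: "\<sigma> \<in> embs k" using embs_nonempty[OF number_field_k] by blast
  have uv: "u * v \<in> l" by (rule subfield_mult[OF subfield_l u v])
  have "\<sigma> (field_norm l k (u * v)) = (\<Prod>\<tau>\<in>ext_embs l k \<sigma>. \<tau> u * \<tau> v)"
    unfolding emb_field_norm(2)[OF uv \<sigma>]
    by (intro prod.cong refl emb_mult[OF subfield_l _ u v] ext_embsD(1))
  also have "\<dots> = \<sigma> (field_norm l k u * field_norm l k v)"
    by (simp add: prod.distrib emb_field_norm(2)[OF u \<sigma>] emb_field_norm(2)[OF v \<sigma>]
        emb_mult[OF subfield_k \<sigma> norm_mem[OF u] norm_mem[OF v]])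
  finally show ?thesis
    using emb_eq_iff[OF subfield_k \<sigma> norm_mem[OF uv] subfield_mult[OF subfield_k norm_mem[OF u]
      norm_mem[OF v]]]
    by simp
qed

lemma norm_base:
  obtains d where "d > 0" "\<And>u. u \<in> k \<Longrightarrow> field_norm l k u = u ^ d"
proof -
  obtain d where d: "d > 0" "\<And>\<sigma>. \<sigma> \<in> embs k \<Longrightarrow> card (ext_embs l k \<sigma>) = d"
    using card_ext_embs_const by blast
  have "field_norm l k u = u ^ d" if u: "u \<in> k" for u
  proof -
    obtain \<sigma> where \<sigma>: "\<sigma> \<in> embs k" using embs_nonempty[OF number_field_k] by blast
    have ul: "u \<in> l" using u subset by blast
    have "\<sigma> (field_norm l k u) = (\<Prod>\<tau>\<in>ext_embs l k \<sigma>. \<sigma> u)"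
      unfolding emb_field_norm(2)[OF ul \<sigma>] by (intro prod.cong refl) (simp add: ext_embsD(2) u)
    also have "\<dots> = \<sigma> (u ^ d)" by (simp add: d(2)[OF \<sigma>] emb_power[OF subfield_k \<sigma> u])
    finally show ?thesis
      using emb_eq_iff[OF subfield_k \<sigma> norm_mem[OF ul] subfield_power[OF subfield_k u]] by simp
  qed
  thus ?thesis using that d(1) by blast
qed

lemma norm_one: "field_norm l k 1 = 1"
  using norm_base subfield_one[OF subfield_k] by (metis power_one)

lemma algebraic_int_norm:
  assumes u: "u \<in> l" "algebraic_int u" shows "algebraic_int (field_norm l k u)"
proof -
  obtain \<sigma> where \<sigma>: "\<sigma> \<in> embs k" using embs_nonempty[OF number_field_k] by blast
  have "algebraic_int (\<sigma> (field_norm l k u))"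
    unfolding emb_field_norm(2)[OF u(1) \<sigma>]
    by (intro algebraic_int_prod)
      (simp add: ext_embsD(1) algebraic_int_emb_iff[OF subfield_l _ u(1)] u(2))
  thus ?thesis using algebraic_int_emb_iff[OF subfield_k \<sigma> norm_mem[OF u(1)]] by simp
qed

lemma norm_units:
  assumes u: "u \<in> units l" shows "field_norm l k u \<in> units k"
proof -
  have u_mem: "u \<in> l" "inverse u \<in> l"
    using units_mem[OF number_field_l u] units_mem[OF number_field_l units_inverse[OF number_field_l u]] .
  have inverse: "field_norm l k u * field_norm l k (inverse u) = 1"
    using norm_mult[OF u_mem] units_nonzero[OF number_field_l u] norm_one by simp
  hence "inverse (field_norm l k u) = field_norm l k (inverse u)" by (rule inverse_unique)
  thus ?thesis
    using inverse u algebraic_int_norm u_mem norm_mem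
    by (auto simp: units_iff[OF subfield_k] units_iff[OF subfield_l])
qed

lemma units_subset: "units k \<subseteq> units l"
  using subset by (auto simp: units_iff[OF subfield_k] units_iff[OF subfield_l])

lemma restrict_arch_place:
  assumes w: "w \<in> arch_places l" shows "restrict w k \<in> arch_places k"
proof -
  have "absolute_value k (restrict w k)"
    using arch_place_absval[OF w] subset subfield_add[OF subfield_k] subfield_mult[OF subfield_k]
    unfolding absolute_value_def by (auto simp: subset_iff)
  thus ?thesis using arch_place_of_rat[OF w] subfield_of_rat[OF subfield_k]
    by (simp add: arch_places_def)
qed

lemma restrict_emb_abs: "emb_abs k (restrict \<tau> k) = restrict (emb_abs l \<tau>) k"
  using subset by (auto simp: emb_abs_def fun_eq_iff)

lemma arch_place_extends:
  assumes v: "v \<in> arch_places k" obtains w where "w \<in> arch_places l" "restrict w k = v"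
proof -
  obtain \<sigma> where \<sigma>: "\<sigma> \<in> embs k" "v = emb_abs k \<sigma>" using v arch_places_eq[OF number_field_k] by blast
  obtain \<tau> where "\<tau> \<in> ext_embs l k \<sigma>" using ext_embs_nonempty[OF \<sigma>(1)] by blast
  hence "\<tau> \<in> embs l" "restrict \<tau> k = \<sigma>" using ext_embs_eq_restrict[OF subset subfield_k \<sigma>(1)] by auto
  thus ?thesis
    using that[of "emb_abs l \<tau>"] emb_abs_arch_place[OF subfield_l] restrict_emb_abs[of \<tau>] \<sigma>(2)
    by simp
qed

lemma ln_cmod_emb_norm:
  assumes u: "u \<in> units l" and \<sigma>: "\<sigma> \<in> embs k"
  shows "ln (cmod (\<sigma> (field_norm l k u))) = (\<Sum>\<tau>\<in>ext_embs l k \<sigma>. ln (cmod (\<tau> u)))"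
proof -
  note u_mem = units_mem[OF number_field_l u]
  have "cmod (\<sigma> (field_norm l k u)) = (\<Prod>\<tau>\<in>ext_embs l k \<sigma>. cmod (\<tau> u))"
    unfolding emb_field_norm(2)[OF u_mem \<sigma>] by (rule prod_norm[symmetric])
  also have "ln \<dots> = (\<Sum>\<tau>\<in>ext_embs l k \<sigma>. ln (cmod (\<tau> u)))"
  proof (rule ln_prod[OF finite_ext_embs])
    fix \<tau> assume "\<tau> \<in> ext_embs l k \<sigma>"
    thus "cmod (\<tau> u) \<noteq> 0"
      using emb_eq_0_iff[OF subfield_l ext_embsD(1) u_mem] units_nonzero[OF number_field_l u] by simp
  qed
  finally show ?thesis .
qed

lemma rel_sum_eq_0_outside: "v \<notin> arch_places k \<Longrightarrow> rel_sum l k f v = 0"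
  using restrict_arch_place unfolding fiber_sum_def by (intro sum.neutral) auto

text \<open>
  At \<open>v\<close>, both sides are the sum of \<open>ln (cmod (\<tau> u))\<close> over the embeddings \<open>\<tau>\<close> of \<open>l\<close> that
  induce \<open>v\<close> on \<open>k\<close>.
\<close>

lemma rel_sum_log_vec:
  assumes u: "u \<in> units l" shows "rel_sum l k (log_vec l u) = log_vec k (field_norm l k u)"
proof
  fix v
  show "rel_sum l k (log_vec l u) v = log_vec k (field_norm l k u) v"
  proof (cases "v \<in> arch_places k")
    case True
    note u_mem = units_mem[OF number_field_l u]
    define T where "T = {\<tau> \<in> embs l. restrict (emb_abs l \<tau>) k = v}"
    have finite_T: "finite T" unfolding T_def using finite_embs[OF number_field_l] by simp
    have "rel_sum l k (log_vec l u) v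
        = (\<Sum>w\<in>{w \<in> arch_places l. restrict w k = v}. \<Sum>\<tau>\<in>{\<tau> \<in> T. emb_abs l \<tau> = w}. ln (cmod (\<tau> u)))"
      unfolding fiber_sum_def
      by (auto simp: log_vec_eq_sum[OF number_field_l u_mem] place_embs_def T_def intro!: sum.cong)
    also have "\<dots> = (\<Sum>\<tau>\<in>T. ln (cmod (\<tau> u)))"
      by (rule sum.group[OF finite_T])
        (use finite_arch_places[OF number_field_l] emb_abs_arch_place[OF subfield_l]
          in \<open>auto simp: T_def\<close>)
    also have "\<dots> = (\<Sum>\<sigma>\<in>place_embs k v. \<Sum>\<tau>\<in>{\<tau> \<in> T. restrict \<tau> k = \<sigma>}. ln (cmod (\<tau> u)))"
      by (rule sum.group[symmetric, OF finite_T])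
        (use finite_embs[OF number_field_k] restrict_emb[OF subset subfield_k] restrict_emb_abs
          in \<open>auto simp: T_def place_embs_def\<close>)
    also have "\<dots> = (\<Sum>\<sigma>\<in>place_embs k v. ln (cmod (\<sigma> (field_norm l k u))))"
    proof (rule sum.cong[OF refl])
      fix \<sigma> assume "\<sigma> \<in> place_embs k v"
      hence \<sigma>: "\<sigma> \<in> embs k" "emb_abs k \<sigma> = v" by (auto simp: place_embs_def)
      hence "{\<tau> \<in> T. restrict \<tau> k = \<sigma>} = ext_embs l k \<sigma>"
        unfolding ext_embs_eq_restrict[OF subset subfield_k \<sigma>(1)] T_def restrict_emb_abs[symmetric]
        by auto
      thus "(\<Sum>\<tau>\<in>{\<tau> \<in> T. restrict \<tau> k = \<sigma>}. ln (cmod (\<tau> u))) = ln (cmod (\<sigma> (field_norm l k u)))"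
        by (simp add: ln_cmod_emb_norm[OF u \<sigma>(1)])
    qed
    also have "\<dots> = log_vec k (field_norm l k u) v"
      by (rule log_vec_eq_sum[OF number_field_k norm_mem[OF u_mem] True, symmetric])
    finally show ?thesis .
  qed (simp add: rel_sum_eq_0_outside log_vec_def)
qed

lemma rel_sum_log_vec_base:
  assumes "field_norm l k u = u ^ d" "u \<in> units k"
  shows "rel_sum l k (log_vec l u) = of_nat d *\<^sub>R log_vec k u"
  using rel_sum_log_vec[of u] units_subset assms log_vec_power[OF number_field_k assms(2)] by auto

lemma torsion_subset: "torsion (unit_group k) \<subseteq> torsion (unit_group l)"
  using units_subset by (auto simp: torsion_def unit_group_pow unit_group_simps units_def)

lemma norm_torsion:
  assumes "t \<in> torsion (unit_group l)" shows "field_norm l k t \<in> torsion (unit_group k)"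
proof -
  have t: "t \<in> units l" "log_vec l t = 0" using assms by (auto simp: torsion_iff[OF number_field_l])
  have "log_vec k (field_norm l k t) = 0"
    using rel_sum_log_vec[OF t(1)] t(2) linear_0[OF linear_fiber_sum] by metis
  thus ?thesis using norm_units[OF t(1)] by (simp add: torsion_iff[OF number_field_k])
qed

lemma F_norm_unit_coset:
  assumes u: "u \<in> units l" shows "F_norm l k (unit_coset l u) = unit_coset k (field_norm l k u)"
proof (intro equalityI subsetI)
  fix x assume "x \<in> F_norm l k (unit_coset l u)"
  then obtain t s where t: "t \<in> torsion (unit_group k)" and s: "s \<in> torsion (unit_group l)"
    and x: "x = t * field_norm l k (s * u)"
    by (auto simp: F_norm_def set_mult_def unit_group_simps mem_unit_coset)
  have "s \<in> l" using s units_mem[OF number_field_l] by (simp add: torsion_iff[OF number_field_l])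
  hence "x = (t * field_norm l k s) * field_norm l k u"
    unfolding x using norm_mult[OF _ units_mem[OF number_field_l u]] by (simp add: mult.assoc)
  thus "x \<in> unit_coset k (field_norm l k u)"
    unfolding mem_unit_coset using torsion_mult[OF number_field_k t norm_torsion[OF s]] by blast
next
  fix x assume "x \<in> unit_coset k (field_norm l k u)"
  then obtain t where "t \<in> torsion (unit_group k)" "x = t * field_norm l k u"
    by (auto simp: mem_unit_coset)
  thus "x \<in> F_norm l k (unit_coset l u)"
    using unit_coset_self[OF number_field_l, of u]
    by (auto simp: F_norm_def set_mult_def unit_group_simps)
qed

lemma F_embed_unit_coset: "F_embed l (unit_coset k b) = unit_coset l b"
proof (intro equalityI subsetI)
  fix x assume "x \<in> F_embed l (unit_coset k b)"
  then obtain t s where t: "t \<in> torsion (unit_group l)" and s: "s \<in> torsion (unit_group k)"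
    and x: "x = t * (s * b)"
    by (auto simp: F_embed_def set_mult_def unit_group_simps mem_unit_coset)
  have "t * s \<in> torsion (unit_group l)"
    using torsion_mult[OF number_field_l t] torsion_subset s by blast
  thus "x \<in> unit_coset l b" unfolding mem_unit_coset x by (metis mult.assoc)
next
  fix x assume "x \<in> unit_coset l b"
  then obtain t where "t \<in> torsion (unit_group l)" "x = t * b" by (auto simp: mem_unit_coset)
  thus "x \<in> F_embed l (unit_coset k b)"
    using unit_coset_self[OF number_field_k, of b]
    by (auto simp: F_embed_def set_mult_def unit_group_simps)
qed

sublocale Fl: log_group "units_mod_tor l" "F_log l"
  by (rule log_group_units_mod_tor[OF number_field_l])

sublocale Fk: log_group "units_mod_tor k" "F_log k"
  by (rule log_group_units_mod_tor[OF number_field_k])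

definition rel_carrier :: "'a set set" where
  "rel_carrier = {A \<in> carrier (units_mod_tor l). rel_sum l k (F_log l A) = 0}"

lemma rel_units_eq: "rel_units l k = (units_mod_tor l)\<lparr>carrier := rel_carrier\<rparr>"
proof -
  have "F_norm l k A = \<one>\<^bsub>units_mod_tor k\<^esub> \<longleftrightarrow> rel_sum l k (F_log l A) = 0"
    if A: "A \<in> carrier (units_mod_tor l)" for A
  proof -
    obtain u where u: "u \<in> units l" "A = unit_coset l u"
      using A by (auto simp: carrier_units_mod_tor[OF number_field_l])
    have norm: "field_norm l k u \<in> units k" by (rule norm_units[OF u(1)])
    hence "F_norm l k A = \<one>\<^bsub>units_mod_tor k\<^esub> \<longleftrightarrow> F_log k (unit_coset k (field_norm l k u)) = 0"
      using Fk.lg_eq_zero_iff[of "unit_coset k (field_norm l k u)"]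
        carrier_units_mod_tor[OF number_field_k]
      unfolding u(2) F_norm_unit_coset[OF u(1)] by blast
    thus ?thesis
      by (simp add: u F_log_unit_coset[OF number_field_k norm] F_log_unit_coset[OF number_field_l]
        rel_sum_log_vec)
  qed
  hence "{A \<in> carrier (units_mod_tor l). F_norm l k A = \<one>\<^bsub>units_mod_tor k\<^esub>} = rel_carrier"
    unfolding rel_carrier_def by (intro Collect_cong conj_cong refl)
  thus ?thesis unfolding rel_units_def by simp
qed

lemma subgroup_rel_carrier: "subgroup rel_carrier (units_mod_tor l)"
proof (rule Fl.subgroupI)
  show "rel_carrier \<subseteq> carrier (units_mod_tor l)" by (auto simp: rel_carrier_def)
  have "\<one>\<^bsub>units_mod_tor l\<^esub> \<in> rel_carrier"
    by (simp add: rel_carrier_def Fl.lg_one linear_0[OF linear_fiber_sum])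
  thus "rel_carrier \<noteq> {}" by blast
  fix a assume a: "a \<in> rel_carrier"
  thus "inv\<^bsub>units_mod_tor l\<^esub> a \<in> rel_carrier"
    by (simp add: rel_carrier_def Fl.lg_inv linear_neg[OF linear_fiber_sum])
  fix b assume "b \<in> rel_carrier"
  with a show "a \<otimes>\<^bsub>units_mod_tor l\<^esub> b \<in> rel_carrier"
    by (simp add: rel_carrier_def Fl.lg_mult linear_add[OF linear_fiber_sum])
qed

sublocale E: log_group "rel_units l k" "F_log l"
  unfolding rel_units_eq by (rule Fl.log_group_subgroup[OF subgroup_rel_carrier])

lemma carrier_rel_units: "carrier (rel_units l k) = rel_carrier"
  by (simp add: rel_units_eq)

lemma F_log_rel_units:
  "F_log l ` carrier (rel_units l k) = {f \<in> log_vec l ` units l. rel_sum l k f = 0}"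
  unfolding carrier_rel_units rel_carrier_def F_log_image[OF number_field_l, symmetric] by blast

lemma F_embed_mem:
  assumes "A \<in> carrier (units_mod_tor k)" shows "F_embed l A \<in> carrier (units_mod_tor l)"
  using assms units_subset F_embed_unit_coset
  by (auto simp: carrier_units_mod_tor[OF number_field_k] carrier_units_mod_tor[OF number_field_l])

lemma rel_sum_F_embed:
  obtains d :: int where "d \<noteq> 0"
    "\<And>A. A \<in> carrier (units_mod_tor k) \<Longrightarrow> rel_sum l k (F_log l (F_embed l A)) = of_int d *\<^sub>R F_log k A"
proof -
  obtain d where d: "d > 0" "\<And>u. u \<in> k \<Longrightarrow> field_norm l k u = u ^ d" using norm_base by blast
  show ?thesis
  proof (rule that[of "int d"])
    show "int d \<noteq> 0" using d(1) by simp
    fix A assume "A \<in> carrier (units_mod_tor k)"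
    then obtain u where u: "u \<in> units k" "A = unit_coset k u"
      by (auto simp: carrier_units_mod_tor[OF number_field_k])
    thus "rel_sum l k (F_log l (F_embed l A)) = of_int (int d) *\<^sub>R F_log k A"
      using rel_sum_log_vec_base[OF d(2)[OF units_mem[OF number_field_k u(1)]] u(1)] units_subset
      by (auto simp: F_embed_unit_coset F_log_unit_coset[OF number_field_k]
        F_log_unit_coset[OF number_field_l])
  qed
qed

lemma mult_independent_union:
  assumes \<beta>: "mult_independent (units_mod_tor k) I \<beta>" and \<psi>: "mult_independent (rel_units l k) J \<psi>"
  shows "mult_independent (units_mod_tor l) (I <+> J) (case_sum (\<lambda>i. F_embed l (\<beta> i)) \<psi>)"
proof -
  have I: "finite I" "\<And>i. i \<in> I \<Longrightarrow> \<beta> i \<in> carrier (units_mod_tor k)"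
      "int_independent I (\<lambda>i. F_log k (\<beta> i))"
    using \<beta> unfolding Fk.mult_independent_iff by auto
  have J: "finite J" "\<And>j. j \<in> J \<Longrightarrow> \<psi> j \<in> rel_carrier" "int_independent J (\<lambda>j. F_log l (\<psi> j))"
    using \<psi> unfolding E.mult_independent_iff carrier_rel_units by auto
  obtain d :: int where d: "d \<noteq> 0"
    "\<And>A. A \<in> carrier (units_mod_tor k) \<Longrightarrow> rel_sum l k (F_log l (F_embed l A)) = of_int d *\<^sub>R F_log k A"
    using rel_sum_F_embed by blast
  have "int_independent I (\<lambda>i. rel_sum l k (F_log l (F_embed l (\<beta> i))))"
    using int_independent_scale[OF I(3) d(1)] d(2)[OF I(2)] by (simp cong: int_independent_cong)
  moreover have "rel_sum l k (F_log l (\<psi> j)) = 0" if "j \<in> J" for j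
    using J(2)[OF that] by (simp add: rel_carrier_def)
  ultimately have
    "int_independent (I <+> J) (case_sum (\<lambda>i. F_log l (F_embed l (\<beta> i))) (\<lambda>j. F_log l (\<psi> j)))"
    by (intro int_independent_case_sum[OF linear_fiber_sum] I(1) J(1,3))
  moreover have "case_sum (\<lambda>i. F_log l (F_embed l (\<beta> i))) (\<lambda>j. F_log l (\<psi> j))
      = (\<lambda>x. F_log l (case_sum (\<lambda>i. F_embed l (\<beta> i)) \<psi> x))"
    by (rule ext) (simp split: sum.split)
  moreover have "case_sum (\<lambda>i. F_embed l (\<beta> i)) \<psi> \<in> I <+> J \<rightarrow> carrier (units_mod_tor l)"
    using F_embed_mem[OF I(2)] J(2) by (auto simp: rel_carrier_def)
  ultimately show ?thesis unfolding Fl.mult_independent_iff using I(1) J(1) by simp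
qed

end


section \<open>Regulators\<close>

lemma log_det_eq_fdet:
  assumes "length ws = length us" "set ws \<subseteq> arch_places L"
  shows "log_det L ws us = \<bar>fdet (length us) (\<lambda>i j. F_log L (us ! j) (ws ! i))\<bar>"
proof -
  have "ws ! i \<in> arch_places L" if "i < length us" for i using assms that by (metis nth_mem subsetD)
  hence "mat (length ws) (length us)
        (\<lambda>(i, j). real (local_degree L (ws ! i)) * ln (F_abs (ws ! i) (us ! j)))
      = mat (length us) (length us) (\<lambda>(i, j). F_log L (us ! j) (ws ! i))"
    using assms(1) by (intro eq_matI) (auto simp: F_log_def)
  thus ?thesis by (simp add: log_det_def fdet_def)
qed

lemma log_det_nonsquare: "length ws \<noteq> length us \<Longrightarrow> log_det L ws us = 0"
  by (simp add: log_det_def Determinant.det_def)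

lemma log_det_nonneg: "log_det L ws us \<ge> 0"
  by (simp add: log_det_def)

lemma regulator_eq_log_det:
  assumes L: "number_field L"
  obtains w0 ws us where "w0 \<in> arch_places L" "distinct ws" "set ws = arch_places L - {w0}"
    "group_basis (units_mod_tor L) us" "regulator L = log_det L ws us"
proof -
  let ?P = "\<lambda>R. \<exists>w0 ws us. w0 \<in> arch_places L \<and> distinct ws \<and> set ws = arch_places L - {w0} \<and>
     group_basis (units_mod_tor L) us \<and> R = log_det L ws us"
  interpret log_group "units_mod_tor L" "F_log L" by (rule log_group_units_mod_tor[OF L])
  obtain n b where "lattice_basis (log_vec L ` units L) n b"
    using discrete_lattice_has_basis[OF log_lattice_discrete[OF L] finite_arch_places[OF L]] .
  then obtain us where us: "group_basis (units_mod_tor L) us"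
    using group_basis_exists[of n b] unfolding F_log_image[OF L] by blast
  obtain w0 where w0: "w0 \<in> arch_places L" using arch_places_nonempty[OF L] by blast
  obtain ws where ws: "set ws = arch_places L - {w0}" "distinct ws"
    using finite_distinct_list[of "arch_places L - {w0}"] finite_arch_places[OF L] by auto
  have "?P (log_det L ws us)" using us w0 ws by blast
  hence "?P (regulator L)" unfolding regulator_def by (rule someI)
  thus ?thesis using that by blast
qed

lemma regulator_nonneg: "number_field L \<Longrightarrow> regulator L \<ge> 0"
  using regulator_eq_log_det log_det_nonneg by metis

context number_field_extension
begin

sublocale lattice_fibration "arch_places l" "arch_places k" "\<lambda>w. restrict w k"
  "log_vec l ` units l" "log_vec k ` units k"
proof
  show "finite (arch_places l)" "finite (arch_places k)"
    by (rule finite_arch_places[OF number_field_l] finite_arch_places[OF number_field_k])+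
  show "(\<lambda>w. restrict w k) ` arch_places l \<subseteq> arch_places k" using restrict_arch_place by blast
  show "int_subspace (log_vec l ` units l)"
    by (rule discrete_lattice_subspace[OF log_lattice_discrete[OF number_field_l]])
  show "discrete_lattice (arch_places k) (log_vec k ` units k)"
    by (rule log_lattice_discrete[OF number_field_k])
  show "(\<Sum>w\<in>arch_places l. f w) = 0" if "f \<in> log_vec l ` units l" for f
    using that sum_log_vec[OF number_field_l] by auto
  show "rel_sum l k f \<in> log_vec k ` units k" if "f \<in> log_vec l ` units l" for f
    using that rel_sum_log_vec norm_units by auto
  obtain d where d: "d > 0" "\<And>u. u \<in> k \<Longrightarrow> field_norm l k u = u ^ d" using norm_base by blast
  have "of_int (int d) *\<^sub>R log_vec k u \<in> rel_sum l k ` log_vec l ` units l" if "u \<in> units k" for u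
    using rel_sum_log_vec_base[OF d(2)[OF units_mem[OF number_field_k that]] that] that units_subset
    by (auto simp: image_image intro!: image_eqI[of _ _ u])
  thus "\<exists>d::int. d \<noteq> 0 \<and> (\<forall>g\<in>log_vec k ` units k. of_int d *\<^sub>R g \<in> rel_sum l k ` log_vec l ` units l)"
    using d(1) by (intro exI[of _ "int d"]) auto
qed

lemma rel_regulator_eq_log_det:
  obtains c ws us where "\<And>v. v \<in> arch_places k \<Longrightarrow> c v \<in> arch_places l"
    "\<And>v. v \<in> arch_places k \<Longrightarrow> restrict (c v) k = v"
    "distinct ws" "set ws = arch_places l - c ` arch_places k"
    "group_basis (rel_units l k) us" "rel_regulator l k = log_det l ws us"
proof -
  let ?P = "\<lambda>R. \<exists>c ws us. (\<forall>v\<in>arch_places k. c v \<in> arch_places l \<and> restrict (c v) k = v) \<and>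
     distinct ws \<and> set ws = arch_places l - c ` arch_places k \<and>
     group_basis (rel_units l k) us \<and> R = log_det l ws us"
  have "discrete_lattice (arch_places l) (F_log l ` carrier (rel_units l k))"
    by (rule discrete_lattice_subset[OF log_lattice_discrete[OF number_field_l]
          E.int_subspace_lg_image[OF E.subgroup_self]]) (auto simp: F_log_rel_units)
  then obtain n b where "lattice_basis (F_log l ` carrier (rel_units l k)) n b"
    using discrete_lattice_has_basis finite_arch_places[OF number_field_l] by blast
  then obtain us where us: "group_basis (rel_units l k) us" using E.group_basis_exists by blast
  have "\<forall>v\<in>arch_places k. \<exists>w. w \<in> arch_places l \<and> restrict w k = v" using arch_place_extends by metis
  then obtain c where c: "\<forall>v\<in>arch_places k. c v \<in> arch_places l \<and> restrict (c v) k = v"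
    by (rule bchoice[THEN exE])
  obtain ws where ws: "set ws = arch_places l - c ` arch_places k" "distinct ws"
    using finite_distinct_list[of "arch_places l - c ` arch_places k"]
      finite_arch_places[OF number_field_l]
    by auto
  have "?P (log_det l ws us)" using us c ws by blast
  hence "?P (rel_regulator l k)" unfolding rel_regulator_def by (rule someI)
  thus ?thesis using that by blast
qed

theorem regulator_mult_rel_regulator_le: "regulator k * rel_regulator l k \<le> regulator l"
proof -
  obtain v0 vs uk where reg_k: "v0 \<in> arch_places k" "distinct vs" "set vs = arch_places k - {v0}"
    "group_basis (units_mod_tor k) uk" "regulator k = log_det k vs uk"
    using regulator_eq_log_det[OF number_field_k] .
  obtain w0 ws ul where reg_l: "w0 \<in> arch_places l" "distinct ws" "set ws = arch_places l - {w0}"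
    "group_basis (units_mod_tor l) ul" "regulator l = log_det l ws ul"
    using regulator_eq_log_det[OF number_field_l] .
  obtain c ss ue where reg_E: "\<And>v. v \<in> arch_places k \<Longrightarrow> c v \<in> arch_places l"
    "\<And>v. v \<in> arch_places k \<Longrightarrow> restrict (c v) k = v"
    "distinct ss" "set ss = arch_places l - c ` arch_places k"
    "group_basis (rel_units l k) ue" "rel_regulator l k = log_det l ss ue"
    using rel_regulator_eq_log_det by blast
  show ?thesis
  proof (cases "length vs = length uk \<and> length ss = length ue")
    case False
    hence "regulator k * rel_regulator l k = 0"
      unfolding reg_k(5) reg_E(6) using log_det_nonsquare by fastforce
    thus ?thesis using regulator_nonneg[OF number_field_l] by linarith
  next
    case True
    have bases:
      "lattice_basis (log_vec l ` units l) (length ul) (\<lambda>i. F_log l (ul ! i))"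
      "lattice_basis (log_vec k ` units k) (length uk) (\<lambda>i. F_log k (uk ! i))"
      "lattice_basis {f \<in> log_vec l ` units l. rel_sum l k f = 0} (length ue) (\<lambda>i. F_log l (ue ! i))"
      using Fl.lattice_basis_if_group_basis[OF reg_l(4)] Fk.lattice_basis_if_group_basis[OF reg_k(4)]
        E.lattice_basis_if_group_basis[OF reg_E(5)]
      by (simp_all add: F_log_image[OF number_field_l] F_log_image[OF number_field_k] F_log_rel_units)
    have enumerations:
      "bij_betw (\<lambda>i. ws ! i) {..<length ws} (arch_places l - {w0})"
      "bij_betw (\<lambda>i. vs ! i) {..<length uk} (arch_places k - {v0})"
      "bij_betw (\<lambda>i. ss ! i) {..<length ue} (arch_places l - c ` arch_places k)"
      using bij_betw_nth[OF reg_l(2) refl refl] bij_betw_nth[OF reg_k(2) refl refl]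
        bij_betw_nth[OF reg_E(3) refl refl] reg_l(3) reg_k(3) reg_E(4) True by simp_all
    note covolumes = fdet_mult_fdet_kernel_le[OF reg_E(1,2) reg_l(1) reg_k(1) enumerations bases]
    show ?thesis
      using covolumes(2) True covolumes(1) reg_k(3) reg_l(3) reg_E(4)
      unfolding reg_k(5) reg_l(5) reg_E(6) by (simp add: log_det_eq_fdet)
  qed
qed

end

lemma fact_mult_fact_le: "fact m * fact n \<le> (fact (m + n) :: real)"
proof -
  have "fact m * fact n \<le> (fact (m + n) :: nat)" by (rule dvd_imp_le[OF fact_fact_dvd_fact]) simp
  hence "real (fact m * fact n) \<le> real (fact (m + n))" by (rule of_nat_mono)
  thus ?thesis by simp
qed

theorem theorem1p4:
  fixes k l :: "'a::field_char_0 set"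
    and \<beta> \<psi> :: "nat \<Rightarrow> 'a set"
  assumes "number_field k" and "number_field l" and "k \<subset> l"
    and "k \<noteq> \<rat>" and "\<not> imaginary_quadratic k"
    and "unit_rank l > unit_rank k"
    and "mult_independent (units_mod_tor k) {1..unit_rank k} \<beta>"
    and "(\<Prod>i=1..unit_rank k. real (field_degree k) * F_height k (\<beta> i))
           \<le> fact (unit_rank k) * regulator k"
    and "mult_independent (rel_units l k) {1..rel_unit_rank l k} \<psi>"
    and "(\<Prod>j=1..rel_unit_rank l k. real (field_degree l) * F_height l (\<psi> j))
           \<le> fact (rel_unit_rank l k) * rel_regulator l k"
  shows "mult_independent (units_mod_tor l) ({1..unit_rank k} <+> {1..rel_unit_rank l k})
           (case_sum (\<lambda>i. F_embed l (\<beta> i)) \<psi>)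
         \<and> (\<Prod>i=1..unit_rank k. real (field_degree k) * F_height k (\<beta> i))
           * (\<Prod>j=1..rel_unit_rank l k. real (field_degree l) * F_height l (\<psi> j))
           \<le> fact (unit_rank l) * regulator l"
proof
  interpret number_field_extension k l
    by (rule number_field_extension.intro) (use assms(1-3) in auto)
  show "mult_independent (units_mod_tor l) ({1..unit_rank k} <+> {1..rel_unit_rank l k})
      (case_sum (\<lambda>i. F_embed l (\<beta> i)) \<psi>)"
    by (rule mult_independent_union[OF assms(7,9)])
  let ?r = "unit_rank k" and ?s = "rel_unit_rank l k"
  let ?P = "\<Prod>i=1..?r. real (field_degree k) * F_height k (\<beta> i)"
  let ?Q = "\<Prod>j=1..?s. real (field_degree l) * F_height l (\<psi> j)"
  have "?Q \<ge> 0"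
    using assms(9) unfolding E.mult_independent_iff carrier_rel_units rel_carrier_def
    by (intro prod_nonneg mult_nonneg_nonneg F_height_nonneg[OF number_field_l]) auto
  hence "?P * ?Q \<le> (fact ?r * regulator k) * (fact ?s * rel_regulator l k)"
    using assms(8,10) regulator_nonneg[OF number_field_k] by (intro mult_mono) auto
  also have "\<dots> = (fact ?r * fact ?s) * (regulator k * rel_regulator l k)" by (simp only: mult_ac)
  also have "\<dots> \<le> (fact ?r * fact ?s) * regulator l"
    by (intro mult_left_mono regulator_mult_rel_regulator_le) simp
  also have "\<dots> \<le> fact (?r + ?s) * regulator l"
    by (intro mult_right_mono fact_mult_fact_le regulator_nonneg[OF number_field_l])
  also have "?r + ?s = unit_rank l" using assms(6) by (simp add: rel_unit_rank_def)
  finally show "?P * ?Q \<le> fact (unit_rank l) * regulator l" .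
qed

end
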